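(* Let $E$ be an infinite-dimensional separable real Hilbert space and let $\mathcal E=\{e_i\}$, $\mathcal F=\{f_j\}$ be orthonormal bases of $E$. Then $\lambda_{\mathcal E}|_{\mathcal R_{\mathcal E}\cap\mathcal R_{\mathcal F}}=\lambda_{\mathcal F}|_{\mathcal R_{\mathcal E}\cap\mathcal R_{\mathcal F}}$. In particular, if $$\prod_{j=1}^\infty\Bigl(\sum_{i=1}^\infty|(e_i,f_j)|\Bigr)<+\infty,$$ then $\mathcal R_{\mathcal E}=\mathcal R_{\mathcal F}$ and $\lambda_{\mathcal E}=\lambda_{\mathcal F}$. If this condition is violated, then $\lambda_{\mathcal F}(A)=\lambda_{\mathcal E}(A)=0$ for every set $A\in\mathcal R_{\mathcal E}\cap\mathcal R_{\mathcal F}$.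
   Context: For an orthonormal basis $\mathcal E=\{e_j\}_{j\in\mathbb N}$ of $E$, $\mathcal K_{\mathcal E}$ denotes the collection consisting of $\varnothing$ and of all nonempty sets $\Pi=\{x\in E:\ (x,e_j)\in[a_j,b_j)\ \forall j\in\mathbb N\}$ with $a,b\in\ell_\infty$ and $\sum_{j=1}^\infty\max\{0,\ln(b_j-a_j)\}<\infty$ (measurable rectangles). Put $\lambda_{\mathcal E}(\varnothing)=0$ and $\lambda_{\mathcal E}(\Pi)=\exp\bigl[\sum_{j=1}^\infty\ln(b_j-a_j)\bigr]\in[0,+\infty)$ (equal to $0$ if the sum is $-\infty$). It is known that $\lambda_{\mathcal E}$ extends uniquely to a finitely additive shift-invariant measure on the ring $r_{\mathcal E}$ (closed under finite unions and differences) generated by $\mathcal K_{\mathcal E}$. $\mathcal R_{\mathcal E}$ is the ring of all $A\subset E$ such that for every $\epsilon>0$ there are $A_*,A^*\in r_{\mathcal E}$ with $A_*\subset A\subset A^*$ and $\lambda_{\mathcal E}(A^*\setminus A_* )<\epsilon$, and $\lambda_{\mathcal E}(A)=\inf\{\lambda_{\mathcal E}(A^* ):A^*\in r_{\mathcal E},A^*\supset A\}$ for $A\in\mathcal R_{\mathcal E}$. The factors $\sum_i|(e_i,f_j)|$ lie in $[1,+\infty]$, so the product is always defined in $[1,+\infty]$. *)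

theory Defs
  imports "HOL-Analysis.Analysis"
begin

definition orthonormal_basis :: "(nat \<Rightarrow> 'a::{real_inner, complete_space}) \<Rightarrow> bool" where
  "orthonormal_basis e \<longleftrightarrow>
     (\<forall>i j. e i \<bullet> e j = (if i = j then 1 else 0)) \<and> closure (span (range e)) = UNIV"

definition rectangle :: "(nat \<Rightarrow> 'a::real_inner) \<Rightarrow> (nat \<Rightarrow> real) \<Rightarrow> (nat \<Rightarrow> real) \<Rightarrow> 'a set" where
  "rectangle e a b = {x. \<forall>j. x \<bullet> e j \<in> {a j..<b j}}"

text \<open>
  A nonempty rectangle has \<open>a j < b j\<close> for all \<open>j\<close>, so the logarithms below are only used at
  positive arguments.
\<close>

definition rectangle_bounds ::
    "(nat \<Rightarrow> 'a::real_inner) \<Rightarrow> (nat \<Rightarrow> real) \<Rightarrow> (nat \<Rightarrow> real) \<Rightarrow> bool" where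
  "rectangle_bounds e a b \<longleftrightarrow>
     rectangle e a b \<noteq> {} \<and> bounded (range a) \<and> bounded (range b) \<and>
     summable (\<lambda>j. max 0 (ln (b j - a j)))"

definition measurable_rectangles :: "(nat \<Rightarrow> 'a::real_inner) \<Rightarrow> 'a set set" where
  "measurable_rectangles e = insert {} {rectangle e a b | a b. rectangle_bounds e a b}"

text \<open>
  Under \<^const>\<open>rectangle_bounds\<close> the positive parts of \<open>ln (b j - a j)\<close> are summable, so the
  series either converges or diverges to \<open>-\<infinity>\<close>; the second case is the \<open>else\<close> branch.
\<close>

definition rectangle_volume :: "(nat \<Rightarrow> real) \<Rightarrow> (nat \<Rightarrow> real) \<Rightarrow> real" where
  "rectangle_volume a b =
     (if summable (\<lambda>j. ln (b j - a j)) then exp (\<Sum>j. ln (b j - a j)) else 0)"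

definition rectangle_ring :: "(nat \<Rightarrow> 'a::real_inner) \<Rightarrow> 'a set set" where
  "rectangle_ring e = ring_of_sets UNIV hull measurable_rectangles e"

definition shift_invariant_extension ::
    "(nat \<Rightarrow> 'a::real_inner) \<Rightarrow> ('a set \<Rightarrow> real) \<Rightarrow> bool" where
  "shift_invariant_extension e \<mu> \<longleftrightarrow>
     (\<forall>A\<in>rectangle_ring e. 0 \<le> \<mu> A) \<and>
     additive (rectangle_ring e) \<mu> \<and>
     (\<forall>A\<in>rectangle_ring e. \<forall>h. \<mu> ((\<lambda>x. x + h) ` A) = \<mu> A) \<and>
     \<mu> {} = 0 \<and>
     (\<forall>a b. rectangle_bounds e a b \<longrightarrow> \<mu> (rectangle e a b) = rectangle_volume a b)"

text \<open>
  The extension is unique as a function on the ring; membership in \<^const>\<open>extensional\<close> fixes its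
  irrelevant values elsewhere, so that the definite description is meaningful.
\<close>

definition ring_measure :: "(nat \<Rightarrow> 'a::real_inner) \<Rightarrow> 'a set \<Rightarrow> real" where
  "ring_measure e =
     (THE \<mu>. \<mu> \<in> extensional (rectangle_ring e) \<and> shift_invariant_extension e \<mu>)"

definition completed_ring :: "(nat \<Rightarrow> 'a::real_inner) \<Rightarrow> 'a set set" where
  "completed_ring e =
     {A. \<forall>\<epsilon>>0. \<exists>A1\<in>rectangle_ring e. \<exists>A2\<in>rectangle_ring e.
           A1 \<subseteq> A \<and> A \<subseteq> A2 \<and> ring_measure e (A2 - A1) < \<epsilon>}"

text \<open>Only meaningful on \<^const>\<open>completed_ring\<close>, where the infimum is over a nonempty set.\<close>

definition completed_measure :: "(nat \<Rightarrow> 'a::real_inner) \<Rightarrow> 'a set \<Rightarrow> real" where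
  "completed_measure e A = Inf {ring_measure e A2 | A2. A2 \<in> rectangle_ring e \<and> A \<subseteq> A2}"

end

theory Submission
  imports Defs
begin

text \<open>
  The product condition is equivalent, after reindexing one basis by a bijection \<open>\<sigma>\<close>, to
  summability of the off-diagonal entries \<open>\<bar>e (\<sigma> i) \<bullet> f j\<bar>\<close>, \<open>i \<noteq> j\<close>; this form is symmetric in the
  two bases.

  If it holds, an \<open>f\<close>-rectangle of positive volume contains, for large \<open>n\<close>, the product of a slightly
  shrunk tail rectangle in the coordinates \<open>j \<ge> n\<close> and the preimage of a slightly shrunk box under the
  block \<open>(e i \<bullet> f j)\<close>, \<open>i, j < n\<close>. The block is a contraction, so taking preimages does not decrease
  the volume, and the \<open>e\<close>-inner measure of the \<open>f\<close>-rectangle is at least its \<open>f\<close>-measure. This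
  inequality in both directions forces both completions to coincide, without computing a determinant.

  If some set in both completed rings has positive \<open>e\<close>-measure, it contains an \<open>e\<close>-rectangle of positive
  volume covered by finitely many \<open>f\<close>-rectangles. Shrinking it away from the members of the cover,
  one may assume that it lies in the closure of a single one. Comparing widths in the directions \<open>f j\<close>,
  \<open>\<Sum>i. (b i - a i) * \<bar>e i \<bullet> f j\<bar> \<le> \<beta> j - \<alpha> j\<close>, then gives the product condition.
\<close>

section \<open>Orthonormal expansions\<close>

text \<open>\<open>ring_measure\<close> is a definite description, so existence and uniqueness of
  the extension must be established before it has any property. Rectangles are not a semiring, which
  rules out the usual extension argument. Indicators of ring sets are instead written as signed
  combinations of rectangle indicators; such a combination that is nonnegative as a function has
  nonnegative volume, because this can be tested on finitely many coordinates.

  Points of a rectangle are bounded uniformly in each coordinate but not uniformly in norm. All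
  comparisons of the two coordinate systems therefore pair sup bounds on coordinates with absolute
  sums of the entries \<open>e i \<bullet> f j\<close>; this is why absolute sums and not sums of
  squares govern the result.

  Equality of the measures on the common sets is not proved separately: either the product condition
  holds and everything coincides, or both measures vanish on every common set.\<close>

lemma ortho_inner: "orthonormal_basis e \<Longrightarrow> e i \<bullet> e j = (if i = j then 1 else 0)"
  by (simp add: orthonormal_basis_def)

lemma norm_sum_orthonormal:
  assumes e: "orthonormal_basis e" and "finite I"
  shows "(norm (\<Sum>i\<in>I. c i *\<^sub>R e i))\<^sup>2 = (\<Sum>i\<in>I. (c i)\<^sup>2)"
proof -
  have "(\<Sum>i\<in>I. c i *\<^sub>R e i) \<bullet> (\<Sum>i\<in>I. c i *\<^sub>R e i) = (\<Sum>i\<in>I. \<Sum>j\<in>I. if j = i then c i * c j else 0)"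
    unfolding inner_sum_left inner_sum_right
    by (intro sum.cong) (auto simp: ortho_inner[OF e])
  then show ?thesis
    using \<open>finite I\<close> unfolding power2_norm_eq_inner by (simp add: power2_eq_square)
qed

lemma inner_sum_orthonormal:
  assumes e: "orthonormal_basis e" and "finite I"
  shows "(\<Sum>i\<in>I. c i *\<^sub>R e i) \<bullet> e j = (if j \<in> I then c j else 0)"
  using \<open>finite I\<close> by (simp add: inner_sum_left ortho_inner[OF e] if_distrib cong: if_cong)

lemma bessel:
  assumes e: "orthonormal_basis e" and "finite I"
  shows "(\<Sum>i\<in>I. (x \<bullet> e i)\<^sup>2) \<le> (norm x)\<^sup>2"
proof -
  let ?y = "\<Sum>i\<in>I. (x \<bullet> e i) *\<^sub>R e i"
  have 1: "x \<bullet> ?y = (\<Sum>i\<in>I. (x \<bullet> e i)\<^sup>2)"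
    by (simp add: inner_sum_right power2_eq_square)
  have "0 \<le> (norm (x - ?y))\<^sup>2" by simp
  also have "\<dots> = (norm x)\<^sup>2 - 2 * (x \<bullet> ?y) + (norm ?y)\<^sup>2"
    by (simp add: power2_norm_eq_inner algebra_simps inner_commute)
  also have "\<dots> = (norm x)\<^sup>2 - (\<Sum>i\<in>I. (x \<bullet> e i)\<^sup>2)"
    unfolding 1 norm_sum_orthonormal[OF assms] by simp
  finally show ?thesis by simp
qed

lemma fourier_best_approximation:
  assumes e: "orthonormal_basis e" and v: "v \<in> span (e ` {..<n})"
  shows "norm (x - (\<Sum>i<n. (x \<bullet> e i) *\<^sub>R e i)) \<le> norm (x - v)"
proof -
  let ?y = "\<Sum>i<n. (x \<bullet> e i) *\<^sub>R e i"
  have orth: "(x - ?y) \<bullet> w = 0" if "w \<in> span (e ` {..<n})" for w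
    using that
  proof (induction rule: span_induct_alt)
    case base
    then show ?case by simp
  next
    case (step c w z)
    then show ?case
      by (auto simp: inner_diff_left inner_add_right inner_sum_orthonormal[OF e])
  qed
  have "?y - v \<in> span (e ` {..<n})"
    by (intro span_diff v span_sum span_scale span_base) auto
  then have "(x - ?y) \<bullet> (?y - v) = 0" by (rule orth)
  then have "(norm (x - v))\<^sup>2 = (norm (x - ?y))\<^sup>2 + (norm (?y - v))\<^sup>2"
    using norm_add_Pythagorean[of "x - ?y" "?y - v"] by (simp add: orthogonal_def)
  then have "(norm (x - ?y))\<^sup>2 \<le> (norm (x - v))\<^sup>2" by simp
  then show ?thesis by (rule power2_le_imp_le) simp
qed

lemma fourier_tendsto:
  assumes e: "orthonormal_basis e"
  shows "(\<lambda>n. \<Sum>i<n. (x \<bullet> e i) *\<^sub>R e i) \<longlonglongrightarrow> x"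
proof (rule LIMSEQ_I)
  fix r :: real assume "0 < r"
  have "x \<in> closure (span (range e))"
    using e by (simp add: orthonormal_basis_def)
  then obtain v where v: "v \<in> span (range e)" "dist v x < r"
    using \<open>0 < r\<close> closure_approachable by blast
  obtain S where S: "finite S" "S \<subseteq> range e" "v \<in> span S"
    using v(1) unfolding span_explicit by (auto intro: span_sum span_scale span_base)
  obtain J where J: "finite J" "S = e ` J"
    using S finite_subset_image by metis
  obtain m where m: "J \<subseteq> {..<m}"
    using J(1) finite_nat_bounded by blast
  have "norm ((\<Sum>i<n. (x \<bullet> e i) *\<^sub>R e i) - x) < r" if "n \<ge> m" for n
  proof -
    have "S \<subseteq> e ` {..<n}" using m J that by force
    then have "v \<in> span (e ` {..<n})" using S(3) span_mono by blast
    from fourier_best_approximation[OF e this, of x] v(2) show ?thesis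
      by (simp add: dist_norm norm_minus_commute)
  qed
  then show "\<exists>no. \<forall>n\<ge>no. norm ((\<Sum>i<n. (x \<bullet> e i) *\<^sub>R e i) - x) < r" by blast
qed

lemma parseval:
  assumes e: "orthonormal_basis e"
  shows "(\<lambda>i. (x \<bullet> e i) * (y \<bullet> e i)) sums (x \<bullet> y)"
proof -
  have "(\<lambda>n. (\<Sum>i<n. (x \<bullet> e i) *\<^sub>R e i) \<bullet> y) \<longlonglongrightarrow> x \<bullet> y"
    by (intro tendsto_inner fourier_tendsto[OF e] tendsto_const)
  then show ?thesis
    by (simp add: sums_def inner_sum_left inner_commute[of y])
qed

lemma parseval_norm:
  assumes e: "orthonormal_basis e"
  shows "(\<lambda>i. (x \<bullet> e i)\<^sup>2) sums (norm x)\<^sup>2"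
  using parseval[OF e, of x x] unfolding power2_norm_eq_inner by (simp add: power2_eq_square)

lemma riesz_fischer:
  assumes e: "orthonormal_basis e" and c: "summable (\<lambda>i. (c i)\<^sup>2)"
  obtains x where "\<And>i. x \<bullet> e i = c i"
proof -
  let ?s = "\<lambda>i. c i *\<^sub>R e i"
  have "Cauchy (\<lambda>n. \<Sum>i<n. ?s i)"
  proof (rule CauchyI')
    fix r :: real assume "0 < r"
    then obtain N where N: "\<And>m n. m \<ge> N \<Longrightarrow> norm (\<Sum>i=m..<n. (c i)\<^sup>2) < r\<^sup>2"
      using c unfolding summable_Cauchy by (metis zero_less_power)
    have "dist (\<Sum>i<m. ?s i) (\<Sum>i<n. ?s i) < r" if "m \<ge> N" "m < n" for m n
    proof (rule power2_less_imp_less)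
      have "(\<Sum>i<n. ?s i) - (\<Sum>i<m. ?s i) = sum ?s {m..<n}"
        using that(2) sum_diff_nat_ivl[of 0 m n ?s] by (simp add: atLeast0LessThan)
      then show "(dist (\<Sum>i<m. ?s i) (\<Sum>i<n. ?s i))\<^sup>2 < r\<^sup>2"
        using N[OF that(1), of n] by (simp add: norm_sum_orthonormal[OF e] dist_norm norm_minus_commute[of "sum ?s {..<m}"])
    qed (use \<open>0 < r\<close> in simp)
    then show "\<exists>M. \<forall>m\<ge>M. \<forall>n>m. dist (\<Sum>i<m. ?s i) (\<Sum>i<n. ?s i) < r" by blast
  qed
  then obtain s where lim: "(\<lambda>n. \<Sum>i<n. ?s i) \<longlonglongrightarrow> s"
    using Cauchy_convergent_iff convergent_def by blast
  have "s \<bullet> e j = c j" for j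
  proof (rule LIMSEQ_unique)
    show "(\<lambda>n. (\<Sum>i<n. ?s i) \<bullet> e j) \<longlonglongrightarrow> s \<bullet> e j"
      by (intro tendsto_inner lim tendsto_const)
    show "(\<lambda>n. (\<Sum>i<n. ?s i) \<bullet> e j) \<longlonglongrightarrow> c j"
      by (rule tendsto_eventually)
        (auto simp: eventually_sequentially inner_sum_orthonormal[OF e] intro!: exI[of _ "Suc j"])
  qed
  then show thesis by (rule that)
qed

section \<open>Rectangles in coordinates\<close>

lemma in_rectangle: "x \<in> rectangle e a b \<longleftrightarrow> (\<forall>j. a j \<le> x \<bullet> e j \<and> x \<bullet> e j < b j)"
  by (simp add: rectangle_def)

text \<open>Nonempty coordinate intervals are not enough: \<open>[1, 2)\<close> in every coordinate
  contains no point of the space. By Parseval and Riesz-Fischer the question is whether a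
  square-summable selection exists.\<close>

lemma rectangle_nonempty_iff:
  assumes e: "orthonormal_basis e"
  shows "rectangle e a b \<noteq> {} \<longleftrightarrow> (\<exists>c. summable (\<lambda>j. (c j)\<^sup>2) \<and> (\<forall>j. a j \<le> c j \<and> c j < b j))"
proof
  assume "rectangle e a b \<noteq> {}"
  then obtain x where "x \<in> rectangle e a b" by blast
  then show "\<exists>c. summable (\<lambda>j. (c j)\<^sup>2) \<and> (\<forall>j. a j \<le> c j \<and> c j < b j)"
    using parseval_norm[OF e, of x] by (auto simp: in_rectangle sums_iff intro!: exI[of _ "\<lambda>j. x \<bullet> e j"])
next
  assume "\<exists>c. summable (\<lambda>j. (c j)\<^sup>2) \<and> (\<forall>j. a j \<le> c j \<and> c j < b j)"
  then obtain c where c: "summable (\<lambda>j. (c j)\<^sup>2)" "\<forall>j. a j \<le> c j \<and> c j < b j" by blast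
  obtain x where "\<And>i. x \<bullet> e i = c i" using riesz_fischer[OF e c(1)] by blast
  then have "x \<in> rectangle e a b" using c(2) by (simp add: in_rectangle)
  then show "rectangle e a b \<noteq> {}" by blast
qed

lemma coordinate_update:
  assumes e: "orthonormal_basis e" and "finite I"
  obtains y where "\<And>i. y \<bullet> e i = (if i \<in> I then c i else x \<bullet> e i)"
proof -
  let ?y = "x + (\<Sum>i\<in>I. (c i - x \<bullet> e i) *\<^sub>R e i)"
  have "?y \<bullet> e i = (if i \<in> I then c i else x \<bullet> e i)" for i
    by (simp add: inner_add_left inner_sum_orthonormal[OF assms])
  then show thesis by (rule that)
qed

section \<open>Infinite products and positivity of rectangle combinations\<close>

lemma filterlim_nonsummable_at_top:
  fixes f :: "nat \<Rightarrow> real"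
  assumes "\<And>n. 0 \<le> f n" "\<not> summable f"
  shows "filterlim (\<lambda>n. \<Sum>k<n. f k) at_top sequentially"
  unfolding filterlim_at_top
proof
  fix Z
  obtain N where N: "Z < (\<Sum>k<N. f k)"
    using assms summableI_nonneg_bounded[of f Z] by (meson not_le)
  have "Z \<le> (\<Sum>k<n. f k)" if "n \<ge> N" for n
    using N sum_mono2[of "{..<n}" "{..<N}" f] that assms(1) by fastforce
  then show "\<forall>\<^sub>F n in sequentially. Z \<le> (\<Sum>k<n. f k)"
    unfolding eventually_sequentially by blast
qed

lemma summable_ln_pos_cases:
  fixes l :: "nat \<Rightarrow> real"
  assumes "summable (\<lambda>k. max 0 (ln (l k)))" "summable (\<lambda>k. ln (l k))"
  shows "summable (\<lambda>k. \<bar>ln (l k)\<bar>)"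
proof -
  have "summable (\<lambda>k. 2 * max 0 (ln (l k)) - ln (l k))"
    using assms by (intro summable_diff summable_mult)
  moreover have "(\<lambda>k. 2 * max 0 (ln (l k)) - ln (l k)) = (\<lambda>k. \<bar>ln (l k)\<bar>)" by (auto simp: fun_eq_iff)
  ultimately show ?thesis by simp
qed

text \<open>Both branches of \<open>rectangle_volume\<close> are one limit of finite products: with
  summable positive parts, the only alternative to summability is divergence to
  \<open>-\<infinity>\<close>, and then the products tend to 0.\<close>

lemma prod_tendsto_exp_suminf_ln:
  fixes l :: "nat \<Rightarrow> real"
  assumes pos: "\<And>k. 0 < l k" and sm: "summable (\<lambda>k. max 0 (ln (l k)))"
  shows "(\<lambda>n. \<Prod>k<n. l k) \<longlonglongrightarrow> (if summable (\<lambda>k. ln (l k)) then exp (\<Sum>k. ln (l k)) else 0)"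
proof -
  have eq: "(\<Prod>k<n. l k) = exp (\<Sum>k<n. ln (l k))" for n
    by (simp add: exp_sum pos)
  show ?thesis
  proof (cases "summable (\<lambda>k. ln (l k))")
    case True
    then show ?thesis
      unfolding eq by (auto intro!: tendsto_exp summable_LIMSEQ)
  next
    case False
    let ?p = "\<lambda>k. max 0 (ln (l k))" and ?m = "\<lambda>k. max 0 (- ln (l k))"
    have d: "ln (l k) = ?p k - ?m k" for k by auto
    have nm: "\<not> summable ?m"
    proof
      assume "summable ?m"
      then have "summable (\<lambda>k. ?p k - ?m k)" by (rule summable_diff[OF sm])
      then have "summable (\<lambda>k. ln (l k))" unfolding d[symmetric] .
      with False show False by simp
    qed
    have "filterlim (\<lambda>n. \<Sum>k<n. ?m k) at_top sequentially"
      by (rule filterlim_nonsummable_at_top) (use nm in auto)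
    then have "filterlim (\<lambda>n. - (\<Sum>k<n. ?p k) + (\<Sum>k<n. ?m k)) at_top sequentially"
      by (rule filterlim_tendsto_add_at_top[OF tendsto_minus[OF summable_LIMSEQ[OF sm]]])
    then have "filterlim (\<lambda>n. - (- (\<Sum>k<n. ?p k) + (\<Sum>k<n. ?m k))) at_bot sequentially"
      by (subst filterlim_uminus_at_top[symmetric])
    moreover have "- (- (\<Sum>k<n. ?p k) + (\<Sum>k<n. ?m k)) = (\<Sum>k<n. ln (l k))" for n
      by (subst d) (simp add: sum_subtractf)
    ultimately have "filterlim (\<lambda>n. \<Sum>k<n. ln (l k)) at_bot sequentially" by simp
    then have "(\<lambda>n. exp (\<Sum>k<n. ln (l k))) \<longlonglongrightarrow> 0"
      by (rule filterlim_compose[OF exp_at_bot])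
    then show ?thesis using False by (simp add: eq)
  qed
qed

lemma rectangle_bounds_less: "rectangle_bounds e a b \<Longrightarrow> a j < b j"
  unfolding rectangle_bounds_def rectangle_def by (auto dest!: spec[of _ j])

lemma rectangle_volume_nonneg [simp]: "0 \<le> rectangle_volume a b"
  by (simp add: rectangle_volume_def)

lemma rectangle_volume_pos_iff: "0 < rectangle_volume a b \<longleftrightarrow> summable (\<lambda>j. ln (b j - a j))"
  by (simp add: rectangle_volume_def)

lemma rectangle_volume_tendsto:
  assumes "rectangle_bounds e a b"
  shows "(\<lambda>n. \<Prod>k<n. b k - a k) \<longlonglongrightarrow> rectangle_volume a b"
  unfolding rectangle_volume_def
  by (rule prod_tendsto_exp_suminf_ln)
    (use assms rectangle_bounds_less[OF assms] in \<open>auto simp: rectangle_bounds_def\<close>)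

text \<open>From \<open>n\<close> on, the finite products differ by a constant factor. Passing to
  the limit covers volume 0 without a separate case.\<close>

lemma rectangle_volume_finite_change:
  assumes ab: "rectangle_bounds e a b" and ab': "rectangle_bounds e' a' b'"
    and eq: "\<And>k. k \<ge> n \<Longrightarrow> b' k - a' k = b k - a k"
  shows "rectangle_volume a' b' = rectangle_volume a b * (\<Prod>k<n. (b' k - a' k) / (b k - a k))"
proof (rule LIMSEQ_unique)
  show "(\<lambda>n. \<Prod>k<n. b' k - a' k) \<longlonglongrightarrow> rectangle_volume a' b'"
    by (rule rectangle_volume_tendsto[OF ab'])
  have "(\<Prod>k<m. b k - a k) * (\<Prod>k<n. (b' k - a' k) / (b k - a k)) = (\<Prod>k<m. b' k - a' k)"
    if "m \<ge> n" for m
  proof -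
    have *: "(\<Prod>k<m. f k) = (\<Prod>k<n. f k) * (\<Prod>k=n..<m. f k)" for f :: "nat \<Rightarrow> real"
      using that prod.atLeastLessThan_concat[of 0 n m f] by (simp add: atLeast0LessThan)
    have "(\<Prod>k=n..<m. b' k - a' k) = (\<Prod>k=n..<m. b k - a k)"
      by (rule prod.cong) (auto simp: eq)
    moreover have "(\<Prod>k<n. b k - a k) \<noteq> 0"
      using rectangle_bounds_less[OF ab] by (subst prod_zero_iff) (auto, metis less_irrefl)
    ultimately show ?thesis
      unfolding *[of "\<lambda>k. b k - a k"] *[of "\<lambda>k. b' k - a' k"] by (simp add: prod_dividef)
  qed
  then have "\<forall>\<^sub>F m in sequentially. (\<Prod>k<m. b k - a k) * (\<Prod>k<n. (b' k - a' k) / (b k - a k)) = (\<Prod>k<m. b' k - a' k)"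
    unfolding eventually_sequentially by blast
  moreover have "(\<lambda>m. (\<Prod>k<m. b k - a k) * (\<Prod>k<n. (b' k - a' k) / (b k - a k)))
      \<longlonglongrightarrow> rectangle_volume a b * (\<Prod>k<n. (b' k - a' k) / (b k - a k))"
    by (intro tendsto_mult rectangle_volume_tendsto[OF ab] tendsto_const)
  ultimately show "(\<lambda>m. \<Prod>k<m. b' k - a' k)
      \<longlonglongrightarrow> rectangle_volume a b * (\<Prod>k<n. (b' k - a' k) / (b k - a k))"
    by (rule Lim_transform_eventually[rotated])
qed

lemma rectangle_bounds_sub:
  assumes ab: "rectangle_bounds e a b" and le: "\<And>j. a j \<le> a' j" "\<And>j. b' j \<le> b j"
    and ne: "rectangle e a' b' \<noteq> {}"
  shows "rectangle_bounds e a' b'"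
proof -
  have less: "a' j < b' j" for j
    using ne by (auto simp: rectangle_def dest!: spec[of _ j])
  obtain A B where A: "\<And>j. \<bar>a j\<bar> \<le> A" and B: "\<And>j. \<bar>b j\<bar> \<le> B"
    using ab by (auto simp: rectangle_bounds_def bounded_iff)
  have "\<bar>a' j\<bar> \<le> A + B" "\<bar>b' j\<bar> \<le> A + B" for j
    using le[of j] less[of j] A[of j] B[of j] by linarith+
  then have bd: "bounded (range a')" "bounded (range b')"
    by (auto simp: bounded_iff)
  have "summable (\<lambda>j. max 0 (ln (b' j - a' j)))"
  proof (rule summable_comparison_test')
    show "summable (\<lambda>j. max 0 (ln (b j - a j)))" using ab by (simp add: rectangle_bounds_def)
    fix j
    have "ln (b' j - a' j) \<le> ln (b j - a j)"
      using less[of j] le[of j] by simp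
    then show "norm (max 0 (ln (b' j - a' j))) \<le> max 0 (ln (b j - a j))" by simp
  qed
  with ne bd show ?thesis by (simp add: rectangle_bounds_def)
qed

lemma rectangle_Int:
  "rectangle e a b \<inter> rectangle e a' b' = rectangle e (\<lambda>j. max (a j) (a' j)) (\<lambda>j. min (b j) (b' j))"
  by (auto simp: in_rectangle)

lemma rectangle_bounds_Int:
  assumes "rectangle_bounds e a b" "rectangle e a b \<inter> rectangle e a' b' \<noteq> {}"
  shows "rectangle_bounds e (\<lambda>j. max (a j) (a' j)) (\<lambda>j. min (b j) (b' j))"
  using assms(2) unfolding rectangle_Int by (intro rectangle_bounds_sub[OF assms(1)]) auto

text \<open>The common point is essentially the one nearest to 0. Its square is then bounded by that
  of one of the \<open>p i\<close>, so a choice made coordinate by coordinate inherits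
  square-summability from given points of the rectangles.\<close>

lemma intervals_common_point:
  fixes a b p :: "'i \<Rightarrow> real"
  assumes "finite S" and p: "\<And>i. i \<in> S \<Longrightarrow> a i \<le> p i \<and> p i < b i"
    and t: "\<And>i. i \<in> S \<Longrightarrow> a i \<le> t \<and> t < b i"
  obtains s where "\<And>i. i \<in> S \<Longrightarrow> a i \<le> s \<and> s < b i" "s\<^sup>2 \<le> (\<Sum>i\<in>S. (p i)\<^sup>2)"
proof (cases "S = {}")
  case True
  then show thesis by (intro that[of 0]) auto
next
  case False
  let ?A = "Max (a ` S)" and ?B = "Min (b ` S)"
  have A: "a i \<le> ?A" and B: "?B \<le> b i" if "i \<in> S" for i
    using \<open>finite S\<close> that by auto
  have "?A \<in> a ` S" using \<open>finite S\<close> False by (intro Max_in) auto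
  then obtain i0 where i0: "i0 \<in> S" "?A = a i0" by auto
  have "?B \<in> b ` S" using \<open>finite S\<close> False by (intro Min_in) auto
  then obtain i1 where i1: "i1 \<in> S" "?B = b i1" by auto
  have AB: "?A < ?B" using i0 i1 t by (metis order_le_less_trans)
  have le: "(p i)\<^sup>2 \<le> (\<Sum>i\<in>S. (p i)\<^sup>2)" if "i \<in> S" for i
    using that \<open>finite S\<close> by (intro member_le_sum) auto
  consider "?A \<le> 0" "0 < ?B" | "?A > 0" | "?B \<le> 0" by linarith
  then show thesis
  proof cases
    case 1
    then show thesis using A B by (intro that[of 0]) (force intro: sum_nonneg)+
  next
    case 2
    have "?A\<^sup>2 \<le> (p i0)\<^sup>2" using 2 i0 p[of i0] by (intro power_mono) auto
    then show thesis using A B AB le[of i0] i0 by (intro that[of ?A]) force+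
  next
    case 3
    \<comment> \<open>The point nearest to 0 would be the excluded endpoint \<open>?B\<close>. Every
      point between \<open>p i1 < ?B\<close> and 0 satisfies the bound, and the maximum with
      \<open>?A\<close> puts it into all intervals.\<close>
    let ?s = "max ?A (p i1)"
    have "p i1 < ?B" using i1 p by auto
    then have "(- ?s)\<^sup>2 \<le> (- p i1)\<^sup>2" using 3 AB by (intro power_mono) auto
    then have "?s\<^sup>2 \<le> (p i1)\<^sup>2" by simp
    moreover have "?s < ?B" using AB \<open>p i1 < ?B\<close> by simp
    ultimately show thesis using A B le[of i1] i1 by (intro that[of ?s]) force+
  qed
qed

lemma interval_sum_nonneg:
  fixes a b d :: "'i \<Rightarrow> real"
  assumes "finite I" "\<And>i. i \<in> I \<Longrightarrow> a i \<le> b i"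
    and nn: "\<And>t. 0 \<le> (\<Sum>i\<in>I. d i * indicator {a i..<b i} t)"
  shows "0 \<le> (\<Sum>i\<in>I. d i * (b i - a i))"
proof -
  have int: "integrable lborel (\<lambda>t. d i * indicator {a i..<b i} t)" if "i \<in> I" for i
    using assms(2)[OF that] by (intro integrable_mult_right integrable_real_indicator) auto
  have "0 \<le> (\<integral>t. (\<Sum>i\<in>I. d i * indicator {a i..<b i} t) \<partial>lborel)"
    by (rule Bochner_Integration.integral_nonneg) (rule nn)
  also have "\<dots> = (\<Sum>i\<in>I. \<integral>t. d i * indicator {a i..<b i} t \<partial>lborel)"
    by (rule Bochner_Integration.integral_sum[OF int])
  also have "\<dots> = (\<Sum>i\<in>I. d i * (b i - a i))"
    by (rule sum.cong) (use assms(2) in auto)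
  finally show ?thesis .
qed

text \<open>The last coordinate is integrated out and its side lengths are absorbed into the
  coefficients, which is why \<open>c\<close> is arbitrary in the induction.\<close>

lemma box_sum_nonneg:
  fixes a b :: "'i \<Rightarrow> nat \<Rightarrow> real"
  assumes "finite I" and le: "\<And>i j. i \<in> I \<Longrightarrow> a i j \<le> b i j"
    and nn: "\<And>y :: nat \<Rightarrow> real. 0 \<le> (\<Sum>i\<in>I. c i * (\<Prod>j<N. indicator {a i j..<b i j} (y j)))"
  shows "0 \<le> (\<Sum>i\<in>I. c i * (\<Prod>j<N. b i j - a i j))"
  using nn
proof (induction N arbitrary: c)
  case 0
  then show ?case by simp
next
  case (Suc N)
  have "0 \<le> (\<Sum>i\<in>I. (c i * (b i N - a i N)) * (\<Prod>j<N. indicator {a i j..<b i j} (y j)))" for y :: "nat \<Rightarrow> real"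
  proof -
    have "0 \<le> (\<Sum>i\<in>I. (c i * (\<Prod>j<N. indicator {a i j..<b i j} (y j))) * (b i N - a i N))"
    proof (rule interval_sum_nonneg[OF \<open>finite I\<close> le])
      fix t :: real
      have "(\<Prod>j<N. indicator {a i j..<b i j} ((y(N := t)) j) :: real) = (\<Prod>j<N. indicator {a i j..<b i j} (y j))" for i
        by (rule prod.cong) auto
      then show "0 \<le> (\<Sum>i\<in>I. c i * (\<Prod>j<N. indicator {a i j..<b i j} (y j)) * indicator {a i N..<b i N} t)"
        using Suc.prems[of "y(N := t)"] by (simp add: mult.assoc)
    qed
    then show ?thesis by (simp add: mult_ac)
  qed
  from Suc.IH[OF this] show ?case by (simp add: mult_ac)
qed

text \<open>
  A linear relation between indicator functions of rectangles on the Hilbert space therefore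
  persists for their projections to the first \<open>N\<close> coordinates once \<open>N\<close> is large, although most
  sequences extending \<open>y\<close> are not square summable.
\<close>

lemma membership_pattern_realized:
  assumes e: "orthonormal_basis e" and "finite I"
    and ne: "\<And>i. i \<in> I \<Longrightarrow> rectangle e (a i) (b i) \<noteq> {}"
  obtains N0 :: nat where "\<And>N y. N \<ge> N0 \<Longrightarrow>
    \<exists>x. \<forall>i\<in>I. x \<in> rectangle e (a i) (b i) \<longleftrightarrow> (\<forall>j<N. y j \<in> {a i j..<b i j})"
proof -
  let ?P = "\<lambda>S j. \<exists>t. \<forall>i\<in>S. t \<in> {a i j..<b i j}"
  \<comment> \<open>If the intervals of a family \<open>S\<close> fail to meet in some coordinate, a
    definite index witnesses this. \<open>I\<close> has finitely many subsets, so one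
    \<open>N0\<close> exceeds all these witnesses.\<close>
  have "\<forall>S\<in>Pow I. \<exists>m. (\<forall>j. ?P S j) \<or> (\<exists>j<m. \<not> ?P S j)"
    by (metis lessI)
  then obtain m where m: "\<And>S. S \<subseteq> I \<Longrightarrow> (\<forall>j. ?P S j) \<or> (\<exists>j<m S. \<not> ?P S j)"
    using bchoice[of "Pow I" "\<lambda>S m. (\<forall>j. ?P S j) \<or> (\<exists>j<m. \<not> ?P S j)"] by (meson PowI)
  define N0 where "N0 = Max (m ` Pow I)"
  have mN: "m S \<le> N0" if "S \<subseteq> I" for S
    unfolding N0_def using \<open>finite I\<close> that by (intro Max_ge) auto
  obtain p where p: "\<And>i. i \<in> I \<Longrightarrow> p i \<in> rectangle e (a i) (b i)"
    using bchoice[of I "\<lambda>i x. x \<in> rectangle e (a i) (b i)"] ne by blast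
  have "\<exists>x. \<forall>i\<in>I. x \<in> rectangle e (a i) (b i) \<longleftrightarrow> (\<forall>j<N. y j \<in> {a i j..<b i j})"
    if N: "N \<ge> N0" for N y
  proof -
    define S where "S = {i \<in> I. \<forall>j<N. y j \<in> {a i j..<b i j}}"
    have S: "S \<subseteq> I" "finite S" using \<open>finite I\<close> by (auto simp: S_def)
    have "?P S j" if "j < m S" for j
      using mN[OF S(1)] N that unfolding S_def by (intro exI[of _ "y j"]) auto
    then have "\<not> (\<exists>j<m S. \<not> ?P S j)" by blast
    then have P: "?P S j" for j using m[OF S(1)] by blast
    have "\<exists>s. (\<forall>i\<in>S. a i j \<le> s \<and> s < b i j) \<and> s\<^sup>2 \<le> (\<Sum>i\<in>S. (p i \<bullet> e j)\<^sup>2)" for j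
    proof -
      obtain t where t: "\<forall>i\<in>S. t \<in> {a i j..<b i j}" using P by blast
      show ?thesis
        by (rule intervals_common_point[OF S(2), of "\<lambda>i. a i j" "\<lambda>i. p i \<bullet> e j" "\<lambda>i. b i j" t])
          (use p S(1) t in \<open>auto simp: in_rectangle\<close>)
    qed
    then obtain s where s: "\<And>j i. i \<in> S \<Longrightarrow> a i j \<le> s j \<and> s j < b i j"
      and s2: "\<And>j. (s j)\<^sup>2 \<le> (\<Sum>i\<in>S. (p i \<bullet> e j)\<^sup>2)" by metis
    \<comment> \<open>The tail stays inside every rectangle of \<open>S\<close>; the rectangles
      outside \<open>S\<close> are already excluded by the first \<open>N\<close>
      coordinates.\<close>
    define c where "c = (\<lambda>j. if j < N then y j else s j)"
    have "summable (\<lambda>j. (c j)\<^sup>2)"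
    proof (rule summable_comparison_test')
      show "summable (\<lambda>j. \<Sum>i\<in>S. (p i \<bullet> e j)\<^sup>2)"
        by (intro summable_sum sums_summable[OF parseval_norm[OF e]])
      show "norm ((c j)\<^sup>2) \<le> (\<Sum>i\<in>S. (p i \<bullet> e j)\<^sup>2)" if "j \<ge> N" for j
        using s2[of j] that by (simp add: c_def)
    qed
    then obtain x where x: "\<And>j. x \<bullet> e j = c j" using riesz_fischer[OF e] by blast
    have "x \<in> rectangle e (a i) (b i) \<longleftrightarrow> (\<forall>j<N. y j \<in> {a i j..<b i j})" if "i \<in> I" for i
    proof
      assume "x \<in> rectangle e (a i) (b i)"
      then show "\<forall>j<N. y j \<in> {a i j..<b i j}" unfolding in_rectangle x c_def by (metis atLeastLessThan_iff)
    next
      assume *: "\<forall>j<N. y j \<in> {a i j..<b i j}"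
      then have "i \<in> S" using that by (simp add: S_def)
      then show "x \<in> rectangle e (a i) (b i)" using * s unfolding in_rectangle x c_def by auto
    qed
    then show ?thesis by blast
  qed
  then show thesis by (rule that)
qed

text \<open>Positivity of the projections to \<open>N\<close> coordinates passes to the limit. It
  gives both that the volume of a signed combination depends only on the function represented and
  that the resulting set function is nonnegative.\<close>

lemma rectangle_combination_nonneg:
  assumes e: "orthonormal_basis e" and "finite I"
    and bd: "\<And>i. i \<in> I \<Longrightarrow> rectangle_bounds e (a i) (b i)"
    and nn: "\<And>x. 0 \<le> (\<Sum>i\<in>I. c i * indicator (rectangle e (a i) (b i)) x)"
  shows "0 \<le> (\<Sum>i\<in>I. c i * rectangle_volume (a i) (b i))"
proof -
  obtain N0 where N0: "\<And>N y. N \<ge> N0 \<Longrightarrow>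
    \<exists>x. \<forall>i\<in>I. x \<in> rectangle e (a i) (b i) \<longleftrightarrow> (\<forall>j<N. y j \<in> {a i j..<b i j})"
    by (rule membership_pattern_realized[OF e \<open>finite I\<close>, of a b]) (use bd in \<open>auto simp: rectangle_bounds_def\<close>)
  have "0 \<le> (\<Sum>i\<in>I. c i * (\<Prod>j<N. b i j - a i j))" if N: "N \<ge> N0" for N
  proof (rule box_sum_nonneg[OF \<open>finite I\<close>])
    show "a i j \<le> b i j" if "i \<in> I" for i j
      using rectangle_bounds_less[OF bd[OF that], of j] by simp
    fix y :: "nat \<Rightarrow> real"
    obtain x where x: "\<forall>i\<in>I. x \<in> rectangle e (a i) (b i) \<longleftrightarrow> (\<forall>j<N. y j \<in> {a i j..<b i j})"
      using N0[OF N] by blast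
    have "(\<Prod>j<N. indicator {a i j..<b i j} (y j)) = (indicator (rectangle e (a i) (b i)) x :: real)"
      if "i \<in> I" for i
    proof (cases "\<forall>j<N. y j \<in> {a i j..<b i j}")
      case True
      then show ?thesis using x that by (simp add: indicator_def)
    next
      case False
      then obtain j where "j < N" "indicator {a i j..<b i j} (y j) = (0::real)" by (auto simp: indicator_def)
      then have "(\<Prod>j<N. indicator {a i j..<b i j} (y j)) = (0::real)" by (intro prod_zero) auto
      then show ?thesis using False x that by auto
    qed
    then show "0 \<le> (\<Sum>i\<in>I. c i * (\<Prod>j<N. indicator {a i j..<b i j} (y j)))"
      using nn[of x] by simp
  qed
  moreover have "(\<lambda>N. \<Sum>i\<in>I. c i * (\<Prod>j<N. b i j - a i j)) \<longlonglongrightarrow> (\<Sum>i\<in>I. c i * rectangle_volume (a i) (b i))"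
    by (intro tendsto_sum tendsto_mult tendsto_const rectangle_volume_tendsto[OF bd])
  ultimately show ?thesis
    by (intro LIMSEQ_le_const[of "\<lambda>N. \<Sum>i\<in>I. c i * (\<Prod>j<N. b i j - a i j)" _ 0]) blast+
qed

section \<open>The ring measure\<close>

lemma ring_of_sets_rectangle_ring: "ring_of_sets UNIV (rectangle_ring e)"
  unfolding rectangle_ring_def by (rule hull_in) (auto simp: ring_of_sets_iff)

lemma rectangle_ring_empty [simp]: "{} \<in> rectangle_ring e"
  and rectangle_ring_Un [intro]: "A \<in> rectangle_ring e \<Longrightarrow> B \<in> rectangle_ring e \<Longrightarrow> A \<union> B \<in> rectangle_ring e"
  and rectangle_ring_Diff [intro]: "A \<in> rectangle_ring e \<Longrightarrow> B \<in> rectangle_ring e \<Longrightarrow> A - B \<in> rectangle_ring e"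
  using ring_of_sets_rectangle_ring[of e] unfolding ring_of_sets_iff by blast+

lemma rectangle_ring_Int [intro]:
  assumes "A \<in> rectangle_ring e" "B \<in> rectangle_ring e" shows "A \<inter> B \<in> rectangle_ring e"
proof -
  have "A - (A - B) \<in> rectangle_ring e" using assms by blast
  then show ?thesis by (simp add: Diff_Diff_Int)
qed

lemma rectangle_ring_UN [intro]:
  "finite I \<Longrightarrow> (\<And>i. i \<in> I \<Longrightarrow> A i \<in> rectangle_ring e) \<Longrightarrow> (\<Union>i\<in>I. A i) \<in> rectangle_ring e"
  by (induction I rule: finite_induct) auto

lemma rectangle_in_ring [intro]: "rectangle_bounds e a b \<Longrightarrow> rectangle e a b \<in> rectangle_ring e"
  unfolding rectangle_ring_def by (rule hull_inc) (auto simp: measurable_rectangles_def)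

lemma sub_rectangle_in_ring:
  assumes "rectangle_bounds e a b" "\<And>j. a j \<le> a' j" "\<And>j. b' j \<le> b j"
  shows "rectangle e a' b' \<in> rectangle_ring e"
  using rectangle_bounds_sub[OF assms] by (cases "rectangle e a' b' = {}") auto

text \<open>The union case may assume disjointness because
  \<open>A \<union> B = (A - B) \<union> B\<close> and differences are treated separately.\<close>

lemma rectangle_ring_induct [consumes 1, case_names empty rectangle Diff Un]:
  assumes A: "A \<in> rectangle_ring e"
    and "P {}" and "\<And>a b. rectangle_bounds e a b \<Longrightarrow> P (rectangle e a b)"
    and "\<And>A B. A \<in> rectangle_ring e \<Longrightarrow> B \<in> rectangle_ring e \<Longrightarrow> P A \<Longrightarrow> P B \<Longrightarrow> P (A - B)"
    and Un: "\<And>A B. A \<in> rectangle_ring e \<Longrightarrow> B \<in> rectangle_ring e \<Longrightarrow> A \<inter> B = {} \<Longrightarrow> P A \<Longrightarrow> P B \<Longrightarrow> P (A \<union> B)"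
  shows "P A"
proof -
  let ?T = "{A \<in> rectangle_ring e. P A}"
  have "ring_of_sets UNIV ?T"
    unfolding ring_of_sets_iff
  proof (intro conjI ballI)
    fix A B assume A: "A \<in> ?T" and B: "B \<in> ?T"
    show d: "A - B \<in> ?T" using A B assms(4) by auto
    have "P ((A - B) \<union> B)" using d B by (intro Un) auto
    then show "A \<union> B \<in> ?T" using A B by auto
  qed (use assms(2) in auto)
  moreover have "measurable_rectangles e \<subseteq> ?T"
    using assms(2,3) by (auto simp: measurable_rectangles_def)
  ultimately have "rectangle_ring e \<subseteq> ?T"
    unfolding rectangle_ring_def by (intro hull_minimal) auto
  then show ?thesis using A by blast
qed

lemma rectangle_ring_covered:
  assumes "A \<in> rectangle_ring e"
  obtains \<C> where "finite \<C>" "\<C> \<subseteq> {(a, b). rectangle_bounds e a b}" "A \<subseteq> (\<Union>(a, b)\<in>\<C>. rectangle e a b)"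
proof -
  have "\<exists>\<C>. finite \<C> \<and> \<C> \<subseteq> {(a, b). rectangle_bounds e a b} \<and> A \<subseteq> (\<Union>(a, b)\<in>\<C>. rectangle e a b)"
    using assms
  proof (induction rule: rectangle_ring_induct)
    case (rectangle a b)
    then show ?case by (intro exI[of _ "{(a, b)}"]) auto
  next
    case (Un A B)
    then obtain \<C> \<D> where "finite \<C>" "\<C> \<subseteq> {(a, b). rectangle_bounds e a b}" "A \<subseteq> (\<Union>(a, b)\<in>\<C>. rectangle e a b)"
      "finite \<D>" "\<D> \<subseteq> {(a, b). rectangle_bounds e a b}" "B \<subseteq> (\<Union>(a, b)\<in>\<D>. rectangle e a b)" by blast
    then show ?case by (intro exI[of _ "\<C> \<union> \<D>"]) auto
  next
    case (Diff A B)
    then show ?case by (elim exE conjE) (meson Diff_subset order_trans)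
  qed auto
  then show thesis by (elim exE conjE) (rule that)
qed

text \<open>
  The quantification over all additive \<open>\<mu>\<close> gives uniqueness of the extension, and for point masses
  \<open>\<mu>\<close> it expresses the indicator function of \<open>A\<close> by indicator functions of rectangles.
\<close>

definition rectangle_expansion ::
    "(nat \<Rightarrow> 'a::real_inner) \<Rightarrow> 'a set \<Rightarrow> (real \<times> (nat \<Rightarrow> real) \<times> (nat \<Rightarrow> real)) list \<Rightarrow> bool" where
  "rectangle_expansion e A l \<longleftrightarrow>
     (\<forall>(c, a, b)\<in>set l. rectangle_bounds e a b) \<and>
     (\<forall>\<mu>. additive (rectangle_ring e) \<mu> \<longrightarrow>
        (\<forall>B\<in>rectangle_ring e. \<mu> (A \<inter> B) = (\<Sum>(c, a, b)\<leftarrow>l. c * \<mu> (rectangle e a b \<inter> B))))"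

abbreviation expansion_volume :: "(real \<times> (nat \<Rightarrow> real) \<times> (nat \<Rightarrow> real)) list \<Rightarrow> real" where
  "expansion_volume l \<equiv> (\<Sum>(c, a, b)\<leftarrow>l. c * rectangle_volume a b)"

lemma additive_empty:
  fixes \<mu> :: "'a::real_inner set \<Rightarrow> real"
  shows "additive (rectangle_ring e) \<mu> \<Longrightarrow> \<mu> {} = 0"
  unfolding additive_def by (drule bspec[OF _ rectangle_ring_empty], drule bspec[OF _ rectangle_ring_empty]) simp

text \<open>A product of signed combinations is again one, since rectangles intersect in rectangles.
  Empty intersections violate \<open>rectangle_bounds\<close> and are dropped from the list; this is
  where \<open>\<mu> {} = 0\<close> enters.\<close>

lemma rectangle_expansion_product:
  fixes e :: "nat \<Rightarrow> 'a::real_inner"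
  assumes "\<forall>(c, a, b)\<in>set l. rectangle_bounds e a b" "\<forall>(c, a, b)\<in>set l'. rectangle_bounds e a b"
  obtains m where "\<forall>(c, a, b)\<in>set m. rectangle_bounds e a b"
    "\<And>(\<mu> :: 'a set \<Rightarrow> real) B. \<mu> {} = 0 \<Longrightarrow> (\<Sum>(c, a, b)\<leftarrow>m. c * \<mu> (rectangle e a b \<inter> B)) =
       (\<Sum>(c, a, b)\<leftarrow>l. c * (\<Sum>(c', a', b')\<leftarrow>l'. c' * \<mu> (rectangle e a' b' \<inter> (rectangle e a b \<inter> B))))"
proof -
  have 1: "\<exists>m. (\<forall>(c, a, b)\<in>set m. rectangle_bounds e a b) \<and>
     (\<forall>(\<mu> :: 'a set \<Rightarrow> real) B. \<mu> {} = 0 \<longrightarrow> (\<Sum>(c, a, b)\<leftarrow>m. c * \<mu> (rectangle e a b \<inter> B)) =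
       c * (\<Sum>(c', a', b')\<leftarrow>l'. c' * \<mu> (rectangle e a' b' \<inter> (rectangle e a b \<inter> B))))" (is "\<exists>m. ?Q l' m")
    if "rectangle_bounds e a b" for c a b
    using assms(2)
  proof (induction l')
    case Nil
    then show ?case by (intro exI[of _ "[]"]) simp
  next
    case (Cons t l')
    obtain c' a' b' where t: "t = (c', a', b')" by (cases t)
    obtain m where m: "?Q l' m" using Cons by auto
    let ?a = "\<lambda>j. max (a' j) (a j)" and ?b = "\<lambda>j. min (b' j) (b j)"
    have bd': "rectangle_bounds e a' b'" using Cons.prems t by simp
    show ?case
    proof (cases "rectangle e a' b' \<inter> rectangle e a b = {}")
      case True
      then have "rectangle e a' b' \<inter> (rectangle e a b \<inter> B) = {}" for B by blast
      then have "?Q (t # l') m" using m by (simp add: t)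
      then show ?thesis by blast
    next
      case False
      have "rectangle e a' b' \<inter> (rectangle e a b \<inter> B) = rectangle e ?a ?b \<inter> B" for B
        unfolding rectangle_Int[symmetric] by blast
      moreover have "rectangle_bounds e ?a ?b" by (rule rectangle_bounds_Int[OF bd' False])
      ultimately have "?Q (t # l') ((c * c', ?a, ?b) # m)"
        using m by (simp add: t algebra_simps)
      then show ?thesis by blast
    qed
  qed
  have "\<exists>m. (\<forall>(c, a, b)\<in>set m. rectangle_bounds e a b) \<and>
     (\<forall>(\<mu> :: 'a set \<Rightarrow> real) B. \<mu> {} = 0 \<longrightarrow> (\<Sum>(c, a, b)\<leftarrow>m. c * \<mu> (rectangle e a b \<inter> B)) =
       (\<Sum>(c, a, b)\<leftarrow>l. c * (\<Sum>(c', a', b')\<leftarrow>l'. c' * \<mu> (rectangle e a' b' \<inter> (rectangle e a b \<inter> B)))))" (is "\<exists>m. ?Q l m")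
    using assms(1)
  proof (induction l)
    case Nil
    then show ?case by (intro exI[of _ "[]"]) simp
  next
    case (Cons t l)
    obtain c a b where t: "t = (c, a, b)" by (cases t)
    obtain m where m: "?Q l m" using Cons by auto
    have "rectangle_bounds e a b" using Cons.prems t by simp
    from 1[OF this, of c] obtain m' where m': "(\<forall>(c, a, b)\<in>set m'. rectangle_bounds e a b) \<and>
     (\<forall>(\<mu> :: 'a set \<Rightarrow> real) B. \<mu> {} = 0 \<longrightarrow> (\<Sum>(c, a, b)\<leftarrow>m'. c * \<mu> (rectangle e a b \<inter> B)) =
       c * (\<Sum>(c', a', b')\<leftarrow>l'. c' * \<mu> (rectangle e a' b' \<inter> (rectangle e a b \<inter> B))))" ..
    have "?Q (t # l) (m' @ m)" using m m' by (auto simp: t)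
    then show ?case by blast
  qed
  then show thesis using that by blast
qed

lemma expansion_uminus:
  fixes F :: "(nat \<Rightarrow> real) \<Rightarrow> (nat \<Rightarrow> real) \<Rightarrow> real"
  shows "(\<Sum>(c, a, b)\<leftarrow>map (\<lambda>(c, a, b). (- c, a, b)) l. c * F a b) = - (\<Sum>(c, a, b)\<leftarrow>l. c * F a b)"
  by (induction l) auto

lemma rectangle_expansion_Un:
  assumes "rectangle_expansion e A l" "rectangle_expansion e B m"
    "A \<in> rectangle_ring e" "B \<in> rectangle_ring e" "A \<inter> B = {}"
  shows "rectangle_expansion e (A \<union> B) (l @ m)"
proof -
  have "\<mu> ((A \<union> B) \<inter> C) = \<mu> (A \<inter> C) + \<mu> (B \<inter> C)"
    if "additive (rectangle_ring e) \<mu>" "C \<in> rectangle_ring e" for C and \<mu> :: "'a set \<Rightarrow> real"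
  proof -
    have "A \<inter> C \<in> rectangle_ring e" "B \<inter> C \<in> rectangle_ring e" "(A \<inter> C) \<inter> (B \<inter> C) = {}"
      using assms(3-5) that by auto
    then show ?thesis using that(1) by (simp add: additive_def Int_Un_distrib2)
  qed
  then show ?thesis
    using assms(1,2) unfolding rectangle_expansion_def by auto
qed

lemma rectangle_expansion_exists:
  fixes e :: "nat \<Rightarrow> 'a::real_inner"
  assumes "A \<in> rectangle_ring e"
  shows "\<exists>l. rectangle_expansion e A l"
  using assms
proof (induction rule: rectangle_ring_induct)
  case empty
  show ?case by (rule exI[of _ "[]"]) (simp add: rectangle_expansion_def additive_empty)
next
  case (rectangle a b)
  then show ?case by (intro exI[of _ "[(1, a, b)]"]) (simp add: rectangle_expansion_def)
next
  case (Diff A B)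
  then obtain l l' where l: "rectangle_expansion e A l" and l': "rectangle_expansion e B l'" by blast
  then have bd: "\<forall>(c, a, b)\<in>set l. rectangle_bounds e a b" "\<forall>(c, a, b)\<in>set l'. rectangle_bounds e a b"
    by (auto simp: rectangle_expansion_def)
  obtain m where m: "\<forall>(c, a, b)\<in>set m. rectangle_bounds e a b"
    "\<And>(\<mu> :: 'a set \<Rightarrow> real) B. \<mu> {} = 0 \<Longrightarrow> (\<Sum>(c, a, b)\<leftarrow>m. c * \<mu> (rectangle e a b \<inter> B)) =
       (\<Sum>(c, a, b)\<leftarrow>l. c * (\<Sum>(c', a', b')\<leftarrow>l'. c' * \<mu> (rectangle e a' b' \<inter> (rectangle e a b \<inter> B))))"
    by (rule rectangle_expansion_product[OF bd]) blast
  have "rectangle_expansion e (A - B) (l @ map (\<lambda>(c, a, b). (- c, a, b)) m)"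
    unfolding rectangle_expansion_def
  proof (intro conjI allI impI ballI)
    show "case t of (c, a, b) \<Rightarrow> rectangle_bounds e a b"
      if "t \<in> set (l @ map (\<lambda>(c, a, b). (- c, a, b)) m)" for t
      using that bd m(1) by fastforce
    fix \<mu> :: "'a set \<Rightarrow> real" and C
    assume \<mu>: "additive (rectangle_ring e) \<mu>" and C: "C \<in> rectangle_ring e"
    have R: "rectangle e a b \<in> rectangle_ring e" if "(c, a, b) \<in> set l" for c a b
      using bd(1) that by auto
    \<comment> \<open>The indicator of \<open>A - B\<close> is that of \<open>A\<close> minus the
      product of those of \<open>A\<close> and \<open>B\<close>. The free test set in the notion of
      expansion makes the product accessible: expand \<open>A\<close> against
      \<open>B \<inter> C\<close>, then \<open>B\<close> inside each rectangle.\<close>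
    have "\<mu> (A \<inter> C) = \<mu> ((A - B) \<inter> C) + \<mu> (A \<inter> (B \<inter> C))"
    proof -
      have "A \<inter> C = ((A - B) \<inter> C) \<union> (A \<inter> (B \<inter> C))" by blast
      moreover have "((A - B) \<inter> C) \<inter> (A \<inter> (B \<inter> C)) = {}" by blast
      moreover have "(A - B) \<inter> C \<in> rectangle_ring e" "A \<inter> (B \<inter> C) \<in> rectangle_ring e" using Diff C by auto
      ultimately show ?thesis using \<mu> unfolding additive_def by presburger
    qed
    moreover have "\<mu> (A \<inter> C) = (\<Sum>(c, a, b)\<leftarrow>l. c * \<mu> (rectangle e a b \<inter> C))"
      using l \<mu> C by (simp add: rectangle_expansion_def)
    moreover have "\<mu> (A \<inter> (B \<inter> C)) = (\<Sum>(c, a, b)\<leftarrow>l. c * \<mu> (rectangle e a b \<inter> (B \<inter> C)))"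
      using l \<mu> C Diff by (simp add: rectangle_expansion_def rectangle_ring_Int)
    moreover have "(\<Sum>(c, a, b)\<leftarrow>l. c * \<mu> (rectangle e a b \<inter> (B \<inter> C))) =
        (\<Sum>(c, a, b)\<leftarrow>l. c * (\<Sum>(c', a', b')\<leftarrow>l'. c' * \<mu> (rectangle e a' b' \<inter> (rectangle e a b \<inter> C))))"
    proof (rule arg_cong[of _ _ sum_list], rule map_cong[OF refl], clarify)
      fix c a b assume "(c, a, b) \<in> set l"
      then have "\<mu> (B \<inter> (rectangle e a b \<inter> C)) = (\<Sum>(c', a', b')\<leftarrow>l'. c' * \<mu> (rectangle e a' b' \<inter> (rectangle e a b \<inter> C)))"
        using l' \<mu> C R by (simp add: rectangle_expansion_def rectangle_ring_Int)
      then show "c * \<mu> (rectangle e a b \<inter> (B \<inter> C)) = c * (\<Sum>(c', a', b')\<leftarrow>l'. c' * \<mu> (rectangle e a' b' \<inter> (rectangle e a b \<inter> C)))"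
        by (simp add: Int_left_commute)
    qed
    ultimately show "\<mu> ((A - B) \<inter> C) =
        (\<Sum>(c, a, b)\<leftarrow>l @ map (\<lambda>(c, a, b). (- c, a, b)) m. c * \<mu> (rectangle e a b \<inter> C))"
      using m(2)[of \<mu> C, OF additive_empty[OF \<mu>]] expansion_uminus[of "\<lambda>a b. \<mu> (rectangle e a b \<inter> C)" m]
      by simp
  qed
  then show ?case by (rule exI)
next
  case (Un A B)
  then obtain l m where "rectangle_expansion e A l" "rectangle_expansion e B m" by blast
  then have "rectangle_expansion e (A \<union> B) (l @ m)" using Un by (intro rectangle_expansion_Un)
  then show ?case by (rule exI)
qed

lemma expansion_value:
  fixes \<mu> :: "'a::real_inner set \<Rightarrow> real"
  assumes A: "A \<in> rectangle_ring e" and l: "rectangle_expansion e A l" and \<mu>: "additive (rectangle_ring e) \<mu>"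
  shows "\<mu> A = (\<Sum>(c, a, b)\<leftarrow>l. c * \<mu> (rectangle e a b))"
proof -
  have bd: "rectangle_bounds e a b" if "(c, a, b) \<in> set l" for c a b
    using l that by (auto simp: rectangle_expansion_def)
  \<comment> \<open>The whole space need not belong to the ring, so the test set is a ring set that
    contains \<open>A\<close> and all rectangles of the expansion.\<close>
  let ?B = "A \<union> (\<Union>t\<in>set l. rectangle e (fst (snd t)) (snd (snd t)))"
  have "?B \<in> rectangle_ring e" using A bd by (intro rectangle_ring_Un rectangle_ring_UN) auto
  then have "\<mu> (A \<inter> ?B) = (\<Sum>(c, a, b)\<leftarrow>l. c * \<mu> (rectangle e a b \<inter> ?B))"
    using l \<mu> unfolding rectangle_expansion_def by blast
  moreover have "A \<inter> ?B = A" by blast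
  moreover have "(\<Sum>(c, a, b)\<leftarrow>l. c * \<mu> (rectangle e a b \<inter> ?B)) = (\<Sum>(c, a, b)\<leftarrow>l. c * \<mu> (rectangle e a b))"
  proof (rule arg_cong[of _ _ sum_list], rule map_cong[OF refl], clarify)
    fix c a b assume "(c, a, b) \<in> set l"
    then have "rectangle e a b \<inter> ?B = rectangle e a b" by force
    then show "c * \<mu> (rectangle e a b \<inter> ?B) = c * \<mu> (rectangle e a b)" by simp
  qed
  ultimately show ?thesis by simp
qed

lemma expansion_indicator:
  assumes "A \<in> rectangle_ring e" "rectangle_expansion e A l"
  shows "indicator A x = (\<Sum>(c, a, b)\<leftarrow>l. c * (indicator (rectangle e a b) x :: real))"
  by (rule expansion_value[OF assms, of "\<lambda>A. indicator A x"]) (auto simp: additive_def indicator_def)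

lemma expansion_volume_nonneg:
  assumes e: "orthonormal_basis e" and bd: "\<forall>(c, a, b)\<in>set l. rectangle_bounds e a b"
    and nn: "\<And>x. 0 \<le> (\<Sum>(c, a, b)\<leftarrow>l. c * (indicator (rectangle e a b) x :: real))"
  shows "0 \<le> expansion_volume l"
proof -
  let ?c = "\<lambda>i. fst (l ! i)" and ?a = "\<lambda>i. fst (snd (l ! i))" and ?b = "\<lambda>i. snd (snd (l ! i))"
  have eq: "(\<Sum>(c, a, b)\<leftarrow>l. c * F a b) = (\<Sum>i<length l. ?c i * F (?a i) (?b i))"
    for F :: "(nat \<Rightarrow> real) \<Rightarrow> (nat \<Rightarrow> real) \<Rightarrow> real"
    by (simp add: sum_list_sum_nth case_prod_beta atLeast0LessThan)
  show ?thesis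
    unfolding eq
  proof (rule rectangle_combination_nonneg[OF e])
    show "rectangle_bounds e (?a i) (?b i)" if "i \<in> {..<length l}" for i
      using bd that nth_mem[of i l] by (auto simp: case_prod_beta)
    show "0 \<le> (\<Sum>i<length l. ?c i * indicator (rectangle e (?a i) (?b i)) x)" for x
      using nn[of x] unfolding eq[of "\<lambda>a b. indicator (rectangle e a b) x"] .
  qed simp
qed

lemma expansion_volume_unique:
  assumes e: "orthonormal_basis e" and A: "A \<in> rectangle_ring e"
    and l: "rectangle_expansion e A l" and m: "rectangle_expansion e A m"
  shows "expansion_volume l = expansion_volume m"
proof -
  have "expansion_volume m \<le> expansion_volume l"
    if l: "rectangle_expansion e A l" and m: "rectangle_expansion e A m" for l m
  proof -
    \<comment> \<open>This list represents the zero function, so positivity applies; exchanging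
      \<open>l\<close> and \<open>m\<close> then gives equality.\<close>
    let ?k = "l @ map (\<lambda>(c, a, b). (- c, a, b)) m"
    have "0 \<le> expansion_volume ?k"
    proof (rule expansion_volume_nonneg[OF e])
      show "\<forall>(c, a, b)\<in>set ?k. rectangle_bounds e a b"
        using l m by (fastforce simp: rectangle_expansion_def)
      show "0 \<le> (\<Sum>(c, a, b)\<leftarrow>?k. c * (indicator (rectangle e a b) x :: real))" for x
        using expansion_indicator[OF A l, of x] expansion_indicator[OF A m, of x]
          expansion_uminus[of "\<lambda>a b. indicator (rectangle e a b) x" m]
        by simp
    qed
    then show ?thesis using expansion_uminus[of rectangle_volume m] by simp
  qed
  from this[OF l m] this[OF m l] show ?thesis by simp
qed

lemma expansion_of_rectangle:
  "rectangle_bounds e a b \<Longrightarrow> rectangle_expansion e (rectangle e a b) [(1, a, b)]"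
  by (simp add: rectangle_expansion_def)

section \<open>Translations, and existence and uniqueness of the extension\<close>

lemma rectangle_shift:
  "(\<lambda>x. x + h) ` rectangle e a b = rectangle e (\<lambda>j. a j + h \<bullet> e j) (\<lambda>j. b j + h \<bullet> e j)"
proof -
  have "y \<in> (\<lambda>x. x + h) ` rectangle e a b" if "y \<in> rectangle e (\<lambda>j. a j + h \<bullet> e j) (\<lambda>j. b j + h \<bullet> e j)" for y
    using that by (intro image_eqI[of _ _ "y - h"]) (auto simp: in_rectangle inner_diff_left algebra_simps)
  then show ?thesis by (auto simp: in_rectangle inner_add_left)
qed

lemma rectangle_bounds_shift:
  assumes e: "orthonormal_basis e" and ab: "rectangle_bounds e a b"
  shows "rectangle_bounds e (\<lambda>j. a j + h \<bullet> e j) (\<lambda>j. b j + h \<bullet> e j)"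
proof -
  have "\<bar>h \<bullet> e j\<bar> \<le> norm h" for j
    using Cauchy_Schwarz_ineq2[of h "e j"] ortho_inner[OF e, of j j] by (simp add: norm_eq_sqrt_inner)
  then have "bounded (range (\<lambda>j. h \<bullet> e j))" by (auto simp: bounded_iff)
  moreover have "bounded (range (\<lambda>j. u j + v j))" if u: "bounded (range u)" and v: "bounded (range v)" for u v :: "nat \<Rightarrow> real"
  proof -
    obtain U where U: "\<And>j. \<bar>u j\<bar> \<le> U" using u by (auto simp: bounded_iff)
    obtain V where V: "\<And>j. \<bar>v j\<bar> \<le> V" using v by (auto simp: bounded_iff)
    have "\<bar>u j + v j\<bar> \<le> U + V" for j using U[of j] V[of j] by linarith
    then show ?thesis by (auto simp: bounded_iff)
  qed
  ultimately show ?thesis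
    using ab unfolding rectangle_bounds_def rectangle_shift[symmetric] by simp
qed

lemma shift_in_ring:
  assumes e: "orthonormal_basis e" and "A \<in> rectangle_ring e"
  shows "(\<lambda>x. x + h) ` A \<in> rectangle_ring e"
  using assms(2)
proof (induction rule: rectangle_ring_induct)
  case (rectangle a b)
  then show ?case unfolding rectangle_shift by (intro rectangle_in_ring rectangle_bounds_shift[OF e])
next
  case (Diff A B)
  then show ?case by (subst image_set_diff) auto
qed (auto simp: image_Un)

lemma shift_invariant_extension_unique:
  assumes "shift_invariant_extension e \<mu>" "shift_invariant_extension e \<nu>" "A \<in> rectangle_ring e"
  shows "\<mu> A = \<nu> A"
proof -
  obtain l where l: "rectangle_expansion e A l" using rectangle_expansion_exists[OF assms(3)] by blast
  have "\<rho> A = expansion_volume l" if "shift_invariant_extension e \<rho>" for \<rho>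
  proof -
    have "\<rho> A = (\<Sum>(c, a, b)\<leftarrow>l. c * \<rho> (rectangle e a b))"
      using that by (intro expansion_value[OF assms(3) l]) (simp add: shift_invariant_extension_def)
    also have "\<dots> = expansion_volume l"
      using that l by (intro arg_cong[of _ _ sum_list] map_cong[OF refl])
        (auto simp: shift_invariant_extension_def rectangle_expansion_def)
    finally show ?thesis .
  qed
  from this[OF assms(1)] this[OF assms(2)] show ?thesis by simp
qed

lemma shift_invariant_extension_exists:
  fixes e :: "nat \<Rightarrow> 'a::{real_inner, complete_space}"
  assumes e: "orthonormal_basis e"
  shows "\<exists>\<mu>. shift_invariant_extension e \<mu>"
proof -
  define \<mu> where "\<mu> = (\<lambda>A. expansion_volume (SOME l. rectangle_expansion e A l))"
  have \<mu>: "\<mu> A = expansion_volume l" if "A \<in> rectangle_ring e" "rectangle_expansion e A l" for A l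
    unfolding \<mu>_def by (rule expansion_volume_unique[OF e that(1) someI[of "rectangle_expansion e A", OF that(2)] that(2)])
  have rect: "\<mu> (rectangle e a b) = rectangle_volume a b" if "rectangle_bounds e a b" for a b
    using \<mu>[OF rectangle_in_ring[OF that] expansion_of_rectangle[OF that]] by simp
  have nonneg: "0 \<le> \<mu> A" if A: "A \<in> rectangle_ring e" for A
  proof -
    obtain l where l: "rectangle_expansion e A l" using rectangle_expansion_exists[OF A] by blast
    have "0 \<le> expansion_volume l"
    proof (rule expansion_volume_nonneg[OF e])
      show "\<forall>(c, a, b)\<in>set l. rectangle_bounds e a b"
        using l unfolding rectangle_expansion_def by blast
      show "0 \<le> (\<Sum>(c, a, b)\<leftarrow>l. c * (indicator (rectangle e a b) x :: real))" for x
        unfolding expansion_indicator[OF A l, symmetric] by simp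
    qed
    then show ?thesis using \<mu>[OF A l] by simp
  qed
  have add: "additive (rectangle_ring e) \<mu>"
    unfolding additive_def
  proof (intro ballI impI)
    fix A B assume A: "A \<in> rectangle_ring e" and B: "B \<in> rectangle_ring e" and "A \<inter> B = {}"
    obtain l m where l: "rectangle_expansion e A l" and m: "rectangle_expansion e B m"
      using rectangle_expansion_exists A B by blast
    have "rectangle_expansion e (A \<union> B) (l @ m)"
      by (rule rectangle_expansion_Un) fact+
    then show "\<mu> (A \<union> B) = \<mu> A + \<mu> B"
      using \<mu>[OF A l] \<mu>[OF B m] \<mu>[OF rectangle_ring_Un[OF A B]] by simp
  qed
  \<comment> \<open>Translating before measuring is again additive, so the expansion of
    \<open>A\<close> evaluates it; on a rectangle a translation moves both bounds and keeps the
    lengths.\<close>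
  have shift: "\<mu> ((\<lambda>x. x + h) ` A) = \<mu> A" if A: "A \<in> rectangle_ring e" for A h
  proof -
    obtain l where l: "rectangle_expansion e A l" using rectangle_expansion_exists[OF A] by blast
    have "additive (rectangle_ring e) (\<lambda>A. \<mu> ((\<lambda>x. x + h) ` A))"
      unfolding additive_def
    proof (intro ballI impI)
      fix A B :: "'a set" assume A: "A \<in> rectangle_ring e" and B: "B \<in> rectangle_ring e" and "A \<inter> B = {}"
      then have "(\<lambda>x. x + h) ` A \<inter> (\<lambda>x. x + h) ` B = {}" by auto
      then show "\<mu> ((\<lambda>x. x + h) ` (A \<union> B)) = \<mu> ((\<lambda>x. x + h) ` A) + \<mu> ((\<lambda>x. x + h) ` B)"
        using add shift_in_ring[OF e A] shift_in_ring[OF e B] by (simp add: image_Un additive_def)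
    qed
    then have "\<mu> ((\<lambda>x. x + h) ` A) = (\<Sum>(c, a, b)\<leftarrow>l. c * \<mu> ((\<lambda>x. x + h) ` rectangle e a b))"
      by (rule expansion_value[OF A l])
    also have "\<dots> = expansion_volume l"
    proof (rule arg_cong[of _ _ sum_list], rule map_cong[OF refl], clarify)
      fix c a b assume "(c, a, b) \<in> set l"
      then have "rectangle_bounds e a b" using l by (auto simp: rectangle_expansion_def)
      then show "c * \<mu> ((\<lambda>x. x + h) ` rectangle e a b) = c * rectangle_volume a b"
        unfolding rectangle_shift
        by (subst rect[OF rectangle_bounds_shift[OF e]]) (auto simp: rectangle_volume_def)
    qed
    finally show ?thesis using \<mu>[OF A l] by simp
  qed
  show ?thesis
    unfolding shift_invariant_extension_def
    by (intro exI[of _ \<mu>] conjI ballI allI impI nonneg add shift additive_empty[OF add] rect)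
qed

text \<open>Restricting any extension to the ring produces the single extensional candidate, so the
  definite description denotes.\<close>

lemma ring_measure_extension:
  fixes e :: "nat \<Rightarrow> 'a::{real_inner, complete_space}"
  assumes e: "orthonormal_basis e"
  shows "shift_invariant_extension e (ring_measure e)"
proof -
  obtain \<mu> where \<mu>: "shift_invariant_extension e \<mu>" using shift_invariant_extension_exists[OF e] by blast
  let ?\<nu> = "restrict \<mu> (rectangle_ring e)"
  have ex: "shift_invariant_extension e ?\<nu>"
    unfolding shift_invariant_extension_def additive_def
  proof (intro conjI ballI allI impI)
    fix A assume A: "A \<in> rectangle_ring e"
    then show "0 \<le> ?\<nu> A" using \<mu> by (simp add: shift_invariant_extension_def)
    show "?\<nu> ((\<lambda>x. x + h) ` A) = ?\<nu> A" for h
      using \<mu> A shift_in_ring[OF e A, of h] by (simp add: shift_invariant_extension_def)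
    show "?\<nu> (A \<union> B) = ?\<nu> A + ?\<nu> B" if "B \<in> rectangle_ring e" "A \<inter> B = {}" for B
      using \<mu> A that rectangle_ring_Un[OF A that(1)] by (simp add: shift_invariant_extension_def additive_def)
  next
    show "?\<nu> {} = 0" using \<mu> by (simp add: shift_invariant_extension_def)
    show "?\<nu> (rectangle e a b) = rectangle_volume a b" if "rectangle_bounds e a b" for a b
      using \<mu> rectangle_in_ring[OF that] that by (simp add: shift_invariant_extension_def)
  qed
  have "\<exists>!\<nu>. \<nu> \<in> extensional (rectangle_ring e) \<and> shift_invariant_extension e \<nu>"
  proof (rule ex1I[of _ ?\<nu>])
    show "?\<nu> \<in> extensional (rectangle_ring e) \<and> shift_invariant_extension e ?\<nu>" using ex by simp
    fix \<nu> assume "\<nu> \<in> extensional (rectangle_ring e) \<and> shift_invariant_extension e \<nu>"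
    then show "\<nu> = ?\<nu>"
      using shift_invariant_extension_unique[OF _ ex] by (intro extensionalityI) auto
  qed
  from theI'[OF this] show ?thesis unfolding ring_measure_def by blast
qed

section \<open>Inner approximation by rectangles\<close>

lemma ring_measure_nonneg: "orthonormal_basis e \<Longrightarrow> A \<in> rectangle_ring e \<Longrightarrow> 0 \<le> ring_measure e A"
  using ring_measure_extension[of e] by (simp add: shift_invariant_extension_def)

lemma ring_measure_additive: "orthonormal_basis e \<Longrightarrow> additive (rectangle_ring e) (ring_measure e)"
  using ring_measure_extension[of e] by (simp add: shift_invariant_extension_def)

lemma ring_measure_Un:
  "orthonormal_basis e \<Longrightarrow> A \<in> rectangle_ring e \<Longrightarrow> B \<in> rectangle_ring e \<Longrightarrow> A \<inter> B = {} \<Longrightarrow>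
    ring_measure e (A \<union> B) = ring_measure e A + ring_measure e B"
  using ring_measure_additive[of e] by (simp add: additive_def)

lemma ring_measure_empty: "orthonormal_basis e \<Longrightarrow> ring_measure e {} = 0"
  using ring_measure_extension[of e] by (simp add: shift_invariant_extension_def)

lemma ring_measure_rectangle:
  "orthonormal_basis e \<Longrightarrow> rectangle_bounds e a b \<Longrightarrow> ring_measure e (rectangle e a b) = rectangle_volume a b"
  using ring_measure_extension[of e] by (simp add: shift_invariant_extension_def)

lemma ring_measure_Diff:
  assumes e: "orthonormal_basis e" and A: "A \<in> rectangle_ring e" and B: "B \<in> rectangle_ring e" "B \<subseteq> A"
  shows "ring_measure e (A - B) = ring_measure e A - ring_measure e B"
proof -
  have "ring_measure e ((A - B) \<union> B) = ring_measure e (A - B) + ring_measure e B"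
    by (rule ring_measure_Un[OF e rectangle_ring_Diff[OF A B(1)] B(1)]) blast
  moreover have "(A - B) \<union> B = A" using B(2) by blast
  ultimately show ?thesis by simp
qed

lemma ring_measure_mono:
  assumes e: "orthonormal_basis e" and A: "A \<in> rectangle_ring e" and B: "B \<in> rectangle_ring e" "B \<subseteq> A"
  shows "ring_measure e B \<le> ring_measure e A"
  using ring_measure_Diff[OF assms] ring_measure_nonneg[OF e rectangle_ring_Diff[OF A B(1)]] by simp

lemma ring_measure_UN_disjoint:
  assumes e: "orthonormal_basis e" and "finite I"
    and A: "\<And>i. i \<in> I \<Longrightarrow> A i \<in> rectangle_ring e" and d: "disjoint_family_on A I"
  shows "ring_measure e (\<Union>i\<in>I. A i) = (\<Sum>i\<in>I. ring_measure e (A i))"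
  using \<open>finite I\<close> A d
proof (induction I rule: finite_induct)
  case empty
  show ?case by (simp add: ring_measure_empty[OF e])
next
  case (insert i I)
  have "A i \<inter> (\<Union>j\<in>I. A j) = {}"
    using insert.prems(2) insert.hyps(2) by (auto simp: disjoint_family_on_def)
  moreover have "(\<Union>j\<in>I. A j) \<in> rectangle_ring e"
    using insert.prems(1) insert.hyps(1) by (intro rectangle_ring_UN) auto
  moreover have "disjoint_family_on A I"
    using insert.prems(2) by (auto simp: disjoint_family_on_def)
  ultimately show ?case using insert by (simp add: ring_measure_Un[OF e])
qed

lemma rectangle_Inter:
  assumes "finite S" "S \<noteq> {}" "\<And>a b. (a, b) \<in> S \<Longrightarrow> rectangle_bounds e a b" "(\<Inter>(a, b)\<in>S. rectangle e a b) \<noteq> {}"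
  shows "\<exists>a b. rectangle_bounds e a b \<and> (\<Inter>(a, b)\<in>S. rectangle e a b) = rectangle e a b"
  using assms
proof (induction S rule: finite_ne_induct)
  case (singleton p)
  then show ?case by (cases p) auto
next
  case (insert p S)
  obtain a b where p: "p = (a, b)" by (cases p)
  have "(\<Inter>(a, b)\<in>S. rectangle e a b) \<noteq> {}" using insert.prems(2) by auto
  then obtain a' b' where ab': "rectangle_bounds e a' b'" "(\<Inter>(a, b)\<in>S. rectangle e a b) = rectangle e a' b'"
    using insert.IH insert.prems(1) by (metis insertCI)
  have "rectangle e a b \<inter> rectangle e a' b' \<noteq> {}"
    using insert.prems(2) by (simp add: p ab'(2))
  from rectangle_bounds_Int[OF _ this] show ?case
    using insert.prems(1) by (auto simp: p ab'(2) rectangle_Int)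
qed

lemma rectangle_restrict:
  assumes "\<And>j s. a' j \<le> s \<and> s < b' j \<longleftrightarrow> (a j \<le> s \<and> s < b j) \<and> Q j s"
  shows "rectangle e a' b' = rectangle e a b \<inter> {x. \<forall>j. Q j (x \<bullet> e j)}"
  unfolding set_eq_iff Int_iff in_rectangle mem_Collect_eq assms by blast

text \<open>
  The difference of two infinite-dimensional rectangles \<open>R\<close> and \<open>R'\<close> is not a finite union of
  rectangles, but it is approximated from inside by \<open>R - F n\<close>, where \<open>F n\<close> is cut out by the first
  \<open>n\<close> constraints of \<open>R'\<close>.
\<close>

lemma rectangle_ring_inner_induct [consumes 2, case_names empty rectangle Un limit]:
  fixes e :: "nat \<Rightarrow> 'a::{real_inner, complete_space}"
  assumes e: "orthonormal_basis e" and A: "A \<in> rectangle_ring e"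
    and P0: "P {}"
    and PR: "\<And>a b. rectangle_bounds e a b \<Longrightarrow> 0 < rectangle_volume a b \<Longrightarrow> P (rectangle e a b)"
    and PU: "\<And>A B. A \<in> rectangle_ring e \<Longrightarrow> B \<in> rectangle_ring e \<Longrightarrow> A \<inter> B = {} \<Longrightarrow> P A \<Longrightarrow> P B \<Longrightarrow> P (A \<union> B)"
    and PL: "\<And>A. A \<in> rectangle_ring e \<Longrightarrow>
      (\<And>\<epsilon>. \<epsilon> > 0 \<Longrightarrow> \<exists>A'\<in>rectangle_ring e. A' \<subseteq> A \<and> P A' \<and> ring_measure e A - \<epsilon> \<le> ring_measure e A') \<Longrightarrow> P A"
  shows "P A"
proof -
  let ?m = "ring_measure e"
  \<comment> \<open>Induction on the set \<open>T\<close> of removed rectangles, with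
    \<open>a\<close> and \<open>b\<close> arbitrary: removing one more rectangle cuts
    \<open>rectangle e a b\<close> into smaller rectangles, to each of which the hypothesis for
    \<open>T\<close> applies.\<close>
  have atom: "P (rectangle e a b - (\<Union>(a, b)\<in>T. rectangle e a b))"
    if "finite T" "\<And>a b. (a, b) \<in> T \<Longrightarrow> rectangle_bounds e a b" "rectangle_bounds e a b" for T a b
    using that
  proof (induction T arbitrary: a b rule: finite_induct)
    case empty
    show ?case
    proof (cases "0 < rectangle_volume a b")
      case True
      then show ?thesis using PR empty by simp
    next
      case False
      \<comment> \<open>A null rectangle is approximated from inside by the empty set, so
        \<open>PR\<close> has to deal with positive volume only.\<close>
      then have "?m (rectangle e a b) \<le> 0"
        using empty by (simp add: ring_measure_rectangle[OF e])
      then have "P (rectangle e a b)"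
        using empty P0 by (intro PL bexI[of _ "{}"]) (auto simp: ring_measure_empty[OF e])
      then show ?thesis by simp
    qed
  next
    case (insert t T)
    obtain a' b' where t: "t = (a', b')" by (cases t)
    have bd: "rectangle_bounds e a b" and bd': "rectangle_bounds e a' b'" using insert.prems t by auto
    let ?R = "rectangle e a b" and ?R' = "rectangle e a' b'" and ?W = "\<Union>(a, b)\<in>T. rectangle e a b"
    have W: "?W \<in> rectangle_ring e"
      using insert.hyps insert.prems(1) by (intro rectangle_ring_UN) auto
    have IH: "P (rectangle e a b - ?W)" if "rectangle_bounds e a b" for a b
      using insert.IH insert.prems(1) that by blast
    have IH': "rectangle e a b \<in> rectangle_ring e" "P (rectangle e a b - ?W)"
      if "rectangle_bounds e a0 b0" "\<And>j. a0 j \<le> a j" "\<And>j. b j \<le> b0 j" for a b a0 b0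
      using sub_rectangle_in_ring[OF that] IH[of a b] rectangle_bounds_sub[OF that] P0
      by (cases "rectangle e a b = {}"; auto)+
    show ?case
    proof (cases "?R \<inter> ?R' = {}")
      case True
      then have "?R - (\<Union>(a, b)\<in>insert t T. rectangle e a b) = ?R - ?W" by (auto simp: t)
      then show ?thesis using IH[OF bd] by simp
    next
      case False
      define F where "F n = {x. \<forall>k<n. a' k \<le> x \<bullet> e k \<and> x \<bullet> e k < b' k}" for n
      define aa where "aa n k = (if k < n then max (a k) (a' k) else a k)" for n k
      define bb where "bb n k = (if k < n then min (b k) (b' k) else b k)" for n k
      have RF: "?R \<inter> F n = rectangle e (aa n) (bb n)" for n
        by (subst rectangle_restrict[of "aa n" "bb n" a b "\<lambda>j s. j < n \<longrightarrow> a' j \<le> s \<and> s < b' j"])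
          (auto simp: aa_def bb_def F_def)
      have R'F: "?R' \<subseteq> F n" for n by (auto simp: in_rectangle F_def)
      have bdF: "rectangle_bounds e (aa n) (bb n)" for n
        by (rule rectangle_bounds_sub[OF bd])
          (use False R'F[of n] in \<open>auto simp: aa_def bb_def simp flip: RF\<close>)
      have Y: "?R - F n \<in> rectangle_ring e \<and> P ((?R - F n) - ?W)" for n
      proof (induction n)
        case 0
        show ?case using P0 by (simp add: F_def)
      next
        case (Suc n)
        \<comment> \<open>\<open>?L\<close> and \<open>?U\<close> are the parts of
          \<open>?R \<inter> F n\<close> that violate the constraint with index \<open>n\<close>
          from below and from above, that is, what \<open>?R - F (Suc n)\<close> gains over
          \<open>?R - F n\<close>.\<close>
        let ?L = "rectangle e (aa n) ((bb n)(n := min (bb n n) (a' n)))"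
        let ?U = "rectangle e ((aa n)(n := max (aa n n) (b' n))) (bb n)"
        have L: "?L = ?R \<inter> F n \<inter> {x. x \<bullet> e n < a' n}"
          unfolding RF by (subst rectangle_restrict[of _ _ "aa n" "bb n" "\<lambda>j s. j = n \<longrightarrow> s < a' n"]) auto
        have U: "?U = ?R \<inter> F n \<inter> {x. b' n \<le> x \<bullet> e n}"
          unfolding RF by (subst rectangle_restrict[of _ _ "aa n" "bb n" "\<lambda>j s. j = n \<longrightarrow> b' n \<le> s"]) auto
        have FS: "F (Suc n) = F n \<inter> {x. a' n \<le> x \<bullet> e n \<and> x \<bullet> e n < b' n}"
          by (auto simp: F_def less_Suc_eq)
        have dec: "?R - F (Suc n) = (?R - F n) \<union> (?L \<union> ?U)"
          unfolding L U FS by auto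
        have decW: "?R - F (Suc n) - ?W = ((?R - F n) - ?W) \<union> ((?L - ?W) \<union> (?U - ?W))"
          unfolding dec by blast
        have disj: "?L \<inter> ?U = {}" "(?R - F n) \<inter> (?L \<union> ?U) = {}"
          unfolding L U using rectangle_bounds_less[OF bd', of n] by auto
        have L': "?L \<in> rectangle_ring e" "P (?L - ?W)" by - (rule IH'[OF bdF[of n]]; simp)+
        have U': "?U \<in> rectangle_ring e" "P (?U - ?W)" by - (rule IH'[OF bdF[of n]]; simp)+
        have "P ((?L - ?W) \<union> (?U - ?W))"
          using L' U' W disj by (intro PU) auto
        moreover have "(?L - ?W) \<union> (?U - ?W) \<in> rectangle_ring e" using L'(1) U'(1) W by blast
        moreover have "((?R - F n) - ?W) \<inter> ((?L - ?W) \<union> (?U - ?W)) = {}" using disj(2) by blast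
        ultimately have "P (((?R - F n) - ?W) \<union> ((?L - ?W) \<union> (?U - ?W)))"
          using PU[OF rectangle_ring_Diff[OF conjunct1[OF Suc] W] _ _ conjunct2[OF Suc]] by simp
        moreover have "(?R - F n) \<union> (?L \<union> ?U) \<in> rectangle_ring e"

          using conjunct1[OF Suc] L'(1) U'(1) by (intro rectangle_ring_Un)
        ultimately show ?case unfolding dec[symmetric] decW[symmetric] by simp
      qed
      let ?X = "?R - (?R' \<union> ?W)"
      have X: "?X \<in> rectangle_ring e" using bd bd' W by auto
      let ?v = "rectangle_volume (\<lambda>j. max (a j) (a' j)) (\<lambda>j. min (b j) (b' j))"
      have bdI: "rectangle_bounds e (\<lambda>j. max (a j) (a' j)) (\<lambda>j. min (b j) (b' j))"
        by (rule rectangle_bounds_Int[OF bd False])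
      \<comment> \<open>What the approximation misses lies in
        \<open>?R \<inter> F n - ?R \<inter> ?R'\<close>, whose measure is a difference of two
        rectangle volumes.\<close>
      have diff: "?m ?X \<le> ?m ((?R - F n) - ?W) + (rectangle_volume (aa n) (bb n) - ?v)" for n
      proof -
        have RF': "?R \<inter> F n \<in> rectangle_ring e" and RR': "?R \<inter> ?R' \<in> rectangle_ring e"
          using rectangle_in_ring[OF bdF[of n]] rectangle_ring_Int[OF rectangle_in_ring[OF bd] rectangle_in_ring[OF bd']]
          unfolding RF by simp_all
        have sub: "?R \<inter> ?R' \<subseteq> ?R \<inter> F n" using R'F[of n] by blast
        have "?X = ((?R - F n) - ?W) \<union> ((?R \<inter> F n - ?R \<inter> ?R') - ?W)" using R'F[of n] by blast
        moreover have "((?R - F n) - ?W) \<inter> ((?R \<inter> F n - ?R \<inter> ?R') - ?W) = {}" by blast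
        ultimately have "?m ?X = ?m ((?R - F n) - ?W) + ?m ((?R \<inter> F n - ?R \<inter> ?R') - ?W)"
          using ring_measure_Un[OF e rectangle_ring_Diff[OF conjunct1[OF Y[of n]] W]
              rectangle_ring_Diff[OF rectangle_ring_Diff[OF RF' RR'] W]] by simp
        moreover have "?m ((?R \<inter> F n - ?R \<inter> ?R') - ?W) \<le> ?m (?R \<inter> F n - ?R \<inter> ?R')"
          by (intro ring_measure_mono[OF e] rectangle_ring_Diff RF' RR' W) blast
        moreover have "?m (?R \<inter> F n - ?R \<inter> ?R') = ?m (?R \<inter> F n) - ?m (?R \<inter> ?R')"
          by (rule ring_measure_Diff[OF e RF' RR' sub])
        moreover have "?m (?R \<inter> F n) = rectangle_volume (aa n) (bb n)" "?m (?R \<inter> ?R') = ?v"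
          unfolding RF rectangle_Int by (simp_all add: ring_measure_rectangle[OF e] bdF bdI)
        ultimately show ?thesis by linarith
      qed
      have "P ?X"
      proof (rule PL[OF X])
        fix \<epsilon> :: real assume "\<epsilon> > 0"
        have "\<exists>n. ?m ?X - \<epsilon> \<le> ?m ((?R - F n) - ?W)"
        proof (cases "0 < rectangle_volume a b")
          case False
          then have "?m ?R \<le> 0" by (simp add: ring_measure_rectangle[OF e bd])
          moreover have "?m ?X \<le> ?m ?R" by (intro ring_measure_mono[OF e rectangle_in_ring[OF bd] X]) blast
          moreover have "0 \<le> ?m ((?R - F 0) - ?W)"
            by (intro ring_measure_nonneg[OF e] rectangle_ring_Diff conjunct1[OF Y] W)
          ultimately show ?thesis using \<open>\<epsilon> > 0\<close> by (intro exI[of _ 0]) linarith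
        next
          case True
          \<comment> \<open>Only the first \<open>n\<close> sides change, so the volume is that of
            \<open>?R\<close> times a quotient of finite products; the limit of the quotient exists
            because the volume of \<open>?R\<close> is positive.\<close>
          have "rectangle_volume (aa n) (bb n) =
              rectangle_volume a b * ((\<Prod>k<n. min (b k) (b' k) - max (a k) (a' k)) / (\<Prod>k<n. b k - a k))" for n
            by (subst rectangle_volume_finite_change[OF bd bdF, of n])
              (auto simp: aa_def bb_def prod_dividef[symmetric])
          moreover have "(\<lambda>n. rectangle_volume a b * ((\<Prod>k<n. min (b k) (b' k) - max (a k) (a' k)) / (\<Prod>k<n. b k - a k)))
              \<longlonglongrightarrow> rectangle_volume a b * (?v / rectangle_volume a b)"
            using True
            by (intro tendsto_mult tendsto_divide tendsto_const rectangle_volume_tendsto[OF bd]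
                rectangle_volume_tendsto[OF bdI]) auto
          ultimately have "(\<lambda>n. rectangle_volume (aa n) (bb n)) \<longlonglongrightarrow> ?v" using True by simp
          then have "\<forall>\<^sub>F n in sequentially. rectangle_volume (aa n) (bb n) < ?v + \<epsilon>"
            using \<open>\<epsilon> > 0\<close> by (intro order_tendstoD) auto
          then obtain n where "rectangle_volume (aa n) (bb n) < ?v + \<epsilon>"
            unfolding eventually_sequentially by blast
          then show ?thesis using diff[of n] by (intro exI[of _ n]) linarith
        qed
        then obtain n where "?m ?X - \<epsilon> \<le> ?m ((?R - F n) - ?W)" ..
        then show "\<exists>A'\<in>rectangle_ring e. A' \<subseteq> ?X \<and> P A' \<and> ?m ?X - \<epsilon> \<le> ?m A'"
          using conjunct2[OF Y[of n]] R'F[of n] rectangle_ring_Diff[OF conjunct1[OF Y[of n]] W]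
          by (intro bexI[of _ "(?R - F n) - ?W"]) auto
      qed
      moreover have "(\<Union>(a, b)\<in>insert t T. rectangle e a b) = ?R' \<union> ?W" by (simp add: t)
      ultimately show ?thesis by simp
    qed
  qed
  obtain l where l: "rectangle_expansion e A l" using rectangle_expansion_exists[OF A] by blast
  define \<C> where "\<C> = snd ` set l"
  have C: "finite \<C>" "\<And>a b. (a, b) \<in> \<C> \<Longrightarrow> rectangle_bounds e a b"
    using l by (auto simp: \<C>_def rectangle_expansion_def)
  \<comment> \<open>By the expansion, membership in \<open>A\<close> depends only on which of the
    finitely many rectangles contain the point. Hence \<open>A\<close> is a finite disjoint union of
    atoms, each an intersection of rectangles minus a union of rectangles.\<close>
  define pat where "pat x = {(a, b) \<in> \<C>. x \<in> rectangle e a b}" for x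
  have indic: "indicator A x = (\<Sum>(c, a, b)\<leftarrow>l. c * (if (a, b) \<in> pat x then 1 else 0 :: real))" for x
    unfolding expansion_indicator[OF A l]
    by (intro arg_cong[of _ _ sum_list] map_cong[OF refl]) (force simp: pat_def \<C>_def indicator_def)
  have patA: "x \<in> A \<longleftrightarrow> y \<in> A" if "pat x = pat y" for x y
  proof -
    have "indicator A x = (indicator A y :: real)" unfolding indic that by (rule refl)
    then show ?thesis by (auto simp: indicator_def split: if_splits)
  qed
  have pat0: "pat x \<noteq> {}" if "x \<in> A" for x
  proof
    assume "pat x = {}"
    then have "indicator A x = (0::real)"
      using indic[of x] by (simp add: case_prod_beta' sum_list_0)
    then show False using that by simp
  qed
  define atm where "atm S = {x. pat x = S}" for S
  have atm: "atm S \<in> rectangle_ring e \<and> P (atm S)" if S: "S \<subseteq> \<C>" "S \<noteq> {}" "atm S \<noteq> {}" for S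
  proof -
    have eq: "atm S = (\<Inter>(a, b)\<in>S. rectangle e a b) - (\<Union>(a, b)\<in>\<C> - S. rectangle e a b)"
      using S(1) by (auto simp: atm_def pat_def)
    have fin: "finite S" using S(1) C(1) finite_subset by blast
    have "(\<Inter>(a, b)\<in>S. rectangle e a b) \<noteq> {}" using S(3) unfolding eq by blast
    moreover have "rectangle_bounds e a b" if "(a, b) \<in> S" for a b using C(2) S(1) that by blast
    ultimately obtain a b where ab: "rectangle_bounds e a b" "(\<Inter>(a, b)\<in>S. rectangle e a b) = rectangle e a b"
      using rectangle_Inter[OF fin S(2), of e] by metis
    have "(\<Union>(a, b)\<in>\<C> - S. rectangle e a b) \<in> rectangle_ring e"
      using C by (intro rectangle_ring_UN) auto
    moreover have "P (rectangle e a b - (\<Union>(a, b)\<in>\<C> - S. rectangle e a b))"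
      using C ab(1) by (intro atom) auto
    ultimately show ?thesis unfolding eq ab(2) using rectangle_in_ring[OF ab(1)] rectangle_ring_Diff by simp
  qed
  define \<P> where "\<P> = {S. S \<subseteq> \<C> \<and> S \<noteq> {} \<and> atm S \<noteq> {} \<and> atm S \<subseteq> A}"
  have "finite \<P>" using C(1) unfolding \<P>_def by simp
  have "(\<Union>S\<in>\<Q>. atm S) \<in> rectangle_ring e \<and> P (\<Union>S\<in>\<Q>. atm S)" if "finite \<Q>" "\<Q> \<subseteq> \<P>" for \<Q>
    using that
  proof (induction \<Q> rule: finite_induct)
    case empty
    show ?case using P0 by simp
  next
    case (insert S \<Q>)
    have "atm S \<in> rectangle_ring e \<and> P (atm S)" using insert.prems by (intro atm) (auto simp: \<P>_def)
    moreover have "atm S \<inter> (\<Union>S\<in>\<Q>. atm S) = {}" using insert.hyps(2) by (auto simp: atm_def)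
    moreover have "(\<Union>S\<in>\<Q>. atm S) \<in> rectangle_ring e \<and> P (\<Union>S\<in>\<Q>. atm S)"
      using insert.IH insert.prems by simp
    ultimately show ?case
      using PU[of "atm S" "\<Union>S\<in>\<Q>. atm S"] rectangle_ring_Un[of "atm S" e "\<Union>S\<in>\<Q>. atm S"] by simp
  qed
  from this[OF \<open>finite \<P>\<close> order_refl] have "P (\<Union>S\<in>\<P>. atm S)" by simp
  moreover have "(\<Union>S\<in>\<P>. atm S) = A"
  proof
    show "A \<subseteq> (\<Union>S\<in>\<P>. atm S)"
    proof
      fix x assume "x \<in> A"
      have "pat x \<subseteq> \<C>" by (auto simp: pat_def)
      moreover have "x \<in> atm (pat x)" by (simp add: atm_def)
      moreover have "atm (pat x) \<subseteq> A"
      proof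
        fix y assume "y \<in> atm (pat x)"
        then have "pat y = pat x" by (simp add: atm_def)
        from patA[OF this] \<open>x \<in> A\<close> show "y \<in> A" by simp
      qed
      ultimately have "pat x \<in> \<P>" using pat0[OF \<open>x \<in> A\<close>] unfolding \<P>_def by blast
      then show "x \<in> (\<Union>S\<in>\<P>. atm S)" by (auto simp: atm_def)
    qed
  qed (auto simp: \<P>_def)
  ultimately show ?thesis by simp
qed

lemma positive_ring_set_contains_rectangle:
  assumes e: "orthonormal_basis e" and A: "A \<in> rectangle_ring e" and pos: "0 < ring_measure e A"
  obtains a b where "rectangle_bounds e a b" "0 < rectangle_volume a b" "rectangle e a b \<subseteq> A"
proof -
  let ?P = "\<lambda>A. \<exists>a b. rectangle_bounds e a b \<and> 0 < rectangle_volume a b \<and> rectangle e a b \<subseteq> A"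
  have "0 < ring_measure e A \<longrightarrow> ?P A"
    using e A
  proof (induction rule: rectangle_ring_inner_induct)
    case empty
    show ?case by (simp add: ring_measure_empty[OF e])
  next
    case (rectangle a b)
    then show ?case by blast
  next
    case (Un A B)
    then have "0 < ring_measure e (A \<union> B) \<longrightarrow> 0 < ring_measure e A \<or> 0 < ring_measure e B"
      using ring_measure_Un[OF e, of A B] by auto
    moreover have "?P (A \<union> B)" if "?P A \<or> ?P B" using that by blast
    ultimately show ?case using Un.IH by blast
  next
    case (limit A)
    show ?case
    proof
      assume pos: "0 < ring_measure e A"
      from limit(2)[of "ring_measure e A / 2"] pos obtain A' where
        A': "A' \<subseteq> A" "0 < ring_measure e A' \<longrightarrow> ?P A'" "ring_measure e A - ring_measure e A / 2 \<le> ring_measure e A'"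
        by auto
      then have "0 < ring_measure e A'" using pos by linarith
      then show "?P A" using A'(1,2) by blast
    qed
  qed
  then show thesis using pos that by blast
qed

section \<open>Rectangles covered by rectangles of another basis\<close>

text \<open>Compares two opposite corners in the coordinates of \<open>I\<close>, selected by the
  signs of \<open>e i \<bullet> g\<close>. The upper ends are excluded, so the corners use a
  fraction \<open>z < 1\<close> of each side, with \<open>z\<close> arbitrary.\<close>

lemma rectangle_width_sum:
  assumes e: "orthonormal_basis e" and ab: "rectangle_bounds e a b" and "finite I"
    and bd: "\<And>x. x \<in> rectangle e a b \<Longrightarrow> lo \<le> x \<bullet> g \<and> x \<bullet> g \<le> hi"
  shows "(\<Sum>i\<in>I. (b i - a i) * \<bar>e i \<bullet> g\<bar>) \<le> hi - lo"
proof (rule field_le_mult_one_interval)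
  fix z :: real assume z: "0 < z" "z < 1"
  obtain x0 where x0: "x0 \<in> rectangle e a b" using ab by (auto simp: rectangle_bounds_def)
  let ?t = "\<lambda>i. a i + z * (b i - a i)"
  have less: "a i < b i" for i by (rule rectangle_bounds_less[OF ab])
  have t: "a i \<le> ?t i \<and> ?t i < b i" for i
  proof -
    have less_step: "p < q - r \<Longrightarrow> r + p < q" for p q r :: real by simp
    have "z * (b i - a i) < 1 * (b i - a i)" using z less[of i] by (intro mult_strict_right_mono) auto
    then have "?t i < b i" by (intro less_step) simp
    then show ?thesis using z less[of i] by simp
  qed
  let ?c = "\<lambda>i. if 0 \<le> e i \<bullet> g then ?t i else a i" and ?d = "\<lambda>i. if 0 \<le> e i \<bullet> g then a i else ?t i"
  let ?y = "x0 + (\<Sum>i\<in>I. (?c i - x0 \<bullet> e i) *\<^sub>R e i)"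
  let ?y' = "x0 + (\<Sum>i\<in>I. (?d i - x0 \<bullet> e i) *\<^sub>R e i)"
  have y: "?y \<bullet> e i = (if i \<in> I then ?c i else x0 \<bullet> e i)" for i
    by (simp add: inner_add_left inner_sum_orthonormal[OF e \<open>finite I\<close>])
  have y': "?y' \<bullet> e i = (if i \<in> I then ?d i else x0 \<bullet> e i)" for i
    by (simp add: inner_add_left inner_sum_orthonormal[OF e \<open>finite I\<close>])
  have "?y \<in> rectangle e a b" using x0 t less unfolding in_rectangle y by auto
  moreover have "?y' \<in> rectangle e a b" using x0 t less unfolding in_rectangle y' by auto
  ultimately have "?y \<bullet> g - ?y' \<bullet> g \<le> hi - lo" using bd by (smt (verit))
  moreover have "?y \<bullet> g - ?y' \<bullet> g = (\<Sum>i\<in>I. z * ((b i - a i) * \<bar>e i \<bullet> g\<bar>))"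
    unfolding inner_add_left inner_sum_left add_diff_cancel_left sum_subtractf[symmetric]
    by (intro sum.cong) (auto simp: algebra_simps abs_if)
  ultimately show "z * (\<Sum>i\<in>I. (b i - a i) * \<bar>e i \<bullet> g\<bar>) \<le> hi - lo"
    by (simp add: sum_distrib_left)
qed

lemma rectangle_width_suminf:
  assumes e: "orthonormal_basis e" and ab: "rectangle_bounds e a b"
    and bd: "\<And>x. x \<in> rectangle e a b \<Longrightarrow> lo \<le> x \<bullet> g \<and> x \<bullet> g \<le> hi"
  shows "summable (\<lambda>i. (b i - a i) * \<bar>e i \<bullet> g\<bar>)" "(\<Sum>i. (b i - a i) * \<bar>e i \<bullet> g\<bar>) \<le> hi - lo"
proof -
  have nn: "0 \<le> (b i - a i) * \<bar>e i \<bullet> g\<bar>" for i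
    using rectangle_bounds_less[OF ab, of i] by simp
  show sm: "summable (\<lambda>i. (b i - a i) * \<bar>e i \<bullet> g\<bar>)"
    by (rule summableI_nonneg_bounded[OF nn]) (rule rectangle_width_sum[OF e ab _ bd], auto)
  show "(\<Sum>i. (b i - a i) * \<bar>e i \<bullet> g\<bar>) \<le> hi - lo"
    by (rule suminf_le_const[OF sm]) (rule rectangle_width_sum[OF e ab _ bd], auto)
qed

text \<open>Shrinking finitely many coordinates towards \<open>x\<close> keeps the volume positive,
  and by summability the remaining coordinates contribute less than \<open>d / 2\<close> to the
  deviation of \<open>y \<bullet> g\<close>.\<close>

lemma shrink_rectangle_off_slab:
  assumes e: "orthonormal_basis e" and ab: "rectangle_bounds e a b" and vol: "0 < rectangle_volume a b"
    and sm: "summable (\<lambda>i. (b i - a i) * \<bar>e i \<bullet> g\<bar>)"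
    and x: "x \<in> rectangle e a b" and d: "0 < d"
  obtains a' b' where "rectangle_bounds e a' b'" "0 < rectangle_volume a' b'"
    "\<And>j. a j \<le> a' j" "\<And>j. b' j \<le> b j"
    "\<And>y. y \<in> rectangle e a' b' \<Longrightarrow> \<bar>y \<bullet> g - x \<bullet> g\<bar> < d"
proof -
  let ?w = "\<lambda>i. (b i - a i) * \<bar>e i \<bullet> g\<bar>"
  have less: "a i < b i" for i by (rule rectangle_bounds_less[OF ab])
  obtain n where n: "norm (\<Sum>i. ?w (i + n)) < d / 2"
    using suminf_exist_split[OF _ sm, of "d / 2"] d by (meson half_gt_zero order_refl)
  define s where "s = (\<Sum>i<n. \<bar>e i \<bullet> g\<bar>)"
  have S: "0 \<le> s" unfolding s_def by (intro sum_nonneg) auto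
  \<comment> \<open>Makes the first \<open>n\<close> coordinates contribute less than
    \<open>d / 2\<close>; the 1 in the denominator covers \<open>s = 0\<close>.\<close>
  define \<eta> where "\<eta> = d / 2 / (1 + s)"
  have s1: "1 + s \<noteq> 0" using S by simp
  have \<eta>: "0 < \<eta>" using d S by (simp add: \<eta>_def add_pos_nonneg)
  have \<eta>d: "\<eta> * s < d / 2"
  proof -
    have "\<eta> * s < \<eta> * (1 + s)" using \<eta> by simp
    also have "\<dots> = d / 2" unfolding \<eta>_def using s1 by (rule nonzero_eq_divide_eq[THEN iffD1]) (rule refl)
    finally show ?thesis .
  qed
  define a' where "a' i = (if i < n then x \<bullet> e i else a i)" for i
  define b' where "b' i = (if i < n then min (b i) (x \<bullet> e i + \<eta>) else b i)" for i
  have xab: "a i \<le> x \<bullet> e i" "x \<bullet> e i < b i" for i using x by (auto simp: in_rectangle)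
  have x': "x \<in> rectangle e a' b'" using xab \<eta> by (auto simp: in_rectangle a'_def b'_def)
  have le: "a j \<le> a' j" "b' j \<le> b j" for j using xab[of j] by (auto simp: a'_def b'_def)
  have bd': "rectangle_bounds e a' b'" using x' by (intro rectangle_bounds_sub[OF ab le]) auto
  have "0 < (\<Prod>k<n. (b' k - a' k) / (b k - a k))"
    using rectangle_bounds_less[OF bd'] less by (intro prod_pos) auto
  then have "0 < rectangle_volume a' b'"
    using vol by (subst rectangle_volume_finite_change[OF ab bd', of n]) (auto simp: a'_def b'_def)
  moreover have "\<bar>y \<bullet> g - x \<bullet> g\<bar> < d" if y: "y \<in> rectangle e a' b'" for y
  proof -
    let ?f = "\<lambda>i. \<bar>(y - x) \<bullet> e i\<bar> * \<bar>e i \<bullet> g\<bar>"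
    have f: "?f i \<le> \<eta> * \<bar>e i \<bullet> g\<bar>" if "i < n" for i
      using y that unfolding in_rectangle a'_def b'_def
      by (intro mult_right_mono) (auto simp: inner_diff_left dest!: spec[of _ i])
    have f': "?f i \<le> ?w i" for i
      using y le[of i] xab[of i] unfolding in_rectangle
      by (intro mult_right_mono) (auto simp: inner_diff_left dest!: spec[of _ i])
    have smf: "summable ?f"
      by (rule summable_comparison_test'[OF sm, of 0]) (use f' in auto)
    have "(\<lambda>i. ((y - x) \<bullet> e i) * (e i \<bullet> g)) sums ((y - x) \<bullet> g)"
      using parseval[OF e, of "y - x" g] by (simp add: inner_commute)
    then have eq: "(y - x) \<bullet> g = (\<Sum>i. ((y - x) \<bullet> e i) * (e i \<bullet> g))" by (simp add: sums_iff)
    have "\<bar>(y - x) \<bullet> g\<bar> \<le> (\<Sum>i. ?f i)"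
      unfolding eq using summable_rabs[of "\<lambda>i. ((y - x) \<bullet> e i) * (e i \<bullet> g)"] smf by (simp add: abs_mult)
    also have "\<dots> = (\<Sum>i. ?f (i + n)) + (\<Sum>i<n. ?f i)" by (rule suminf_split_initial_segment[OF smf])
    also have "\<dots> \<le> (\<Sum>i. ?w (i + n)) + \<eta> * (\<Sum>i<n. \<bar>e i \<bullet> g\<bar>)"
      unfolding sum_distrib_left using f f' summable_ignore_initial_segment[OF smf, of n]
        summable_ignore_initial_segment[OF sm, of n]
      by (intro add_mono suminf_le sum_mono) auto
    also have "\<dots> < d"
    proof -
      have "(\<Sum>i. ?w (i + n)) < d / 2" using n unfolding real_norm_def by (rule order_le_less_trans[OF abs_ge_self])
      from add_strict_mono[OF this \<eta>d] show ?thesis by (simp add: s_def)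
    qed
    finally show ?thesis by (simp add: inner_diff_left)
  qed
  ultimately show thesis using that bd' le by blast
qed

text \<open>The closed box is what the induction can reach: a point that merely misses a half-open
  box may lie on its boundary, whereas a violated closed constraint leaves a positive distance, and
  a smaller rectangle around the point avoids that member of the cover.\<close>

lemma rectangle_in_closed_box:
  fixes e f :: "nat \<Rightarrow> 'a::{real_inner, complete_space}"
  assumes e: "orthonormal_basis e" and "finite \<C>"
    and "\<And>\<alpha> \<beta>. (\<alpha>, \<beta>) \<in> \<C> \<Longrightarrow> rectangle_bounds f \<alpha> \<beta>"
    and "rectangle_bounds e a b" "0 < rectangle_volume a b"
    and "rectangle e a b \<subseteq> (\<Union>(\<alpha>, \<beta>)\<in>\<C>. rectangle f \<alpha> \<beta>)"
  shows "\<exists>a' b' \<alpha> \<beta>. rectangle_bounds e a' b' \<and> 0 < rectangle_volume a' b' \<and> rectangle_bounds f \<alpha> \<beta> \<and>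
    (\<forall>x\<in>rectangle e a' b'. \<forall>j. \<alpha> j \<le> x \<bullet> f j \<and> x \<bullet> f j \<le> \<beta> j)"
  using assms(2-)
proof (induction \<C> arbitrary: a b rule: finite_induct)
  case empty
  then show ?case by (auto simp: rectangle_bounds_def)
next
  case (insert p \<C>)
  obtain \<alpha> \<beta> where p: "p = (\<alpha>, \<beta>)" by (cases p)
  have bdp: "rectangle_bounds f \<alpha> \<beta>" using insert.prems(1) p by auto
  show ?case
  proof (cases "\<forall>x\<in>rectangle e a b. \<forall>j. \<alpha> j \<le> x \<bullet> f j \<and> x \<bullet> f j \<le> \<beta> j")
    case True
    then show ?thesis using insert.prems bdp by blast
  next
    case False
    then obtain x j where x: "x \<in> rectangle e a b" and xj: "x \<bullet> f j < \<alpha> j \<or> \<beta> j < x \<bullet> f j"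
      by (metis not_le)
    define d where "d = max (\<alpha> j - x \<bullet> f j) (x \<bullet> f j - \<beta> j)"
    have "0 < d" using xj by (auto simp: d_def)
    \<comment> \<open>The finite cover bounds \<open>y \<bullet> f j\<close> on the rectangle, and
      boundedness of a functional on a rectangle makes the weighted widths summable, as the
      shrinking requires.\<close>
    let ?lo = "Min ((\<lambda>q. fst q j) ` insert p \<C>)" and ?hi = "Max ((\<lambda>q. snd q j) ` insert p \<C>)"
    have "?lo \<le> y \<bullet> f j \<and> y \<bullet> f j \<le> ?hi" if y: "y \<in> rectangle e a b" for y
    proof -
      obtain q where q: "q \<in> insert p \<C>" "y \<in> rectangle f (fst q) (snd q)"
        using subsetD[OF insert.prems(4) y] unfolding case_prod_beta by blast
      have "?lo \<le> fst q j" "snd q j \<le> ?hi"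
        by (intro Min_le Max_ge finite_imageI finite.insertI insert.hyps(1) imageI[OF q(1), of "\<lambda>q. fst q j"]
            imageI[OF q(1), of "\<lambda>q. snd q j"])+
      moreover have "fst q j \<le> y \<bullet> f j" "y \<bullet> f j \<le> snd q j" using q(2) by (auto simp: in_rectangle less_imp_le)
      ultimately show ?thesis by (blast intro: order_trans)
    qed
    then have sm: "summable (\<lambda>i. (b i - a i) * \<bar>e i \<bullet> f j\<bar>)"
      by (rule rectangle_width_suminf(1)[OF e insert.prems(2)])
    obtain a' b' where 1: "rectangle_bounds e a' b'" "0 < rectangle_volume a' b'"
      "\<And>j. a j \<le> a' j" "\<And>j. b' j \<le> b j"
      "\<And>y. y \<in> rectangle e a' b' \<Longrightarrow> \<bar>y \<bullet> f j - x \<bullet> f j\<bar> < d"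
      using shrink_rectangle_off_slab[OF e insert.prems(2,3) sm x \<open>0 < d\<close>] by metis
    have "rectangle e a' b' \<inter> rectangle f \<alpha> \<beta> = {}"
    proof (intro equals0I)
      fix y assume "y \<in> rectangle e a' b' \<inter> rectangle f \<alpha> \<beta>"
      then have "\<bar>y \<bullet> f j - x \<bullet> f j\<bar> < d" "\<alpha> j \<le> y \<bullet> f j" "y \<bullet> f j < \<beta> j"
        using 1(5) by (auto simp: in_rectangle)
      moreover from xj have "d = \<alpha> j - x \<bullet> f j \<or> d = x \<bullet> f j - \<beta> j" by (auto simp: d_def max_def)
      ultimately show False using xj by (auto simp: abs_if split: if_splits)
    qed
    moreover have "rectangle e a' b' \<subseteq> rectangle e a b"
      using 1(3,4) unfolding subset_iff in_rectangle by (blast intro: order_trans order_less_le_trans)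
    ultimately have "rectangle e a' b' \<subseteq> (\<Union>(\<alpha>, \<beta>)\<in>\<C>. rectangle f \<alpha> \<beta>)"
      using insert.prems(4) unfolding p UN_insert case_prod_conv by blast
    then show ?thesis using insert.IH 1(1,2) insert.prems(1) by blast
  qed
qed

text \<open>Additive form of the product condition: for factors at least 1, the product is finite
  exactly when all factors are finite and their excesses over 1 are summable.\<close>

definition finite_distortion :: "(nat \<Rightarrow> 'a::real_inner) \<Rightarrow> (nat \<Rightarrow> 'a) \<Rightarrow> bool" where
  "finite_distortion e f \<longleftrightarrow>
     (\<forall>j. summable (\<lambda>i. \<bar>e i \<bullet> f j\<bar>)) \<and> summable (\<lambda>j. (\<Sum>i. \<bar>e i \<bullet> f j\<bar>) - 1)"

lemma basis_inner_le_1: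
  assumes e: "orthonormal_basis e" and f: "orthonormal_basis f"
  shows "\<bar>e i \<bullet> f j\<bar> \<le> 1"
  using Cauchy_Schwarz_ineq2[of "e i" "f j"] ortho_inner[OF e, of i i] ortho_inner[OF f, of j j]
  by (simp add: norm_eq_sqrt_inner)

lemma basis_parseval:
  assumes e: "orthonormal_basis e" and f: "orthonormal_basis f"
  shows "(\<lambda>i. (e i \<bullet> f j)\<^sup>2) sums 1" "(\<lambda>j. (e i \<bullet> f j)\<^sup>2) sums 1"
  using parseval_norm[OF e, of "f j"] parseval_norm[OF f, of "e i"] ortho_inner[OF e, of i i] ortho_inner[OF f, of j j]
  by (simp_all add: power2_norm_eq_inner inner_commute)

lemma square_le_abs: "\<bar>u\<bar> \<le> 1 \<Longrightarrow> u\<^sup>2 \<le> \<bar>u\<bar>" for u :: real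
  using mult_left_le[of "\<bar>u\<bar>" "\<bar>u\<bar>"] by (simp add: power2_eq_square)

lemma basis_sum_ge_1:
  assumes e: "orthonormal_basis e" and f: "orthonormal_basis f" and sm: "summable (\<lambda>i. \<bar>e i \<bullet> f j\<bar>)"
  shows "1 \<le> (\<Sum>i. \<bar>e i \<bullet> f j\<bar>)"
proof -
  have "1 = (\<Sum>i. (e i \<bullet> f j)\<^sup>2)" using basis_parseval(1)[OF e f, of j] by (simp add: sums_iff)
  also have "\<dots> \<le> (\<Sum>i. \<bar>e i \<bullet> f j\<bar>)"
    using basis_parseval(1)[OF e f, of j] sm
    by (intro suminf_le square_le_abs basis_inner_le_1[OF e f]) (auto simp: sums_iff)
  finally show ?thesis .
qed

text \<open>Turns summable logarithms into summable deviations of side lengths from 1; above 1 this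
  requires an upper bound \<open>B\<close> on the lengths.\<close>

lemma abs_minus_1_le_ln:
  fixes x :: real assumes x: "0 < x" "x \<le> B" and B: "1 \<le> B" shows "\<bar>x - 1\<bar> \<le> B * \<bar>ln x\<bar>"
proof (cases "1 \<le> x")
  case True
  have "1 - 1 / x \<le> ln x" using ln_one_minus_pos_upper_bound ln_le_minus_one[of "1 / x"] x by (simp add: ln_div)
  then have "x * (1 - 1 / x) \<le> x * ln x" using x by (intro mult_left_mono) auto
  then have "x - 1 \<le> x * ln x" using x by (simp add: algebra_simps)
  also have "\<dots> \<le> B * ln x" using True x by (intro mult_right_mono) auto
  finally show ?thesis using True by simp
next
  case False
  then have "\<bar>x - 1\<bar> \<le> 1 * \<bar>ln x\<bar>" using ln_le_minus_one[OF x(1)] by simp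
  also have "\<dots> \<le> B * \<bar>ln x\<bar>" using B by (intro mult_right_mono) auto
  finally show ?thesis .
qed

text \<open>
  With \<open>l i = b i - a i\<close> and \<open>c \<le> l i\<close>, the inequality \<open>(e i \<bullet> f j)\<^sup>2 \<le> \<bar>e i \<bullet> f j\<bar>\<close> gives
  \<open>c * (\<Sum>i. \<bar>e i \<bullet> f j\<bar> - (e i \<bullet> f j)\<^sup>2) \<le> \<Sum>i. l i * (\<bar>e i \<bullet> f j\<bar> - (e i \<bullet> f j)\<^sup>2)\<close>,
  and the squares sum to 1 along rows and columns.
\<close>

lemma finite_distortion_if_box:
  fixes e f :: "nat \<Rightarrow> 'a::{real_inner, complete_space}"
  assumes e: "orthonormal_basis e" and f: "orthonormal_basis f"
    and ab: "rectangle_bounds e a b" and vol: "0 < rectangle_volume a b" and \<alpha>\<beta>: "rectangle_bounds f \<alpha> \<beta>"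
    and sub: "\<forall>x\<in>rectangle e a b. \<forall>j. \<alpha> j \<le> x \<bullet> f j \<and> x \<bullet> f j \<le> \<beta> j"
  shows "finite_distortion e f"
proof -
  let ?u = "\<lambda>i j. e i \<bullet> f j"
  define l where "l i = b i - a i" for i
  have lpos: "0 < l i" for i using rectangle_bounds_less[OF ab, of i] by (simp add: l_def)
  have sml: "summable (\<lambda>i. \<bar>ln (l i)\<bar>)"
    using ab vol unfolding l_def rectangle_volume_pos_iff
    by (intro summable_ln_pos_cases) (auto simp: rectangle_bounds_def)
  define T where "T = (\<Sum>i. \<bar>ln (l i)\<bar>)"
  have T: "\<bar>ln (l i)\<bar> \<le> T" for i
    unfolding T_def using sum_le_suminf[OF sml, of "{i}"] by simp
  define c where "c = exp (- T)"
  have cpos: "0 < c" by (simp add: c_def)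
  have cl: "c \<le> l i" and lB: "l i \<le> exp T" for i
  proof -
    have "exp (- T) \<le> exp (ln (l i))" "exp (ln (l i)) \<le> exp T" using T[of i] by (auto simp: abs_le_iff)
    then show "c \<le> l i" "l i \<le> exp T" using lpos[of i] by (simp_all add: c_def)
  qed
  have T0: "0 \<le> T" using T[of 0] by simp
  have sm\<eta>: "summable (\<lambda>i. \<bar>l i - 1\<bar>)"
  proof (rule summable_comparison_test')
    show "summable (\<lambda>i. exp T * \<bar>ln (l i)\<bar>)" by (rule summable_mult[OF sml])
    show "norm \<bar>l i - 1\<bar> \<le> exp T * \<bar>ln (l i)\<bar>" for i
      using abs_minus_1_le_ln[OF lpos lB] T0 by simp
  qed
  have w: "summable (\<lambda>i. l i * \<bar>?u i j\<bar>)" "(\<Sum>i. l i * \<bar>?u i j\<bar>) \<le> \<beta> j - \<alpha> j" for j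
    using rectangle_width_suminf[OF e ab, of "\<alpha> j" "f j" "\<beta> j"] sub unfolding l_def by simp_all
  have smu: "summable (\<lambda>i. \<bar>?u i j\<bar>)" for j
  proof (rule summable_comparison_test')
    show "summable (\<lambda>i. (1 / c) * (l i * \<bar>?u i j\<bar>))" by (rule summable_mult[OF w(1)])
    show "norm \<bar>?u i j\<bar> \<le> (1 / c) * (l i * \<bar>?u i j\<bar>)" for i
      using mult_right_mono[OF cl[of i], of "\<bar>?u i j\<bar>"] cpos by (simp add: field_simps)
  qed
  have sq: "summable (\<lambda>i. (?u i j)\<^sup>2)" "(\<Sum>i. (?u i j)\<^sup>2) = 1" for j
    using basis_parseval(1)[OF e f, of j] by (auto simp: sums_iff)
  have sm\<eta>u: "summable (\<lambda>i. \<bar>l i - 1\<bar> * (?u i j)\<^sup>2)" for j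
  proof (rule summable_comparison_test'[OF sm\<eta>])
    show "norm (\<bar>l i - 1\<bar> * (?u i j)\<^sup>2) \<le> \<bar>l i - 1\<bar>" for i
      using square_le_abs[OF basis_inner_le_1[OF e f], of i j] basis_inner_le_1[OF e f, of i j]
      by (simp add: mult_left_le)
  qed
  \<comment> \<open>Error of replacing \<open>l i\<close> by 1 in front of the squares. By Bessel
    the squares in a row sum to at most 1, so the total over \<open>j\<close> is at most
    \<open>\<Sum>i. \<bar>l i - 1\<bar>\<close>.\<close>
  define r where "r j = (\<Sum>i. \<bar>l i - 1\<bar> * (?u i j)\<^sup>2)" for j
  have key: "c * ((\<Sum>i. \<bar>?u i j\<bar>) - 1) \<le> (\<beta> j - \<alpha> j) - 1 + r j" for j
  proof -
    have "c * ((\<Sum>i. \<bar>?u i j\<bar>) - 1) = (\<Sum>i. c * (\<bar>?u i j\<bar> - (?u i j)\<^sup>2))"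
      using suminf_mult[OF summable_diff[OF smu[of j] sq(1)[of j]], of c] suminf_diff[OF smu[of j] sq(1)[of j]] sq(2)[of j] by simp
    also have "\<dots> \<le> (\<Sum>i. l i * \<bar>?u i j\<bar> - (?u i j)\<^sup>2 + \<bar>l i - 1\<bar> * (?u i j)\<^sup>2)"
    proof (rule suminf_le)
      fix i
      have "c * (\<bar>?u i j\<bar> - (?u i j)\<^sup>2) \<le> l i * (\<bar>?u i j\<bar> - (?u i j)\<^sup>2)"
        using square_le_abs[OF basis_inner_le_1[OF e f]] by (intro mult_right_mono cl) auto
      moreover have "(1 - \<bar>l i - 1\<bar>) * (?u i j)\<^sup>2 \<le> l i * (?u i j)\<^sup>2"
        by (intro mult_right_mono) auto
      ultimately show "c * (\<bar>?u i j\<bar> - (?u i j)\<^sup>2) \<le> l i * \<bar>?u i j\<bar> - (?u i j)\<^sup>2 + \<bar>l i - 1\<bar> * (?u i j)\<^sup>2"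
        by (simp add: algebra_simps)
    qed (intro summable_mult summable_diff summable_add smu sq w sm\<eta>u)+
    also have "\<dots> = (\<Sum>i. l i * \<bar>?u i j\<bar>) - 1 + r j"
      using suminf_add[OF summable_diff[OF w(1)[of j] sq(1)[of j]] sm\<eta>u[of j]] suminf_diff[OF w(1)[of j] sq(1)[of j]] sq(2)[of j] by (simp add: r_def)
    also have "\<dots> \<le> (\<beta> j - \<alpha> j) - 1 + r j" using w(2)[of j] by simp
    finally show ?thesis .
  qed
  have r0: "0 \<le> r j" for j unfolding r_def by (intro suminf_nonneg sm\<eta>u) auto
  have smr: "summable r"
  proof (rule summableI_nonneg_bounded[OF r0])
    fix n
    have "(\<Sum>j<n. r j) = (\<Sum>i. \<Sum>j<n. \<bar>l i - 1\<bar> * (?u i j)\<^sup>2)"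
      unfolding r_def by (rule suminf_sum[symmetric]) (rule sm\<eta>u)
    also have "\<dots> \<le> (\<Sum>i. \<bar>l i - 1\<bar>)"
    proof (rule suminf_le)
      fix i
      have "(\<Sum>j<n. (?u i j)\<^sup>2) \<le> 1"
        using bessel[OF f, of "{..<n}" "e i"] ortho_inner[OF e, of i i] by (simp add: power2_norm_eq_inner)
      then show "(\<Sum>j<n. \<bar>l i - 1\<bar> * (?u i j)\<^sup>2) \<le> \<bar>l i - 1\<bar>"
        unfolding sum_distrib_left[symmetric] by (simp add: mult_left_le)
    qed (intro summable_sum sm\<eta>u sm\<eta>)+
    finally show "(\<Sum>j<n. r j) \<le> (\<Sum>i. \<bar>l i - 1\<bar>)" .
  qed
  obtain A where A: "\<And>j. \<bar>\<alpha> j\<bar> \<le> A" using \<alpha>\<beta> by (auto simp: rectangle_bounds_def bounded_iff)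
  obtain B where B: "\<And>j. \<bar>\<beta> j\<bar> \<le> B" using \<alpha>\<beta> by (auto simp: rectangle_bounds_def bounded_iff)
  let ?M = "A + B + 1"
  have smL: "summable (\<lambda>j. ?M * max 0 (ln (\<beta> j - \<alpha> j)))"
    using \<alpha>\<beta> by (intro summable_mult) (simp add: rectangle_bounds_def)
  \<comment> \<open>The \<open>f\<close>-rectangle may have volume 0, so only positive parts of
    logarithms are summable. They suffice: sides shorter than 1 make the left-hand side negative,
    and longer ones are at most \<open>?M\<close>.\<close>
  have L: "(\<beta> j - \<alpha> j) - 1 \<le> ?M * max 0 (ln (\<beta> j - \<alpha> j))" for j
  proof (cases "1 \<le> \<beta> j - \<alpha> j")
    case True
    have "\<bar>(\<beta> j - \<alpha> j) - 1\<bar> \<le> ?M * \<bar>ln (\<beta> j - \<alpha> j)\<bar>"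
      using A[of j] B[of j] True by (intro abs_minus_1_le_ln) auto
    then show ?thesis using True by simp
  next
    case False
    have "0 \<le> ?M" using A[of j] B[of j] by linarith
    then have "0 \<le> ?M * max 0 (ln (\<beta> j - \<alpha> j))" by (intro mult_nonneg_nonneg) auto
    then show ?thesis using False by linarith
  qed
  have "summable (\<lambda>j. (\<Sum>i. \<bar>?u i j\<bar>) - 1)"
  proof (rule summable_comparison_test')
    show "summable (\<lambda>j. (1 / c) * (?M * max 0 (ln (\<beta> j - \<alpha> j)) + r j))"
      by (intro summable_mult summable_add smL smr)
    show "norm ((\<Sum>i. \<bar>?u i j\<bar>) - 1) \<le> (1 / c) * (?M * max 0 (ln (\<beta> j - \<alpha> j)) + r j)" for j
    proof -
      have "c * ((\<Sum>i. \<bar>?u i j\<bar>) - 1) \<le> ?M * max 0 (ln (\<beta> j - \<alpha> j)) + r j"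
        using key[of j] L[of j] by linarith
      then show ?thesis using basis_sum_ge_1[OF e f smu, of j] cpos by (simp add: field_simps)
    qed
  qed
  with smu show ?thesis by (simp add: finite_distortion_def)
qed

lemma completed_positive_distortion:
  fixes e f :: "nat \<Rightarrow> 'a::{real_inner, complete_space}"
  assumes e: "orthonormal_basis e" and f: "orthonormal_basis f"
    and A: "A \<in> completed_ring e" "A \<in> completed_ring f" and pos: "completed_measure e A \<noteq> 0"
  shows "finite_distortion e f"
proof -
  let ?S = "{ring_measure e A2 | A2. A2 \<in> rectangle_ring e \<and> A \<subseteq> A2}"
  have "bdd_below ?S" using ring_measure_nonneg[OF e] by (intro bdd_belowI[of _ 0]) auto
  then have low: "completed_measure e A \<le> ring_measure e A2" if "A2 \<in> rectangle_ring e" "A \<subseteq> A2" for A2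
    unfolding completed_measure_def using that by (intro cInf_lower) auto
  have "?S \<noteq> {}" using A(1) by (auto simp: completed_ring_def dest!: spec[of _ 1])
  then have "0 \<le> completed_measure e A"
    unfolding completed_measure_def using ring_measure_nonneg[OF e] by (intro cInf_greatest) auto
  with pos have "0 < completed_measure e A" by simp
  with A(1) obtain A1 A2 where A12: "A1 \<in> rectangle_ring e" "A2 \<in> rectangle_ring e" "A1 \<subseteq> A" "A \<subseteq> A2"
    "ring_measure e (A2 - A1) < completed_measure e A"
    by (auto simp: completed_ring_def)
  \<comment> \<open>The gap \<open>A2 - A1\<close> has smaller measure than \<open>A\<close>, whose
    measure is at most that of \<open>A2\<close>.\<close>
  then have "0 < ring_measure e A1"
    using low[OF A12(2,4)] ring_measure_Diff[OF e A12(2,1)] by simp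
  then obtain a b where ab: "rectangle_bounds e a b" "0 < rectangle_volume a b" "rectangle e a b \<subseteq> A1"
    by (rule positive_ring_set_contains_rectangle[OF e A12(1)])
  from A(2) obtain B2 where B2: "B2 \<in> rectangle_ring f" "A \<subseteq> B2"
    by (auto simp: completed_ring_def dest!: spec[of _ 1])
  obtain \<C> where C: "finite \<C>" "\<C> \<subseteq> {(a, b). rectangle_bounds f a b}" "B2 \<subseteq> (\<Union>(a, b)\<in>\<C>. rectangle f a b)"
    by (rule rectangle_ring_covered[OF B2(1)])
  have "rectangle e a b \<subseteq> (\<Union>(a, b)\<in>\<C>. rectangle f a b)"
    using ab(3) A12(3) B2(2) C(3) by blast
  moreover have "rectangle_bounds f \<alpha> \<beta>" if "(\<alpha>, \<beta>) \<in> \<C>" for \<alpha> \<beta> using C(2) that by blast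
  ultimately obtain a' b' \<alpha> \<beta> where "rectangle_bounds e a' b'" "0 < rectangle_volume a' b'" "rectangle_bounds f \<alpha> \<beta>"
    "\<forall>x\<in>rectangle e a' b'. \<forall>j. \<alpha> j \<le> x \<bullet> f j \<and> x \<bullet> f j \<le> \<beta> j"
    using rectangle_in_closed_box[OF e C(1) _ ab(1,2)] by blast
  then show ?thesis by (rule finite_distortion_if_box[OF e f])
qed

section \<open>Matching the two bases\<close>

abbreviation off_diagonal :: "(nat \<Rightarrow> 'a::real_inner) \<Rightarrow> (nat \<Rightarrow> 'a) \<Rightarrow> nat \<Rightarrow> nat \<Rightarrow> real" where
  "off_diagonal e f i j \<equiv> (if i = j then 0 else \<bar>e i \<bullet> f j\<bar>)"

text \<open>Each column \<open>j\<close> has a dominant entry in some row \<open>g j\<close>, and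
  the rest of the column is summable over \<open>j\<close>. From some \<open>N\<close> on,
  \<open>g\<close> is injective, and counting squares shows that it misses exactly \<open>N\<close>
  rows; any bijection of \<open>{..<N}\<close> with these rows settles the first \<open>N\<close>
  columns.\<close>

lemma finite_distortion_matching:
  fixes e f :: "nat \<Rightarrow> 'a::{real_inner, complete_space}"
  assumes e: "orthonormal_basis e" and f: "orthonormal_basis f" and fd: "finite_distortion e f"
  obtains \<sigma> T where "bij \<sigma>" "\<And>m. (\<Sum>i<m. \<Sum>j<m. off_diagonal (e \<circ> \<sigma>) f i j) \<le> T"
proof -
  define u where "u i j = \<bar>e i \<bullet> f j\<bar>" for i j
  have u0: "0 \<le> u i j" and u1: "u i j \<le> 1" for i j
    using basis_inner_le_1[OF e f] by (simp_all add: u_def)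
  have usq: "(u i j)\<^sup>2 \<le> u i j" for i j using square_le_abs[of "u i j"] u0 u1 by simp
  have u2: "(\<lambda>i. (u i j)\<^sup>2) sums 1" and u2': "(\<lambda>j. (u i j)\<^sup>2) sums 1" for i j
    using basis_parseval[OF e f] by (simp_all add: u_def)
  have besR: "(\<Sum>j\<in>J. (u i j)\<^sup>2) \<le> 1" if "finite J" for i J
    using sum_le_suminf[OF sums_summable[OF u2'] that] u2' by (simp add: sums_iff)
  have besC: "(\<Sum>i\<in>I. (u i j)\<^sup>2) \<le> 1" if "finite I" for j I
    using sum_le_suminf[OF sums_summable[OF u2] that] u2 by (simp add: sums_iff)
  have smu: "summable (\<lambda>i. u i j)" for j using fd by (simp add: finite_distortion_def u_def)
  define s where "s j = (\<Sum>i. u i j)" for j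
  have sms: "summable (\<lambda>j. s j - 1)" using fd by (simp add: finite_distortion_def s_def u_def)
  have s1: "1 \<le> s j" for j
    using basis_sum_ge_1[OF e f] smu[of j] unfolding s_def u_def by simp
  have sumu: "(\<Sum>i\<in>I. u i j) \<le> s j" if "finite I" for I j
    unfolding s_def by (rule sum_le_suminf[OF smu that]) (rule u0)
  \<comment> \<open>The mean of the entries \<open>u i j\<close> with weights
    \<open>u i j / s j\<close> is \<open>1 / s j\<close>, because the squares sum to 1. So some
    entry is at least that large.\<close>
  have "\<exists>i. 1 \<le> u i j * s j" for j
  proof (rule ccontr)
    assume "\<not> (\<exists>i. 1 \<le> u i j * s j)"
    then have lt: "u i j * s j < 1" for i by (simp add: not_le)
    let ?d = "\<lambda>i. u i j - (u i j)\<^sup>2 * s j"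
    have d0: "0 \<le> ?d i" for i
      using mult_left_mono[OF less_imp_le[OF lt[of i]] u0[of i j]] by (simp add: power2_eq_square mult.assoc)
    have sd: "?d sums (s j - 1 * s j)"
      using summable_sums[OF smu[of j]] unfolding s_def by (intro sums_diff sums_mult2 u2)
    then have "\<forall>i. ?d i = 0"
      using suminf_eq_zero_iff[OF sums_summable[OF sd] d0] by (simp add: sums_iff)
    then have "u i j * (1 - u i j * s j) = 0" for i by (simp add: power2_eq_square algebra_simps)
    then have "u i j = 0" for i using lt[of i] by (metis mult_eq_0_iff right_minus_eq less_irrefl)
    then show False using u2[of j] by (simp add: sums_iff)
  qed
  then obtain g where g: "\<And>j. 1 \<le> u (g j) j * s j" by metis
  define off where "off j = s j - u (g j) j" for j
  have offS: "(\<Sum>i\<in>I. u i j) \<le> off j" if "finite I" "g j \<notin> I" for I j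
    using sumu[of "insert (g j) I" j] that by (simp add: off_def)
  have off0: "0 \<le> off j" for j using offS[of "{}" j] by simp
  have offle: "off j \<le> 2 * (s j - 1)" for j
  proof -
    have sp: "0 < s j" using s1[of j] by linarith
    have "(2 - s j) * s j \<le> 1"
      using zero_le_power2[of "s j - 1"] by (simp add: power2_eq_square algebra_simps)
    also have "\<dots> \<le> u (g j) j * s j" by (rule g)
    finally have "2 - s j \<le> u (g j) j" using sp by simp
    then show ?thesis by (simp add: off_def)
  qed
  have smoff: "summable off"
    by (rule summable_comparison_test'[OF summable_mult[OF sms, of 2], of 0]) (use off0 offle in auto)
  have diag: "1 - (u (g j) j)\<^sup>2 \<le> off j" for j
  proof -
    have "(\<lambda>i. u i j - (u i j)\<^sup>2) sums (s j - 1)"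
      using summable_sums[OF smu[of j]] unfolding s_def by (intro sums_diff u2)
    then have "(\<Sum>i\<in>{g j}. u i j - (u i j)\<^sup>2) \<le> s j - 1"
      using sum_le_suminf[of "\<lambda>i. u i j - (u i j)\<^sup>2" "{g j}"] usq by (simp add: sums_iff)
    then show ?thesis by (simp add: off_def)
  qed
  obtain N where N: "norm (\<Sum>k. off (k + N)) < 1 / 2"
    using suminf_exist_split[OF _ smoff, of "1 / 2"] by auto
  have smN: "summable (\<lambda>k. off (k + N))" by (rule summable_ignore_initial_segment[OF smoff])
  have N': "(\<Sum>k. off (k + N)) < 1 / 2" using N by (simp add: abs_less_iff)
  have offK: "(\<Sum>k\<in>K. off k) < 1 / 2" if "finite K" "K \<subseteq> {N..}" for K
  proof -
    have "(\<Sum>k\<in>K. off k) + (\<Sum>k<N. off k) = (\<Sum>k\<in>K \<union> {..<N}. off k)"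
      using that by (intro sum.union_disjoint[symmetric]) auto
    also have "\<dots> \<le> suminf off" using that by (intro sum_le_suminf smoff off0) auto
    also have "\<dots> = (\<Sum>k. off (k + N)) + (\<Sum>k<N. off k)" by (rule suminf_split_initial_segment[OF smoff])
    finally show ?thesis using N' by linarith
  qed
  have half: "off j < 1 / 2" if "N \<le> j" for j using offK[of "{j}"] that by simp
  \<comment> \<open>A row that dominates two such columns would contain two squares above 1/2,
    contradicting Bessel.\<close>
  have injg: "inj_on g {N..}"
  proof (rule inj_onI, rule ccontr)
    fix j k assume jk: "j \<in> {N..}" "k \<in> {N..}" "g j = g k" "j \<noteq> k"
    have "(u (g j) j)\<^sup>2 + (u (g j) k)\<^sup>2 \<le> 1" using besR[of "{j, k}" "g j"] jk(4) by simp
    then show False using diag[of j] diag[of k] half[of j] half[of k] jk(1-3) by simp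
  qed
  define C where "C = - g ` {N..}"
  \<comment> \<open>The squares in the rows of \<open>F\<close> sum to \<open>card F\<close>.
    Counted by columns, the first \<open>N\<close> contribute at most 1 each and the others less
    than 1/2 altogether, because their dominant rows lie outside \<open>F\<close>.\<close>
  have cardF: "card F \<le> N" if "finite F" "F \<subseteq> C" for F
  proof -
    let ?h = "\<lambda>j. \<Sum>i\<in>F. (u i j)\<^sup>2"
    have h: "?h sums (\<Sum>i\<in>F. 1)" by (intro sums_sum u2')
    have "real (card F) = suminf ?h" using h by (simp add: sums_iff)
    also have "\<dots> = (\<Sum>k. ?h (k + N)) + (\<Sum>k<N. ?h k)"
      by (rule suminf_split_initial_segment[OF sums_summable[OF h]])
    also have "\<dots> \<le> (\<Sum>k. off (k + N)) + (\<Sum>k<N. 1)"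
    proof (intro add_mono suminf_le sum_mono besC that(1) smN summable_ignore_initial_segment[OF sums_summable[OF h]])
      fix k
      have "g (k + N) \<notin> F" using that(2) by (auto simp: C_def)
      then have "(\<Sum>i\<in>F. u i (k + N)) \<le> off (k + N)" by (rule offS[OF that(1)])
      moreover have "?h (k + N) \<le> (\<Sum>i\<in>F. u i (k + N))" by (intro sum_mono usq)
      ultimately show "?h (k + N) \<le> off (k + N)" by linarith
    qed
    finally have "real (card F) < real N + 1" using N' by simp
    then show ?thesis by linarith
  qed
  have finC: "finite C"
    by (rule ccontr) (metis cardF infinite_arbitrarily_large not_less_eq_eq order_refl)
  \<comment> \<open>The transposed count: the squares in the first \<open>N\<close> columns sum to
    \<open>N\<close>. Rows in \<open>C\<close> contribute at most 1 each, and a row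
    \<open>g k\<close> has at most \<open>off k\<close> left beside its dominant square.\<close>
  have "N \<le> card C"
  proof -
    let ?h = "\<lambda>i. \<Sum>j<N. (u i j)\<^sup>2"
    have h: "?h sums (\<Sum>j<N. 1)" by (intro sums_sum u2)
    have "(\<Sum>i<m. ?h i) \<le> real (card C) + 1 / 2" for m
    proof -
      let ?K = "{k. N \<le> k \<and> g k < m}"
      have gK: "g ` ?K = {..<m} - C" by (auto simp: C_def)
      have finK: "finite ?K"
        by (rule finite_imageD[of g]) (use gK injg in \<open>auto intro: inj_on_subset\<close>)
      have "(\<Sum>i<m. ?h i) = (\<Sum>i\<in>{..<m} \<inter> C. ?h i) + (\<Sum>i\<in>{..<m} - C. ?h i)"
        by (subst sum.union_disjoint[symmetric]) (auto intro!: sum.cong)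
      moreover have "(\<Sum>i\<in>{..<m} \<inter> C. ?h i) \<le> (\<Sum>i\<in>{..<m} \<inter> C. 1)" by (intro sum_mono besR) auto
      moreover have "(\<Sum>i\<in>{..<m} \<inter> C. 1) \<le> real (card C)" using finC by (auto intro!: card_mono)
      moreover have "(\<Sum>i\<in>{..<m} - C. ?h i) = (\<Sum>k\<in>?K. ?h (g k))"
        unfolding gK[symmetric] by (rule sum.reindex_cong[OF _ refl refl]) (rule inj_on_subset[OF injg], auto)
      moreover have "(\<Sum>k\<in>?K. ?h (g k)) \<le> (\<Sum>k\<in>?K. off k)"
      proof (rule sum_mono)
        fix k assume "k \<in> ?K"
        then have "(u (g k) k)\<^sup>2 + ?h (g k) \<le> 1" using besR[of "insert k {..<N}" "g k"] by simp
        then show "?h (g k) \<le> off k" using diag[of k] by linarith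
      qed
      moreover have "(\<Sum>k\<in>?K. off k) < 1 / 2" using finK by (intro offK) auto
      ultimately show ?thesis by linarith
    qed
    then have "(\<Sum>i. ?h i) \<le> real (card C) + 1 / 2" by (intro suminf_le_const sums_summable[OF h]) auto
    then have "real N < real (card C) + 1" using h by (simp add: sums_iff)
    then show ?thesis by linarith
  qed
  with cardF[OF finC] have "card C = N" by simp
  then obtain h where h: "bij_betw h {..<N} C"
    using ex_bij_betw_nat_finite[OF finC] by (auto simp: atLeast0LessThan)
  define \<sigma> where "\<sigma> j = (if j < N then h j else g j)" for j
  have "bij_betw \<sigma> ({..<N} \<union> {N..}) (C \<union> g ` {N..})"
  proof (rule bij_betw_combine)
    show "bij_betw \<sigma> {..<N} C" by (rule bij_betw_cong[THEN iffD1, OF _ h]) (simp add: \<sigma>_def)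
    show "bij_betw \<sigma> {N..} (g ` {N..})"
      by (rule bij_betw_cong[THEN iffD1, OF _ inj_on_imp_bij_betw[OF injg]]) (simp add: \<sigma>_def)
  qed (simp add: C_def)
  moreover have "{..<N} \<union> {N..} = UNIV" "C \<union> g ` {N..} = UNIV" by (auto simp: C_def)
  ultimately have bij: "bij \<sigma>" by simp
  have "(\<Sum>i<m. \<Sum>j<m. off_diagonal (e \<circ> \<sigma>) f i j) \<le> suminf off + (\<Sum>j<N. s j)" for m
  proof -
    have "(\<Sum>i<m. \<Sum>j<m. off_diagonal (e \<circ> \<sigma>) f i j) = (\<Sum>j<m. \<Sum>i<m. off_diagonal (e \<circ> \<sigma>) f i j)"
      by (rule sum.swap)
    \<comment> \<open>In the first \<open>N\<close> columns the matched row is arbitrary, so the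
      entire column sum \<open>s j\<close> is allowed for.\<close>
    also have "\<dots> \<le> (\<Sum>j<m. off j + (if j < N then s j else 0))"
    proof (rule sum_mono)
      fix j
      have "(\<Sum>i<m. off_diagonal (e \<circ> \<sigma>) f i j) = (\<Sum>i\<in>{..<m} - {j}. u (\<sigma> i) j)"
        by (rule sum.mono_neutral_cong_right) (auto simp: u_def)
      also have "\<dots> = (\<Sum>i\<in>\<sigma> ` ({..<m} - {j}). u i j)"
        using bij by (subst sum.reindex) (auto simp: bij_def intro: inj_on_subset)
      also have "\<dots> \<le> off j + (if j < N then s j else 0)"
      proof (cases "j < N")
        case True
        then show ?thesis using sumu[of "\<sigma> ` ({..<m} - {j})" j] off0[of j] by simp
      next
        case False
        then have "g j = \<sigma> j" by (simp add: \<sigma>_def)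
        then have "g j \<notin> \<sigma> ` ({..<m} - {j})" using bij by (auto simp: bij_def inj_def)
        then show ?thesis using offS[of "\<sigma> ` ({..<m} - {j})" j] False by simp
      qed
      finally show "(\<Sum>i<m. off_diagonal (e \<circ> \<sigma>) f i j) \<le> off j + (if j < N then s j else 0)" .
    qed
    also have "\<dots> = (\<Sum>j<m. off j) + (\<Sum>j<m. if j < N then s j else 0)" by (rule sum.distrib)
    also have "(\<Sum>j<m. if j < N then s j else 0) = (\<Sum>j\<in>{..<m} \<inter> {..<N}. s j)"
      by (subst sum.inter_restrict) auto
    also have "(\<Sum>j<m. off j) + \<dots> \<le> suminf off + (\<Sum>j<N. s j)"
      using s1 by (intro add_mono sum_le_suminf smoff off0 sum_mono2) (auto intro: order_trans[OF zero_le_one])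
    finally show ?thesis .
  qed
  with bij show thesis by (rule that)
qed

text \<open>Diagonal entries are at most 1 in modulus, so the excess of a column sum over 1 is
  bounded by its off-diagonal part. Since the hypothesis is invariant under transposition, this is
  the way back in the proof that \<open>finite_distortion\<close> is symmetric.\<close>

lemma matched_finite_distortion:
  fixes e f :: "nat \<Rightarrow> 'a::{real_inner, complete_space}"
  assumes e: "orthonormal_basis e" and f: "orthonormal_basis f"
    and T: "\<And>m. (\<Sum>i<m. \<Sum>j<m. off_diagonal e f i j) \<le> T"
  shows "finite_distortion e f"
proof -
  define u where "u i j = \<bar>e i \<bullet> f j\<bar>" for i j
  have u0: "0 \<le> u i j" and u1: "u i j \<le> 1" for i j
    using basis_inner_le_1[OF e f] by (simp_all add: u_def)
  have part: "(\<Sum>j<k. (\<Sum>i<m. u i j) - 1) \<le> T" if "k \<le> m" for k m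
  proof -
    have "(\<Sum>j<k. (\<Sum>i<m. u i j) - 1) \<le> (\<Sum>j<k. \<Sum>i<m. off_diagonal e f i j)"
    proof (rule sum_mono)
      fix j assume "j \<in> {..<k}"
      then have "j \<in> {..<m}" using that by auto
      then have "(\<Sum>i<m. u i j) = u j j + (\<Sum>i\<in>{..<m} - {j}. u i j)" by (intro sum.remove) auto
      also have "(\<Sum>i\<in>{..<m} - {j}. u i j) = (\<Sum>i<m. off_diagonal e f i j)"
        by (rule sum.mono_neutral_cong_left) (auto simp: u_def)
      finally show "(\<Sum>i<m. u i j) - 1 \<le> (\<Sum>i<m. off_diagonal e f i j)" using u1[of j j] by linarith
    qed
    also have "\<dots> \<le> (\<Sum>j<m. \<Sum>i<m. off_diagonal e f i j)"
      using that by (intro sum_mono2) (auto intro: sum_nonneg)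
    also have "\<dots> \<le> T" by (subst sum.swap) (rule T)
    finally show ?thesis .
  qed
  have sm: "summable (\<lambda>i. u i j)" for j
  proof (rule summableI_nonneg_bounded[OF u0])
    fix n
    let ?m = "max n (Suc j)"
    have "(\<Sum>i<n. u i j) \<le> (\<Sum>i<?m. u i j)" by (intro sum_mono2 u0) auto
    also have "\<dots> = u j j + (\<Sum>i\<in>{..<?m} - {j}. u i j)" by (intro sum.remove) auto
    also have "(\<Sum>i\<in>{..<?m} - {j}. u i j) = (\<Sum>i<?m. off_diagonal e f i j)"
      by (rule sum.mono_neutral_cong_left) (auto simp: u_def)
    also have "\<dots> \<le> (\<Sum>j<?m. \<Sum>i<?m. off_diagonal e f i j)"
      by (rule member_le_sum) (auto intro: sum_nonneg)
    also have "\<dots> \<le> T" by (subst sum.swap) (rule T)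
    finally show "(\<Sum>i<n. u i j) \<le> 1 + T" using u1[of j j] by simp
  qed
  have "summable (\<lambda>j. (\<Sum>i. u i j) - 1)"
  proof (rule summableI_nonneg_bounded)
    show "0 \<le> (\<Sum>i. u i j) - 1" for j
      using basis_sum_ge_1[OF e f, of j] sm[of j] by (simp add: u_def)
    fix k
    have "(\<lambda>m. \<Sum>j<k. (\<Sum>i<m. u i j) - 1) \<longlonglongrightarrow> (\<Sum>j<k. (\<Sum>i. u i j) - 1)"
      by (intro tendsto_sum tendsto_diff tendsto_const summable_LIMSEQ sm)
    then show "(\<Sum>j<k. (\<Sum>i. u i j) - 1) \<le> T"
      by (rule LIMSEQ_le_const2) (use part in blast)
  qed
  with sm show ?thesis by (simp add: finite_distortion_def u_def)
qed

lemma orthonormal_basis_reindex: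
  assumes "bij \<sigma>" "orthonormal_basis e" shows "orthonormal_basis (e \<circ> \<sigma>)"
proof -
  have "range (e \<circ> \<sigma>) = range e"
    using assms(1) by (simp only: image_comp[symmetric] bij_is_surj)
  moreover have "\<sigma> i = \<sigma> j \<longleftrightarrow> i = j" for i j using assms(1) by (simp add: bij_def inj_eq)
  ultimately show ?thesis using assms(2) unfolding orthonormal_basis_def by simp
qed

lemma finite_distortion_sym:
  fixes e f :: "nat \<Rightarrow> 'a::{real_inner, complete_space}"
  assumes e: "orthonormal_basis e" and f: "orthonormal_basis f" and fd: "finite_distortion f e"
  shows "finite_distortion e f"
proof -
  obtain \<sigma> T where \<sigma>: "bij \<sigma>" and T: "\<And>m. (\<Sum>i<m. \<Sum>j<m. off_diagonal (f \<circ> \<sigma>) e i j) \<le> T"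
    by (rule finite_distortion_matching[OF f e fd]) blast
  have f': "orthonormal_basis (f \<circ> \<sigma>)"
    by (rule orthonormal_basis_reindex[OF \<sigma> f])
  have "(\<Sum>i<m. \<Sum>j<m. off_diagonal e (f \<circ> \<sigma>) i j) \<le> T" for m
  proof -
    have "off_diagonal e (f \<circ> \<sigma>) i j = off_diagonal (f \<circ> \<sigma>) e j i" for i j by (simp add: inner_commute)
    then have "(\<Sum>i<m. \<Sum>j<m. off_diagonal e (f \<circ> \<sigma>) i j) = (\<Sum>i<m. \<Sum>j<m. off_diagonal (f \<circ> \<sigma>) e j i)"
      by (intro sum.cong refl)
    also have "\<dots> = (\<Sum>j<m. \<Sum>i<m. off_diagonal (f \<circ> \<sigma>) e j i)" by (rule sum.swap)
    finally show ?thesis using T[of m] by simp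
  qed
  then have "finite_distortion e (f \<circ> \<sigma>)" by (rule matched_finite_distortion[OF e f'])
  then have sm: "\<And>j. summable (\<lambda>i. \<bar>e i \<bullet> f (\<sigma> j)\<bar>)" and sm': "summable (\<lambda>j. (\<Sum>i. \<bar>e i \<bullet> f (\<sigma> j)\<bar>) - 1)"
    by (simp_all add: finite_distortion_def)
  have eq: "\<sigma> (inv \<sigma> j) = j" for j using \<sigma> by (simp add: bij_is_surj surj_f_inv_f)
  \<comment> \<open>The permutation acts on the columns here and has to be undone in the outer
    series, whose terms are nonnegative.\<close>
  have "summable ((\<lambda>j. (\<Sum>i. \<bar>e i \<bullet> f (\<sigma> j)\<bar>) - 1) \<circ> inv \<sigma>)"
    using basis_sum_ge_1[OF e f sm] bij_imp_bij_inv[OF \<sigma>]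
    by (intro summable_reindex sm') (auto simp: bij_def)
  then show ?thesis using sm[of "inv \<sigma> _"] by (simp add: finite_distortion_def eq o_def)
qed

text \<open>\<open>prodinf\<close> is a definite description over \<open>has_prod\<close>, which
  asks for a nonzero limit of the partial products. Factors at least 1 make these increase to a
  nonzero supremum, so the product denotes it even when it is \<infinity>.\<close>

lemma prodinf_ennreal_ge_1:
  fixes F :: "nat \<Rightarrow> ennreal"
  assumes "\<And>j. 1 \<le> F j"
  shows "prodinf F = (SUP n. \<Prod>i\<le>n. F i)"
proof -
  let ?p = "\<lambda>n. \<Prod>i\<le>n. F i"
  have "incseq ?p"
    using assms by (intro incseq_SucI) (simp add: mult_left_mono[of 1 "F _", simplified])
  then have lim: "?p \<longlonglongrightarrow> (SUP n. ?p n)" by (rule LIMSEQ_SUP)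
  have "1 \<le> ?p 0" using assms by simp
  then have nz: "(SUP n. ?p n) \<noteq> 0" by (metis SUP_upper UNIV_I not_one_le_zero order_trans)
  have Fnz: "F j \<noteq> 0" for j using assms[of j] by (metis not_one_le_zero)
  have iff: "F has_prod p \<longleftrightarrow> ?p \<longlonglongrightarrow> p \<and> p \<noteq> 0" for p
    using Fnz by (simp add: has_prod_def raw_has_prod_def)
  show ?thesis
    unfolding prodinf_def
  proof (rule the_equality)
    show "F has_prod (SUP n. ?p n)" unfolding iff using lim nz by blast
    show "p = (SUP n. ?p n)" if "F has_prod p" for p
      using that unfolding iff by (blast intro: LIMSEQ_unique[OF _ lim])
  qed
qed

text \<open>Rests on \<open>\<Sum>x \<le> \<Prod>(1 + x) \<le> exp (\<Sum>x)\<close> for the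
  excesses \<open>x\<close> of the factors over 1.\<close>

lemma prodinf_finite_iff_distortion:
  fixes e f :: "nat \<Rightarrow> 'a::{real_inner, complete_space}"
  assumes e: "orthonormal_basis e" and f: "orthonormal_basis f"
  shows "(\<Prod>j. \<Sum>i. ennreal \<bar>e i \<bullet> f j\<bar>) < \<infinity> \<longleftrightarrow> finite_distortion e f"
proof -
  let ?F = "\<lambda>j. \<Sum>i. ennreal \<bar>e i \<bullet> f j\<bar>" and ?s = "\<lambda>j. \<Sum>i. \<bar>e i \<bullet> f j\<bar>"
  have F: "?F j = ennreal (?s j)" if "summable (\<lambda>i. \<bar>e i \<bullet> f j\<bar>)" for j
    using that by (intro suminf_ennreal2) auto
  have F': "?F j = \<infinity>" if "\<not> summable (\<lambda>i. \<bar>e i \<bullet> f j\<bar>)" for j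
  proof (rule ccontr)
    assume "?F j \<noteq> \<infinity>"
    then have "summable (\<lambda>i. \<bar>e i \<bullet> f j\<bar>)" by (intro summable_suminf_not_top) auto
    with that show False by blast
  qed
  have F1: "1 \<le> ?F j" for j
  proof (cases "summable (\<lambda>i. \<bar>e i \<bullet> f j\<bar>)")
    case True
    then show ?thesis using basis_sum_ge_1[OF e f True] unfolding F[OF True] by (simp add: ennreal_ge_1)
  next
    case False
    then show ?thesis unfolding F'[OF False] by simp
  qed
  note P = prodinf_ennreal_ge_1[of ?F, OF F1]
  show ?thesis
  proof
    assume fin: "prodinf ?F < \<infinity>"
    have le: "(\<Prod>i\<le>n. ?F i) \<le> prodinf ?F" for n unfolding P by (rule SUP_upper) simp
    have sm: "summable (\<lambda>i. \<bar>e i \<bullet> f j\<bar>)" for j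
    proof (rule ccontr)
      assume "\<not> summable (\<lambda>i. \<bar>e i \<bullet> f j\<bar>)"
      then have "?F j = \<infinity>" by (rule F')
      moreover have "?F j \<le> (\<Prod>i\<le>j. ?F i)"
      proof -
        have "1 \<le> (\<Prod>i<j. ?F i)" using F1 by (intro prod_ge_1) auto
        then have "1 * ?F j \<le> (\<Prod>i<j. ?F i) * ?F j" by (rule mult_right_mono) simp
        also have "\<dots> = (\<Prod>i\<le>j. ?F i)" by (simp add: lessThan_Suc_atMost[symmetric])
        finally show ?thesis by simp
      qed
      ultimately show False using le[of j] fin by (simp add: top_unique)
    qed
    have "prodinf ?F \<noteq> top" using fin unfolding infinity_ennreal_def by (rule less_imp_neq)
    then obtain B where B: "prodinf ?F = ennreal B" "0 \<le> B"
      using ennreal_enn2real_if[of "prodinf ?F"] enn2real_nonneg by metis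
    have s1: "1 \<le> ?s j" for j by (rule basis_sum_ge_1[OF e f sm])
    have s0: "0 \<le> ?s j" for j using s1[of j] by linarith
    have pB: "(\<Prod>i\<le>n. ?s i) \<le> B" for n
    proof -
      have "ennreal (\<Prod>i\<le>n. ?s i) = (\<Prod>i\<le>n. ?F i)" by (simp add: F[OF sm] prod_ennreal s0)
      then have "ennreal (\<Prod>i\<le>n. ?s i) \<le> ennreal B" using le[of n] unfolding B(1) by simp
      then show ?thesis unfolding ennreal_le_iff[OF B(2)] .
    qed
    have "summable (\<lambda>j. ?s j - 1)"
    proof (rule summableI_nonneg_bounded)
      show "0 \<le> ?s j - 1" for j using s1[of j] by simp
      fix n
      have "(\<Sum>j<n. ?s j - 1) \<le> (\<Sum>j\<le>n. ?s j - 1)" using s1 by (intro sum_mono2) auto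
      also have "\<dots> \<le> (\<Prod>j\<le>n. 1 + (?s j - 1))" using s1 by (intro sum_le_prod) auto
      also have "\<dots> = (\<Prod>j\<le>n. ?s j)" by simp
      also have "\<dots> \<le> B" by (rule pB)
      finally show "(\<Sum>j<n. ?s j - 1) \<le> B" .
    qed
    with sm show "finite_distortion e f" by (simp add: finite_distortion_def)
  next
    assume fd: "finite_distortion e f"
    then have sm: "\<And>j. summable (\<lambda>i. \<bar>e i \<bullet> f j\<bar>)" and sm': "summable (\<lambda>j. ?s j - 1)"
      by (simp_all add: finite_distortion_def)
    have s1: "1 \<le> ?s j" for j by (rule basis_sum_ge_1[OF e f sm])
    have s0: "0 \<le> ?s j" for j using s1[of j] by linarith
    have "(\<Prod>i\<le>n. ?F i) \<le> ennreal (exp (\<Sum>j. ?s j - 1))" for n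
    proof -
      have "(\<Prod>i\<le>n. ?s i) \<le> (\<Prod>i\<le>n. exp (?s i - 1))"
        using s0 exp_ge_add_one_self[of "?s _ - 1"] by (intro prod_mono) auto
      also have "\<dots> = exp (\<Sum>i\<le>n. ?s i - 1)" by (simp add: exp_sum)
      also have "\<dots> \<le> exp (\<Sum>j. ?s j - 1)" using s1 sm' by (simp add: sum_le_suminf)
      finally show ?thesis by (simp add: F[OF sm] prod_ennreal s0 ennreal_leI)
    qed
    then have "prodinf ?F \<le> ennreal (exp (\<Sum>j. ?s j - 1))" unfolding P by (rule SUP_least)
    then show "prodinf ?F < \<infinity>"
      by (rule order_le_less_trans) (simp add: infinity_ennreal_def)
  qed
qed

section \<open>Independence of the enumeration of a basis\<close>

lemma rectangle_reindex:
  "bij \<sigma> \<Longrightarrow> rectangle (e \<circ> \<sigma>) (a \<circ> \<sigma>) (b \<circ> \<sigma>) = rectangle e a b"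
  unfolding set_eq_iff in_rectangle o_def by (metis bij_pointE)

lemma rectangle_bounds_reindex:
  assumes "bij \<sigma>" "rectangle_bounds e a b" shows "rectangle_bounds (e \<circ> \<sigma>) (a \<circ> \<sigma>) (b \<circ> \<sigma>)"
proof -
  have "summable ((\<lambda>j. max 0 (ln (b j - a j))) \<circ> \<sigma>)"
    using assms by (intro summable_reindex) (auto simp: rectangle_bounds_def bij_def)
  moreover have "bounded (range (c \<circ> \<sigma>))" if "bounded (range c)" for c :: "nat \<Rightarrow> real"
    using that by (rule bounded_subset) auto
  ultimately show ?thesis
    using assms(2) unfolding rectangle_bounds_def rectangle_reindex[OF assms(1)] by (simp add: o_def)
qed

lemma summable_signed_parts:
  fixes x :: "nat \<Rightarrow> real"
  assumes p: "summable (\<lambda>j. max 0 (x j))"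
  shows "summable x \<longleftrightarrow> summable (\<lambda>j. max 0 (- x j))"
    and "summable x \<Longrightarrow> suminf x = (\<Sum>j. max 0 (x j)) - (\<Sum>j. max 0 (- x j))"
proof -
  have x: "(\<lambda>j. max 0 (x j) - max 0 (- x j)) = x" and m: "(\<lambda>j. max 0 (x j) - x j) = (\<lambda>j. max 0 (- x j))"
    by (auto simp: fun_eq_iff)
  show iff: "summable x \<longleftrightarrow> summable (\<lambda>j. max 0 (- x j))"
    using summable_diff[OF p, of "\<lambda>j. max 0 (- x j)"] summable_diff[OF p, of x] unfolding x m by blast
  show "suminf x = (\<Sum>j. max 0 (x j)) - (\<Sum>j. max 0 (- x j))" if "summable x"
    using suminf_diff[OF p, of "\<lambda>j. max 0 (- x j)"] iff that unfolding x by simp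
qed

text \<open>Rearrangement is harmless for series of nonnegative terms, so the logarithms are split
  into positive and negative parts.\<close>

lemma rectangle_volume_reindex:
  assumes \<sigma>: "bij \<sigma>" and ab: "rectangle_bounds e a b"
  shows "rectangle_volume (a \<circ> \<sigma>) (b \<circ> \<sigma>) = rectangle_volume a b"
proof -
  let ?p = "\<lambda>j. max 0 (ln (b j - a j))" and ?m = "\<lambda>j. max 0 (- ln (b j - a j))"
  have inj: "inj \<sigma>" "inj (inv \<sigma>)" using \<sigma> bij_imp_bij_inv[OF \<sigma>] by (auto simp: bij_def)
  have rng: "x \<in> range \<sigma>" for x using \<sigma> by (metis bij_is_surj UNIV_I)
  have p: "summable ?p" using ab by (simp add: rectangle_bounds_def)
  have p': "summable (?p \<circ> \<sigma>)" by (intro summable_reindex p inj) auto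
  note parts = summable_signed_parts[OF p]
  note parts' = summable_signed_parts[of "\<lambda>j. ln (b (\<sigma> j) - a (\<sigma> j))", OF p'[unfolded o_def]]
  have mm: "summable (?m \<circ> \<sigma>) \<longleftrightarrow> summable ?m"
  proof
    assume "summable (?m \<circ> \<sigma>)"
    then have "summable ((?m \<circ> \<sigma>) \<circ> inv \<sigma>)" by (rule summable_reindex[OF _ inj(2)]) simp
    moreover have "(?m \<circ> \<sigma>) \<circ> inv \<sigma> = ?m" using \<sigma> by (simp add: fun_eq_iff bij_is_surj surj_f_inv_f)
    ultimately show "summable ?m" by (rule back_subst)
  next
    assume "summable ?m"
    then show "summable (?m \<circ> \<sigma>)" by (rule summable_reindex[OF _ inj(1)]) simp
  qed
  show ?thesis
  proof (cases "summable ?m")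
    case True
    then have sm: "summable (\<lambda>j. ln (b j - a j))" "summable (\<lambda>j. ln (b (\<sigma> j) - a (\<sigma> j)))"
      using parts(1) parts'(1) mm unfolding o_def by blast+
    have "(\<Sum>j. ln (b (\<sigma> j) - a (\<sigma> j))) = suminf (?p \<circ> \<sigma>) - suminf (?m \<circ> \<sigma>)"
      using parts'(2)[OF sm(2)] by (simp add: o_def)
    also have "suminf (?p \<circ> \<sigma>) = suminf ?p" using rng by (intro suminf_reindex p inj) auto
    also have "suminf (?m \<circ> \<sigma>) = suminf ?m" using rng by (intro suminf_reindex True inj) auto
    also have "suminf ?p - suminf ?m = (\<Sum>j. ln (b j - a j))" by (rule parts(2)[OF sm(1), symmetric])
    finally show ?thesis using sm by (simp add: rectangle_volume_def)
  next
    case False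
    then have "\<not> summable (\<lambda>j. ln (b j - a j))" "\<not> summable (\<lambda>j. ln (b (\<sigma> j) - a (\<sigma> j)))"
      using parts(1) parts'(1) mm unfolding o_def by blast+
    then show ?thesis by (simp add: rectangle_volume_def)
  qed
qed

lemma reindex_inv: "bij \<sigma> \<Longrightarrow> (g \<circ> \<sigma>) \<circ> inv \<sigma> = g" "bij \<sigma> \<Longrightarrow> (g \<circ> inv \<sigma>) \<circ> \<sigma> = g"
  by (auto simp: fun_eq_iff bij_def surj_f_inv_f)

lemma rectangle_ring_reindex:
  assumes "bij \<sigma>" shows "rectangle_ring (e \<circ> \<sigma>) = rectangle_ring e"
proof -
  have sub: "measurable_rectangles e \<subseteq> measurable_rectangles (e \<circ> \<sigma>)" if "bij \<sigma>" for e :: "nat \<Rightarrow> 'a::real_inner" and \<sigma>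
  proof
    fix A assume "A \<in> measurable_rectangles e"
    then consider "A = {}" | a b where "A = rectangle e a b" "rectangle_bounds e a b"
      by (auto simp: measurable_rectangles_def)
    then show "A \<in> measurable_rectangles (e \<circ> \<sigma>)"
    proof cases
      case 2
      then show ?thesis
        using rectangle_bounds_reindex[OF that 2(2)] rectangle_reindex[OF that, of e a b]
        unfolding measurable_rectangles_def by (intro insertI2 CollectI exI[of _ "a \<circ> \<sigma>"] exI[of _ "b \<circ> \<sigma>"]) simp
    qed (simp add: measurable_rectangles_def)
  qed
  have "measurable_rectangles (e \<circ> \<sigma>) = measurable_rectangles e"
    using sub[OF assms, of e] sub[OF bij_imp_bij_inv[OF assms], of "e \<circ> \<sigma>"] reindex_inv[OF assms, of e] by simp
  then show ?thesis by (simp add: rectangle_ring_def)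
qed

lemma shift_invariant_extension_reindex:
  assumes \<sigma>: "bij \<sigma>" and \<mu>: "shift_invariant_extension e \<mu>"
  shows "shift_invariant_extension (e \<circ> \<sigma>) \<mu>"
proof -
  have "\<mu> (rectangle (e \<circ> \<sigma>) a b) = rectangle_volume a b" if "rectangle_bounds (e \<circ> \<sigma>) a b" for a b
  proof -
    let ?a = "a \<circ> inv \<sigma>" and ?b = "b \<circ> inv \<sigma>"
    have bd: "rectangle_bounds e ?a ?b"
      using rectangle_bounds_reindex[OF bij_imp_bij_inv[OF \<sigma>] that] by (simp add: reindex_inv[OF \<sigma>])
    have "rectangle (e \<circ> \<sigma>) a b = rectangle e ?a ?b"
      using rectangle_reindex[OF \<sigma>, of e ?a ?b] by (simp add: reindex_inv[OF \<sigma>])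
    moreover have "rectangle_volume ?a ?b = rectangle_volume a b"
      using rectangle_volume_reindex[OF \<sigma> bd] by (simp add: reindex_inv[OF \<sigma>])
    ultimately show ?thesis using \<mu> bd by (simp add: shift_invariant_extension_def)
  qed
  then show ?thesis
    using \<mu> unfolding shift_invariant_extension_def rectangle_ring_reindex[OF \<sigma>] by blast
qed

lemma ring_measure_reindex:
  assumes \<sigma>: "bij \<sigma>" shows "ring_measure (e \<circ> \<sigma>) = ring_measure e"
proof -
  have "shift_invariant_extension (e \<circ> \<sigma>) \<mu> \<longleftrightarrow> shift_invariant_extension e \<mu>" for \<mu>
    using shift_invariant_extension_reindex[OF \<sigma>, of e \<mu>]
      shift_invariant_extension_reindex[OF bij_imp_bij_inv[OF \<sigma>], of "e \<circ> \<sigma>" \<mu>] reindex_inv[OF \<sigma>, of e] by auto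
  then show ?thesis unfolding ring_measure_def rectangle_ring_reindex[OF \<sigma>] by simp
qed

section \<open>Preimages under contractions\<close>

abbreviation lebesgue_on_coords :: "nat \<Rightarrow> (nat \<Rightarrow> real) measure" where
  "lebesgue_on_coords n \<equiv> Pi\<^sub>M {..<n} (\<lambda>_. lborel)"

lemma lborel_distr_isometry:
  fixes c t :: real assumes "\<bar>c\<bar> = 1" shows "distr lborel borel (\<lambda>x. t + c * x) = lborel"
proof -
  have "c \<noteq> 0" using assms by auto
  then show ?thesis
    using lborel_real_affine[of c t] assms by (simp add: density_1 one_ennreal_def[symmetric])
qed

lemma coord_isometry_measurable:
  "(\<lambda>y. \<lambda>i\<in>{..<n}. h i + c * y i) \<in> measurable (lebesgue_on_coords n) (lebesgue_on_coords n)"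
  by measurable

text \<open>Covers translations (\<open>c = 1\<close>) and point reflections
  (\<open>c = - 1\<close>); both occur in the double integral below.\<close>

lemma distr_lebesgue_on_coords:
  assumes c: "\<bar>c\<bar> = (1 :: real)"
  shows "distr (lebesgue_on_coords n) (lebesgue_on_coords n) (\<lambda>y. \<lambda>i\<in>{..<n}. h i + c * y i) = lebesgue_on_coords n"
proof -
  interpret product_sigma_finite "\<lambda>_::nat. lborel :: real measure" by standard
  show ?thesis
  proof (rule PiM_eqI)
    fix A :: "nat \<Rightarrow> real set" assume A: "\<And>i. i \<in> {..<n} \<Longrightarrow> A i \<in> sets lborel"
    let ?B = "\<lambda>i. (\<lambda>t. h i + c * t) -` A i"
    have B: "?B i \<in> sets lborel" "emeasure lborel (?B i) = emeasure lborel (A i)" if "i \<in> {..<n}" for i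
    proof -
      have m: "(\<lambda>t. h i + c * t) \<in> measurable lborel borel" by measurable
      show "?B i \<in> sets lborel" using measurable_sets[OF m, of "A i"] A[OF that] by simp
      show "emeasure lborel (?B i) = emeasure lborel (A i)"
        using emeasure_distr[OF m, of "A i"] A[OF that] by (simp add: lborel_distr_isometry[OF c])
    qed
    have "emeasure (distr (lebesgue_on_coords n) (lebesgue_on_coords n) (\<lambda>y. \<lambda>i\<in>{..<n}. h i + c * y i)) (Pi\<^sub>E {..<n} A)
        = emeasure (lebesgue_on_coords n) ((\<lambda>y. \<lambda>i\<in>{..<n}. h i + c * y i) -` Pi\<^sub>E {..<n} A \<inter> space (lebesgue_on_coords n))"
      using A by (intro emeasure_distr coord_isometry_measurable sets_PiM_I_finite) auto
    also have "(\<lambda>y. \<lambda>i\<in>{..<n}. h i + c * y i) -` Pi\<^sub>E {..<n} A \<inter> space (lebesgue_on_coords n) = Pi\<^sub>E {..<n} ?B"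
      by (auto simp: space_PiM PiE_iff)
    also have "emeasure (lebesgue_on_coords n) (Pi\<^sub>E {..<n} ?B) = (\<Prod>i<n. emeasure lborel (?B i))"
      using B(1) by (intro emeasure_PiM) auto
    also have "\<dots> = (\<Prod>i<n. emeasure lborel (A i))" by (intro prod.cong refl B(2)) auto
    finally show "emeasure (distr (lebesgue_on_coords n) (lebesgue_on_coords n) (\<lambda>y. \<lambda>i\<in>{..<n}. h i + c * y i)) (Pi\<^sub>E {..<n} A)
        = (\<Prod>i<n. emeasure lborel (A i))" .
  qed auto
qed

lemma nn_integral_lebesgue_on_coords:
  assumes "\<bar>c\<bar> = (1 :: real)" "g \<in> borel_measurable (lebesgue_on_coords n)"
  shows "(\<integral>\<^sup>+y. g (\<lambda>i\<in>{..<n}. h i + c * y i) \<partial>lebesgue_on_coords n) = (\<integral>\<^sup>+y. g y \<partial>lebesgue_on_coords n)"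
proof -
  have "(\<integral>\<^sup>+y. g (\<lambda>i\<in>{..<n}. h i + c * y i) \<partial>lebesgue_on_coords n) =
     (\<integral>\<^sup>+y. g y \<partial>distr (lebesgue_on_coords n) (lebesgue_on_coords n) (\<lambda>y. \<lambda>i\<in>{..<n}. h i + c * y i))"
    by (intro nn_integral_distr[symmetric] coord_isometry_measurable) (simp add: assms(2))
  then show ?thesis by (simp add: distr_lebesgue_on_coords[OF assms(1)])
qed

text \<open>
  At the unit ball \<open>Y\<close> this proportionality shows that the factor of a contraction is at least 1,
  which replaces an estimate of a determinant.
\<close>

lemma linear_preimage_proportional:
  fixes u :: "nat \<Rightarrow> nat \<Rightarrow> real"
  defines "T \<equiv> \<lambda>n y. \<lambda>j\<in>{..<n}. \<Sum>i<n. y i * u i j"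
  assumes surj: "\<And>z. \<exists>y. \<forall>j<n. (\<Sum>i<n. y i * u i j) = z j"
    and X: "X \<in> sets (lebesgue_on_coords n)" and Y: "Y \<in> sets (lebesgue_on_coords n)"
  shows "emeasure (lebesgue_on_coords n) (T n -` X \<inter> space (lebesgue_on_coords n)) * emeasure (lebesgue_on_coords n) Y =
    emeasure (lebesgue_on_coords n) (T n -` Y \<inter> space (lebesgue_on_coords n)) * emeasure (lebesgue_on_coords n) X"
proof -
  let ?M = "lebesgue_on_coords n" and ?T = "T n"
  let ?p = "\<lambda>h c y. \<lambda>i\<in>{..<n}. h i + c * y i :: real"
  interpret product_sigma_finite "\<lambda>_::nat. lborel :: real measure" by standard
  interpret sigma_finite_measure ?M by (rule sigma_finite) simp
  interpret pair_sigma_finite ?M ?M by standard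
  have T[measurable]: "?T \<in> measurable ?M ?M" unfolding T_def by measurable
  note X[measurable] Y[measurable]
  have Ti: "(\<lambda>x. ?T x i) \<in> borel_measurable ?M" and yi: "(\<lambda>y. y i) \<in> borel_measurable ?M" if "i < n" for i
    using measurable_compose[OF T measurable_component_singleton[of i]] measurable_component_singleton[of i "{..<n}" "\<lambda>_. lborel"] that
    by simp_all
  have p: "(\<lambda>z. ?p (?T (fst z)) c (snd z)) \<in> measurable (?M \<Otimes>\<^sub>M ?M) ?M" for c
  proof (rule measurable_restrict)
    fix i assume "i \<in> {..<n}"
    then have "(\<lambda>z. ?T (fst z) i) \<in> borel_measurable (?M \<Otimes>\<^sub>M ?M)" "(\<lambda>z. snd z i) \<in> borel_measurable (?M \<Otimes>\<^sub>M ?M)"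
      using measurable_compose[OF measurable_fst Ti] measurable_compose[OF measurable_snd yi] by simp_all
    then show "(\<lambda>z. ?T (fst z) i + c * snd z i) \<in> measurable (?M \<Otimes>\<^sub>M ?M) lborel"
      by (simp add: borel_measurable_add borel_measurable_times)
  qed
  have ind: "(\<lambda>z. indicator A (g z) * indicator B (g' z) :: ennreal) \<in> borel_measurable N"
    if "A \<in> sets ?M" "B \<in> sets ?M" "g \<in> measurable N ?M" "g' \<in> measurable N ?M" for A B g g' N
    using measurable_compose[OF that(3) borel_measurable_indicator[OF that(1)]]
      measurable_compose[OF that(4) borel_measurable_indicator[OF that(2)]]
    by (rule borel_measurable_times_ennreal)
  have Tf: "(\<lambda>z. ?T (fst z)) \<in> measurable (?M \<Otimes>\<^sub>M ?M) ?M" by (rule measurable_compose[OF measurable_fst T])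
  have int: "(\<integral>\<^sup>+x. indicator A (?T x) * c \<partial>?M) = emeasure ?M (?T -` A \<inter> space ?M) * c" if [measurable]: "A \<in> sets ?M" for A c
  proof -
    have "(\<integral>\<^sup>+x. indicator A (?T x) * c \<partial>?M) = (\<integral>\<^sup>+x. indicator (?T -` A \<inter> space ?M) x * c \<partial>?M)"
      by (rule nn_integral_cong) (simp add: indicator_def)
    also have "\<dots> = emeasure ?M (?T -` A \<inter> space ?M) * c"
      using measurable_sets[OF T that] by (simp add: nn_integral_multc)
    finally show ?thesis .
  qed
  have shift: "(\<integral>\<^sup>+y. indicator A (?p h c y) \<partial>?M) = emeasure ?M A" if "\<bar>c\<bar> = 1" "A \<in> sets ?M" for A h c
    using nn_integral_lebesgue_on_coords[OF that(1), of "indicator A" n h] that(2) by simp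
  \<comment> \<open>As in the uniqueness proof for Haar measure: the indicator of \<open>X\<close>
    at \<open>?T x\<close> times that of \<open>Y\<close> at \<open>?T x + y\<close> is integrated
    over \<open>x\<close> and \<open>y\<close> in both orders.\<close>
  have "emeasure ?M (?T -` X \<inter> space ?M) * emeasure ?M Y =
      (\<integral>\<^sup>+x. (\<integral>\<^sup>+y. indicator X (?T x) * indicator Y (?p (?T x) 1 y) \<partial>?M) \<partial>?M)"
  proof -
    have "(\<integral>\<^sup>+y. indicator X (?T x) * indicator Y (?p (?T x) 1 y) \<partial>?M) = indicator X (?T x) * emeasure ?M Y" for x
    proof -
      have "(\<lambda>y. indicator Y (?p (?T x) 1 y) :: ennreal) \<in> borel_measurable ?M"
        by (rule measurable_compose[OF coord_isometry_measurable borel_measurable_indicator[OF Y]])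
      moreover have "(\<integral>\<^sup>+y. indicator Y (?p (?T x) 1 y) \<partial>?M) = emeasure ?M Y" by (rule shift[OF _ Y]) simp
      ultimately show ?thesis by (subst nn_integral_cmult) (simp_all only:)
    qed
    then show ?thesis using int[OF X, of "emeasure ?M Y"] by simp
  qed
  also have "\<dots> = (\<integral>\<^sup>+y. (\<integral>\<^sup>+x. indicator X (?T x) * indicator Y (?p (?T x) 1 y) \<partial>?M) \<partial>?M)"
  proof -
    have "(\<lambda>z. indicator X (?T (fst z)) * indicator Y (?p (?T (fst z)) 1 (snd z)) :: ennreal) \<in> borel_measurable (?M \<Otimes>\<^sub>M ?M)"
      by (rule ind[OF X Y Tf p])
    then show ?thesis by (intro Fubini'[symmetric]) (simp add: case_prod_beta)
  qed
  also have "\<dots> = (\<integral>\<^sup>+y. (\<integral>\<^sup>+x. indicator X (?p (?T x) (-1) y) * indicator Y (?T x) \<partial>?M) \<partial>?M)"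
  proof (rule nn_integral_cong)
    fix y
    \<comment> \<open>Surjectivity enters here: a shift by \<open>y\<close> in the image is a shift
      of \<open>x\<close> by a preimage \<open>z\<close>, and it moves the dependence on
      \<open>y\<close> from \<open>Y\<close> to \<open>X\<close>.\<close>
    obtain z where z: "\<forall>j<n. (\<Sum>i<n. z i * u i j) = y j" using surj by blast
    let ?g = "\<lambda>x. indicator X (?p (?T x) (-1) y) * indicator Y (?T x) :: ennreal"
    have "(\<lambda>x. ?p (?T x) (-1) y) \<in> measurable ?M ?M"
      by (rule measurable_restrict) (simp add: borel_measurable_diff Ti)
    then have g: "?g \<in> borel_measurable ?M" by (rule ind[OF X Y _ T])
    have Tz: "?T (?p z 1 x) = ?p (?T x) 1 y" for x
    proof
      fix j
      have "(\<Sum>i<n. ?p z 1 x i * u i j) = (\<Sum>i<n. z i * u i j) + (\<Sum>i<n. x i * u i j)"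
        by (simp add: sum.distrib[symmetric] algebra_simps)
      then show "?T (?p z 1 x) j = ?p (?T x) 1 y j" using z by (simp add: T_def)
    qed
    have "?p (?p (?T x) 1 y) (-1) y = ?T x" for x by (auto simp: T_def)
    then have "?g (?p z 1 x) = indicator X (?T x) * indicator Y (?p (?T x) 1 y)" for x
      unfolding Tz by simp
    then show "(\<integral>\<^sup>+x. indicator X (?T x) * indicator Y (?p (?T x) 1 y) \<partial>?M) = (\<integral>\<^sup>+x. ?g x \<partial>?M)"
      using nn_integral_lebesgue_on_coords[OF _ g, of 1 z] by simp
  qed
  also have "\<dots> = (\<integral>\<^sup>+x. (\<integral>\<^sup>+y. indicator X (?p (?T x) (-1) y) * indicator Y (?T x) \<partial>?M) \<partial>?M)"
  proof -
    have "(\<lambda>z. indicator X (?p (?T (fst z)) (-1) (snd z)) * indicator Y (?T (fst z)) :: ennreal) \<in> borel_measurable (?M \<Otimes>\<^sub>M ?M)"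
      by (rule ind[OF X Y p Tf])
    then show ?thesis by (intro Fubini') (simp add: case_prod_beta)
  qed
  also have "\<dots> = (\<integral>\<^sup>+x. indicator Y (?T x) * emeasure ?M X \<partial>?M)"
  proof (rule nn_integral_cong)
    fix x
    have "(\<lambda>y. indicator X (?p (?T x) (-1) y) :: ennreal) \<in> borel_measurable ?M"
      by (rule measurable_compose[OF coord_isometry_measurable borel_measurable_indicator[OF X]])
    moreover have "(\<integral>\<^sup>+y. indicator X (?p (?T x) (-1) y) \<partial>?M) = emeasure ?M X" by (rule shift[OF _ X]) simp
    ultimately show "(\<integral>\<^sup>+y. indicator X (?p (?T x) (-1) y) * indicator Y (?T x) \<partial>?M) = indicator Y (?T x) * emeasure ?M X"
      by (subst nn_integral_multc) (simp_all only: mult.commute)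
  qed
  also have "\<dots> = emeasure ?M (?T -` Y \<inter> space ?M) * emeasure ?M X" by (rule int[OF Y])
  finally show ?thesis .
qed

lemma contraction_preimage_volume:
  fixes u :: "nat \<Rightarrow> nat \<Rightarrow> real"
  assumes surj: "\<And>z. \<exists>y. \<forall>j<n. (\<Sum>i<n. y i * u i j) = z j"
    and contr: "\<And>y. (\<Sum>j<n. (\<Sum>i<n. y i * u i j)\<^sup>2) \<le> (\<Sum>i<n. (y i)\<^sup>2)"
    and X: "X \<in> sets (lebesgue_on_coords n)"
  shows "emeasure (lebesgue_on_coords n) X \<le>
    emeasure (lebesgue_on_coords n) ((\<lambda>y. \<lambda>j\<in>{..<n}. \<Sum>i<n. y i * u i j) -` X \<inter> space (lebesgue_on_coords n))"
proof -
  let ?M = "lebesgue_on_coords n" and ?T = "\<lambda>y. \<lambda>j\<in>{..<n}. \<Sum>i<n. y i * u i j"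
  interpret product_sigma_finite "\<lambda>_::nat. lborel :: real measure" by standard
  \<comment> \<open>Besides being mapped into itself, the ball has positive and finite measure, as
    comparison with cubes shows, so it can be cancelled from the proportionality.\<close>
  define Y where "Y = {y \<in> space ?M. (\<Sum>i<n. (y i)\<^sup>2) \<le> 1}"
  have Y: "Y \<in> sets ?M" unfolding Y_def by measurable
  have TY: "?T -` Y \<inter> space ?M \<in> sets ?M"
    by (rule measurable_sets[OF _ Y]) measurable
  have "Y \<subseteq> ?T -` Y \<inter> space ?M"
    using contr by (auto simp: Y_def space_PiM intro: order_trans)
  then have YT: "emeasure ?M Y \<le> emeasure ?M (?T -` Y \<inter> space ?M)" using TY by (rule emeasure_mono)
  have "emeasure ?M Y \<noteq> 0"
  proof -
    let ?B = "Pi\<^sub>E {..<n} (\<lambda>_. {0<..<1 / (real n + 1)})"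
    have "?B \<subseteq> Y"
    proof
      fix y assume y: "y \<in> ?B"
      have "(\<Sum>i<n. (y i)\<^sup>2) \<le> (\<Sum>i<n. 1 / (real n + 1))"
      proof (rule sum_mono)
        fix i assume "i \<in> {..<n}"
        then have "0 < y i" "y i < 1 / (real n + 1)" using y by (auto simp: PiE_iff)
        moreover have "1 / (real n + 1) \<le> 1" by simp
        ultimately have "0 \<le> y i" "y i \<le> 1" by linarith+
        then have "(y i)\<^sup>2 \<le> y i" by (simp add: power2_eq_square mult_left_le)
        then show "(y i)\<^sup>2 \<le> 1 / (real n + 1)" using \<open>y i < 1 / (real n + 1)\<close> by linarith
      qed
      also have "\<dots> \<le> 1" by simp
      finally show "y \<in> Y" using y by (auto simp: Y_def space_PiM PiE_iff)
    qed
    then have "emeasure ?M ?B \<le> emeasure ?M Y" using Y by (rule emeasure_mono)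
    moreover have "emeasure ?M ?B = (\<Prod>i<n. ennreal (1 / (real n + 1)))"
      by (subst emeasure_PiM) auto
    moreover have "(\<Prod>i<n. ennreal (1 / (real n + 1))) \<noteq> 0" by auto
    ultimately show ?thesis by auto
  qed
  moreover have "emeasure ?M Y \<noteq> top"
  proof -
    let ?B = "Pi\<^sub>E {..<n} (\<lambda>_. {- 1..1 :: real})"
    have "Y \<subseteq> ?B"
    proof
      fix y assume y: "y \<in> Y"
      have "\<bar>y i\<bar> \<le> 1" if "i < n" for i
      proof -
        have "(y i)\<^sup>2 \<le> (\<Sum>i<n. (y i)\<^sup>2)" using that by (intro member_le_sum) auto
        then have "(y i)\<^sup>2 \<le> 1" using y by (simp add: Y_def)
        then show ?thesis by (simp add: abs_square_le_1)
      qed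
      then show "y \<in> ?B" using y by (auto simp: Y_def space_PiM PiE_iff abs_le_iff)
    qed
    then have "emeasure ?M Y \<le> emeasure ?M ?B" by (rule emeasure_mono) (auto intro: sets_PiM_I_finite)
    moreover have "emeasure ?M ?B = (\<Prod>i<n. ennreal 2)"
      by (subst emeasure_PiM) auto
    moreover have "(\<Prod>i<n. ennreal 2) < top" by (subst prod_ennreal) auto
    ultimately show ?thesis by auto
  qed
  moreover have "emeasure ?M Y * emeasure ?M X \<le> emeasure ?M Y * emeasure ?M (?T -` X \<inter> space ?M)"
    using mult_right_mono[OF YT, of "emeasure ?M X"] linear_preimage_proportional[OF surj X Y]
    by (simp only: mult.commute[of "emeasure ?M Y"] zero_le)
  ultimately show ?thesis by (rule ennreal_mult_le_mult_iff[THEN iffD1])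
qed

section \<open>Dyadic grids and square linear systems\<close>

lemma floor_dyadic_coarsen:
  fixes x y :: real
  assumes "\<lfloor>2 ^ Suc k * x\<rfloor> = \<lfloor>2 ^ Suc k * y\<rfloor>" shows "\<lfloor>2 ^ k * x\<rfloor> = \<lfloor>2 ^ k * y\<rfloor>"
proof -
  have "\<lfloor>2 ^ k * x\<rfloor> = \<lfloor>2 ^ Suc k * x\<rfloor> div 2" for x :: real
    using floor_divide_real_eq_div[of 2 "2 ^ Suc k * x"] by simp
  then show ?thesis using assms by simp
qed

lemma dyadic_cell_iff:
  fixes y :: real
  shows "real_of_int z / 2 ^ k \<le> y \<and> y < (real_of_int z + 1) / 2 ^ k \<longleftrightarrow> \<lfloor>2 ^ k * y\<rfloor> = z"
  by (auto simp: floor_eq_iff field_simps)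

text \<open>Only finite unions are available in the rectangle ring. Boundedness makes the number of
  cells finite, openness lets the cells inside \<open>D\<close> exhaust it, and halving the mesh
  makes the exhaustion increasing. Cells are encoded by integer vectors, so that membership is an
  equation between floors.\<close>

lemma grid_inner_approximation:
  assumes D: "D \<in> sets (lebesgue_on_coords n)"
    and bd: "\<And>y i. y \<in> D \<Longrightarrow> i < n \<Longrightarrow> \<bar>y i\<bar> \<le> R"
    and op: "\<And>y. y \<in> D \<Longrightarrow> \<exists>r>0. \<forall>y'\<in>extensional {..<n}. (\<forall>i<n. \<bar>y' i - y i\<bar> < r) \<longrightarrow> y' \<in> D"
    and c: "c < emeasure (lebesgue_on_coords n) D"
  obtains k and Z :: "(nat \<Rightarrow> int) set" where "finite Z" "Z \<subseteq> extensional {..<n}"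
    "\<And>z y. z \<in> Z \<Longrightarrow> y \<in> extensional {..<n} \<Longrightarrow> (\<And>i. i < n \<Longrightarrow> \<lfloor>2 ^ k * y i\<rfloor> = z i) \<Longrightarrow> y \<in> D"
    "c < ennreal (real (card Z) * (1 / 2 ^ k) ^ n)"
proof -
  let ?M = "lebesgue_on_coords n"
  interpret product_sigma_finite "\<lambda>_::nat. lborel :: real measure" by standard
  define Q where "Q k z = {y :: nat \<Rightarrow> real. y \<in> extensional {..<n} \<and> ( \<forall>i<n. \<lfloor>2 ^ k * y i\<rfloor> = z i)}" for k :: nat and z :: "nat \<Rightarrow> int"
  have Qbox: "Q k z = Pi\<^sub>E {..<n} (\<lambda>i. {real_of_int (z i) / 2 ^ k..<(real_of_int (z i) + 1) / 2 ^ k})" for k z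
    unfolding Q_def PiE_def Pi_def by (auto simp: dyadic_cell_iff[symmetric])
  have Qsets: "Q k z \<in> sets ?M" for k z
    unfolding Qbox by (intro sets_PiM_I_finite) auto
  have Qvol: "emeasure ?M (Q k z) = ennreal ((1 / 2 ^ k) ^ n)" for k z
  proof -
    have "emeasure ?M (Q k z) = (\<Prod>i<n. emeasure lborel {real_of_int (z i) / 2 ^ k..<(real_of_int (z i) + 1) / 2 ^ k})"
      unfolding Qbox by (intro emeasure_PiM) auto
    also have "\<dots> = (\<Prod>i<n. ennreal (1 / 2 ^ k))"
      by (intro prod.cong refl) (simp add: divide_right_mono add_divide_distrib)
    also have "\<dots> = ennreal ((1 / 2 ^ k) ^ n)" by (subst prod_ennreal) auto
    finally show ?thesis .
  qed
  define Z where "Z k = {z \<in> Pi\<^sub>E {..<n} (\<lambda>_. {- \<lceil>2 ^ k * R\<rceil> - 1..\<lceil>2 ^ k * R\<rceil>}). Q k z \<subseteq> D}" for k :: nat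
  have finZ: "finite (Z k)" for k
    unfolding Z_def by (rule finite_subset[of _ "Pi\<^sub>E {..<n} (\<lambda>_. {- \<lceil>2 ^ k * R\<rceil> - 1..\<lceil>2 ^ k * R\<rceil>})"])
      (auto intro: finite_PiE)
  define cell where "cell k y = (\<lambda>i\<in>{..<n}. \<lfloor>2 ^ k * y i\<rfloor>)" for k :: nat and y :: "nat \<Rightarrow> real"
  have Dext: "y \<in> extensional {..<n}" if "y \<in> D" for y
    using sets.sets_into_space[OF D] that by (auto simp: space_PiM PiE_def)
  have yQ: "y \<in> Q k (cell k y)" if "y \<in> D" for y k
    using Dext[OF that] by (simp add: Q_def cell_def)
  have cellZ: "cell k y \<in> Z k" if y: "y \<in> D" and sub: "Q k (cell k y) \<subseteq> D" for k y
  proof -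
    have "\<lfloor>2 ^ k * y i\<rfloor> \<in> {- \<lceil>2 ^ k * R\<rceil> - 1..\<lceil>2 ^ k * R\<rceil>}" if i: "i < n" for i
    proof -
      have "2 ^ k * \<bar>y i\<bar> \<le> 2 ^ k * R" using bd[OF y i] by (intro mult_left_mono) auto
      then have "\<bar>2 ^ k * y i\<bar> \<le> 2 ^ k * R" by (simp add: abs_mult)
      then show ?thesis unfolding atLeastAtMost_iff by linarith
    qed
    then show ?thesis using sub by (auto simp: Z_def cell_def)
  qed
  define DD where "DD k = (\<Union>z\<in>Z k. Q k z)" for k
  have DDsets: "DD k \<in> sets ?M" for k
    unfolding DD_def using finZ Qsets by (intro sets.finite_UN) auto
  have DDD: "DD k \<subseteq> D" for k by (auto simp: DD_def Z_def)
  have "incseq DD"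
  proof (rule incseq_SucI, rule subsetI)
    fix k y assume "y \<in> DD k"
    then obtain z where z: "z \<in> Z k" "y \<in> Q k z" by (auto simp: DD_def)
    then have y: "y \<in> D" by (auto simp: Z_def)
    have "Q (Suc k) (cell (Suc k) y) \<subseteq> Q k z"
    proof
      fix y' assume y': "y' \<in> Q (Suc k) (cell (Suc k) y)"
      have "\<lfloor>2 ^ k * y' i\<rfloor> = z i" if "i < n" for i
      proof -
        have "\<lfloor>2 ^ Suc k * y' i\<rfloor> = \<lfloor>2 ^ Suc k * y i\<rfloor>" using y' that unfolding Q_def cell_def by simp
        then have "\<lfloor>2 ^ k * y' i\<rfloor> = \<lfloor>2 ^ k * y i\<rfloor>" by (rule floor_dyadic_coarsen)
        then show ?thesis using z(2) that unfolding Q_def by simp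
      qed
      then show "y' \<in> Q k z" using y' by (simp add: Q_def)
    qed
    then have "cell (Suc k) y \<in> Z (Suc k)" using z(1) by (intro cellZ[OF y]) (auto simp: Z_def)
    then show "y \<in> DD (Suc k)" using yQ[OF y] by (auto simp: DD_def)
  qed
  moreover have "(\<Union>k. DD k) = D"
  proof (intro equalityI subsetI)
    fix y assume y: "y \<in> D"
    obtain r where r: "r > 0" "\<And>y'. y' \<in> extensional {..<n} \<Longrightarrow> (\<forall>i<n. \<bar>y' i - y i\<bar> < r) \<Longrightarrow> y' \<in> D"
      using op[OF y] by blast
    obtain k where k: "(1 / 2) ^ k < r" using real_arch_pow_inv[OF r(1), of "1 / 2"] by auto
    have "Q k (cell k y) \<subseteq> D"
    proof
      fix y' assume y': "y' \<in> Q k (cell k y)"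
      have "\<bar>y' i - y i\<bar> < r" if "i < n" for i
      proof -
        have "\<lfloor>2 ^ k * y' i\<rfloor> = \<lfloor>2 ^ k * y i\<rfloor>" using y' that by (simp add: Q_def cell_def)
        then have "\<bar>2 ^ k * y' i - 2 ^ k * y i\<bar> < 1" by linarith
        then have "2 ^ k * \<bar>y' i - y i\<bar> < 1" by (simp add: abs_mult right_diff_distrib[symmetric])
        then have "\<bar>y' i - y i\<bar> < (1 / 2) ^ k" by (simp add: field_simps)
        then show ?thesis using k by simp
      qed
      then show "y' \<in> D" using y' by (intro r(2)) (auto simp: Q_def)
    qed
    then have "cell k y \<in> Z k" by (rule cellZ[OF y])
    then show "y \<in> (\<Union>k. DD k)" using yQ[OF y] by (auto simp: DD_def)
  qed (use DDD in auto)
  ultimately have "emeasure ?M D = (SUP k. emeasure ?M (DD k))"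
    using SUP_emeasure_incseq[of DD ?M] DDsets by (metis image_subset_iff)
  then obtain k where k: "c < emeasure ?M (DD k)" using c by (auto simp: less_SUP_iff)
  also have "emeasure ?M (DD k) \<le> (\<Sum>z\<in>Z k. emeasure ?M (Q k z))"
    unfolding DD_def using finZ Qsets by (intro emeasure_subadditive_finite) auto
  also have "\<dots> = ennreal (real (card (Z k)) * (1 / 2 ^ k) ^ n)"
    by (simp add: Qvol ennreal_mult ennreal_of_nat_eq_real_of_nat)
  finally have "c < ennreal (real (card (Z k)) * (1 / 2 ^ k) ^ n)" .
  moreover have "Z k \<subseteq> extensional {..<n}" by (auto simp: Z_def PiE_def)
  moreover have "y \<in> D" if "z \<in> Z k" "y \<in> extensional {..<n}" "\<And>i. i < n \<Longrightarrow> \<lfloor>2 ^ k * y i\<rfloor> = z i" for z y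
    using that by (auto simp: Z_def Q_def)
  ultimately show thesis using that[OF finZ] by blast
qed

text \<open>A dimension count: the rows of \<open>A\<close> become vectors in the span of the first
  \<open>n\<close> members of \<open>f\<close>, injectivity makes them independent, and
  \<open>n\<close> independent vectors fill this span.\<close>

lemma square_system_solvable:
  fixes f :: "nat \<Rightarrow> 'a::{real_inner, complete_space}" and A :: "nat \<Rightarrow> nat \<Rightarrow> real"
  assumes f: "orthonormal_basis f"
    and inj: "\<And>y. (\<And>j. j < n \<Longrightarrow> (\<Sum>i<n. y i * A i j) = 0) \<Longrightarrow> (\<And>i. i < n \<Longrightarrow> y i = 0)"
  shows "\<exists>y. \<forall>j<n. (\<Sum>i<n. y i * A i j) = z j"
proof -
  define g where "g i = (\<Sum>j<n. A i j *\<^sub>R f j)" for i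
  have comb: "(\<Sum>i<n. y i *\<^sub>R g i) = (\<Sum>j<n. (\<Sum>i<n. y i * A i j) *\<^sub>R f j)" for y
    unfolding g_def scaleR_sum_right scaleR_sum_left by (subst sum.swap) simp
  have coord: "(\<Sum>i<n. y i *\<^sub>R g i) \<bullet> f j = (\<Sum>i<n. y i * A i j)" if "j < n" for y j
    unfolding comb using that by (simp add: inner_sum_orthonormal[OF f])
  have zero: "y i = 0" if "(\<Sum>i<n. y i *\<^sub>R g i) = 0" "i < n" for y i
    using coord[of _ y] that by (intro inj[of y i]) auto
  have injg: "inj_on g {..<n}"
  proof (rule inj_onI, rule ccontr)
    fix i k assume ik: "i \<in> {..<n}" "k \<in> {..<n}" "g i = g k" "i \<noteq> k"
    let ?y = "\<lambda>l. if l = i then 1 else if l = k then - 1 else 0 :: real"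
    have "(\<Sum>l<n. ?y l *\<^sub>R g l) = (\<Sum>l\<in>{i, k}. ?y l *\<^sub>R g l)"
      using ik by (intro sum.mono_neutral_right) auto
    also have "\<dots> = 0" using ik by simp
    finally show False using zero[of ?y i] ik by simp
  qed
  have injf: "inj_on f {..<n}"
  proof (rule inj_onI)
    fix i j assume "f i = f j"
    then have "f i \<bullet> f j = 1" using ortho_inner[OF f, of j j] by simp
    then show "i = j" using ortho_inner[OF f, of i j] by (simp split: if_splits)
  qed
  have ind: "independent (g ` {..<n})"
  proof
    assume "dependent (g ` {..<n})"
    then obtain w v where w: "v \<in> g ` {..<n}" "w v \<noteq> 0" "(\<Sum>v\<in>g ` {..<n}. w v *\<^sub>R v) = 0"
      unfolding dependent_finite[OF finite_imageI[OF finite_lessThan]] by blast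
    then have "(\<Sum>i<n. w (g i) *\<^sub>R g i) = 0" using sum.reindex[OF injg, of "\<lambda>v. w v *\<^sub>R v"] by (simp add: o_def)
    then show False using zero[of "\<lambda>i. w (g i)"] w(1,2) by auto
  qed
  have fs: "(\<Sum>j<n. c j *\<^sub>R f j) \<in> span (f ` {..<n})" for c
    by (rule span_sum, rule span_scale, rule span_base) simp
  then have sub: "g ` {..<n} \<subseteq> span (f ` {..<n})" unfolding g_def by blast
  have span: "f j \<in> span (g ` {..<n})" if "j < n" for j
  proof (rule ccontr)
    assume out: "f j \<notin> span (g ` {..<n})"
    then have "f j \<notin> g ` {..<n}" by (metis span_base)
    moreover have "independent (insert (f j) (g ` {..<n}))" using ind out by (rule independent_insertI[rotated])
    moreover have "insert (f j) (g ` {..<n}) \<subseteq> span (f ` {..<n})"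
      using sub that by (auto intro: span_base)
    ultimately have "card (insert (f j) (g ` {..<n})) \<le> card (f ` {..<n})"
      using real_vector.independent_span_bound[of "f ` {..<n}"] by blast
    then show False using \<open>f j \<notin> g ` {..<n}\<close> by (simp add: card_image injg injf)
  qed
  have "(\<Sum>j<n. z j *\<^sub>R f j) \<in> span (g ` {..<n})"
    by (rule span_sum, rule span_scale, rule span) simp
  then obtain w where w: "(\<Sum>j<n. z j *\<^sub>R f j) = (\<Sum>v\<in>g ` {..<n}. w v *\<^sub>R v)"
    unfolding span_finite[OF finite_imageI[OF finite_lessThan]] by blast
  have "(\<Sum>j<n. z j *\<^sub>R f j) = (\<Sum>i<n. w (g i) *\<^sub>R g i)"
    unfolding w using sum.reindex[OF injg, of "\<lambda>v. w v *\<^sub>R v"] by (simp add: o_def)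
  then have "(\<Sum>i<n. w (g i) * A i j) = z j" if "j < n" for j
    using coord[OF that, of "\<lambda>i. w (g i)"] inner_sum_orthonormal[OF f, of "{..<n}" z j] that by simp
  then show ?thesis by (intro exI[of _ "\<lambda>i. w (g i)"]) simp
qed

section \<open>Comparison of matched bases\<close>

text \<open>For nonnegative terms, square partial sums are as good as any others. The third claim
  controls everything outside an \<open>n\<close> by \<open>n\<close> block at once, whether the row
  or the column index is large.\<close>

lemma square_bounded_double_series:
  fixes d :: "nat \<Rightarrow> nat \<Rightarrow> real"
  assumes d0: "\<And>i j. 0 \<le> d i j" and T: "\<And>m. (\<Sum>i<m. \<Sum>j<m. d i j) \<le> T"
  shows "summable (\<lambda>i. d i j)" and "summable (\<lambda>j. \<Sum>i. d i j)"
    and "(\<lambda>n. \<Sum>j<n. \<Sum>i<n. d i j) \<longlonglongrightarrow> (\<Sum>j. \<Sum>i. d i j)"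
proof -
  have part: "(\<Sum>j<k. \<Sum>i<m. d i j) \<le> T" for k m
  proof -
    let ?n = "max k m"
    have "(\<Sum>j<k. \<Sum>i<m. d i j) \<le> (\<Sum>j<k. \<Sum>i<?n. d i j)"
      by (intro sum_mono sum_mono2) (auto simp: d0)
    also have "\<dots> \<le> (\<Sum>j<?n. \<Sum>i<?n. d i j)" by (intro sum_mono2 sum_nonneg d0) auto
    also have "\<dots> \<le> T" using T[of ?n] by (subst sum.swap) simp
    finally show ?thesis .
  qed
  show sm: "summable (\<lambda>i. d i j)" for j
  proof (rule summableI_nonneg_bounded[OF d0])
    fix m
    have "(\<Sum>i<m. d i j) \<le> (\<Sum>j<Suc j. \<Sum>i<m. d i j)" by (intro member_le_sum sum_nonneg d0) auto
    then show "(\<Sum>i<m. d i j) \<le> T" using part[of m "Suc j"] by linarith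
  qed
  have lim: "(\<lambda>m. \<Sum>j<k. \<Sum>i<m. d i j) \<longlonglongrightarrow> (\<Sum>j<k. \<Sum>i. d i j)" for k
    by (intro tendsto_sum summable_LIMSEQ sm)
  have c0: "0 \<le> (\<Sum>i. d i j)" for j by (intro suminf_nonneg sm d0)
  show sm2: "summable (\<lambda>j. \<Sum>i. d i j)"
    by (rule summableI_nonneg_bounded[OF c0], rule LIMSEQ_le_const2[OF lim]) (use part in blast)
  let ?sq = "\<lambda>n. \<Sum>j<n. \<Sum>i<n. d i j" and ?t = "\<Sum>j. \<Sum>i. d i j"
  have up: "?sq n \<le> ?t" for n
  proof -
    have "?sq n \<le> (\<Sum>j<n. \<Sum>i. d i j)" by (intro sum_mono sum_le_suminf sm d0) auto
    also have "\<dots> \<le> ?t" by (intro sum_le_suminf sm2 c0) auto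
    finally show ?thesis .
  qed
  show "?sq \<longlonglongrightarrow> ?t"
  proof (rule LIMSEQ_I)
    fix r :: real assume "0 < r"
    have "\<forall>\<^sub>F k in sequentially. ?t - r / 2 < (\<Sum>j<k. \<Sum>i. d i j)"
      using \<open>0 < r\<close> by (intro order_tendstoD(1)[OF summable_LIMSEQ[OF sm2]]) simp
    then obtain k where k: "?t - r / 2 < (\<Sum>j<k. \<Sum>i. d i j)" unfolding eventually_sequentially by blast
    have "\<forall>\<^sub>F m in sequentially. (\<Sum>j<k. \<Sum>i. d i j) - r / 2 < (\<Sum>j<k. \<Sum>i<m. d i j)"
      using \<open>0 < r\<close> by (intro order_tendstoD(1)[OF lim]) simp
    then obtain m where m: "(\<Sum>j<k. \<Sum>i. d i j) - r / 2 < (\<Sum>j<k. \<Sum>i<m. d i j)"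
      unfolding eventually_sequentially by blast
    have "norm (?sq n - ?t) < r" if n: "n \<ge> max k m" for n
    proof -
      have "(\<Sum>j<k. \<Sum>i<m. d i j) \<le> (\<Sum>j<k. \<Sum>i<n. d i j)"
        using n by (intro sum_mono sum_mono2) (auto simp: d0)
      also have "\<dots> \<le> ?sq n" using n by (intro sum_mono2 sum_nonneg d0) auto
      finally show ?thesis using k m up[of n] unfolding real_norm_def abs_less_iff by linarith
    qed
    then show "\<exists>no. \<forall>n\<ge>no. norm (?sq n - ?t) < r" by blast
  qed
qed

lemma off_diagonal_swap:
  fixes e f :: "nat \<Rightarrow> 'a::real_inner"
  shows "(\<Sum>i<m. \<Sum>j<m. off_diagonal f e i j) = (\<Sum>i<m. \<Sum>j<m. off_diagonal e f i j)"
proof -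
  have "off_diagonal f e i j = off_diagonal e f j i" for i j by (simp add: inner_commute)
  then have "(\<Sum>i<m. \<Sum>j<m. off_diagonal f e i j) = (\<Sum>i<m. \<Sum>j<m. off_diagonal e f j i)"
    by (intro sum.cong refl)
  also have "\<dots> = (\<Sum>j<m. \<Sum>i<m. off_diagonal e f j i)" by (rule sum.swap)
  finally show ?thesis .
qed

text \<open>A sup bound on coordinates meets an absolute sum of entries. Every discarded index
  differs from \<open>j \<in> I\<close>, so only off-diagonal entries enter.\<close>

lemma coordinate_expansion_error:
  fixes e f :: "nat \<Rightarrow> 'a::{real_inner, complete_space}"
  assumes e: "orthonormal_basis e" and f: "orthonormal_basis f"
    and sm: "summable (\<lambda>i. off_diagonal e f i j)"
    and R: "\<And>i. \<bar>x \<bullet> e i\<bar> \<le> R" and "finite I" and \<theta>: "\<theta> = (\<Sum>i. off_diagonal e f i j) - (\<Sum>i\<in>I. off_diagonal e f i j)"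
    and "j \<in> I"
  shows "\<bar>x \<bullet> f j - (\<Sum>i\<in>I. (x \<bullet> e i) * (e i \<bullet> f j))\<bar> \<le> R * \<theta>"
proof -
  let ?g = "\<lambda>i. (x \<bullet> e i) * (e i \<bullet> f j)" and ?d = "\<lambda>i. off_diagonal e f i j"
  have R0: "0 \<le> R" using R[of 0] by linarith
  have "?g sums (x \<bullet> f j)" using parseval[OF e, of x "f j"] by (simp add: inner_commute)
  then have "(\<lambda>i. ?g i - (if i \<in> I then ?g i else 0)) sums (x \<bullet> f j - (\<Sum>i\<in>I. ?g i))"
    by (intro sums_diff sums_If_finite_set \<open>finite I\<close>)
  moreover have "(\<lambda>i. ?g i - (if i \<in> I then ?g i else 0)) = (\<lambda>i. if i \<in> I then 0 else ?g i)" by auto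
  ultimately have g: "(\<lambda>i. if i \<in> I then 0 else ?g i) sums (x \<bullet> f j - (\<Sum>i\<in>I. ?g i))" by simp
  have "(\<lambda>i. ?d i - (if i \<in> I then ?d i else 0)) sums \<theta>"
    unfolding \<theta> by (intro sums_diff sums_If_finite_set \<open>finite I\<close> summable_sums sm)
  then have d: "(\<lambda>i. R * (?d i - (if i \<in> I then ?d i else 0))) sums (R * \<theta>)" by (rule sums_mult)
  have le: "\<bar>if i \<in> I then 0 else ?g i\<bar> \<le> R * (?d i - (if i \<in> I then ?d i else 0))" for i
  proof (cases "i \<in> I")
    case False
    then have "i \<noteq> j" using \<open>j \<in> I\<close> by auto
    then show ?thesis using False R[of i] by (simp add: abs_mult mult_right_mono)
  qed simp
  have "\<bar>\<Sum>i. if i \<in> I then 0 else ?g i\<bar> \<le> (\<Sum>i. R * (?d i - (if i \<in> I then ?d i else 0)))"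
  proof -
    have sma: "summable (\<lambda>i. \<bar>if i \<in> I then 0 else ?g i\<bar>)"
      by (rule summable_comparison_test'[OF sums_summable[OF d], of 0]) (use le in auto)
    have "\<bar>\<Sum>i. if i \<in> I then 0 else ?g i\<bar> \<le> (\<Sum>i. \<bar>if i \<in> I then 0 else ?g i\<bar>)"
      by (rule summable_rabs[OF sma])
    also have "\<dots> \<le> (\<Sum>i. R * (?d i - (if i \<in> I then ?d i else 0)))"
      by (rule suminf_le[OF le sma sums_summable[OF d]])
    finally show ?thesis .
  qed
  then show ?thesis using g d by (simp add: sums_iff)
qed

text \<open>One error comes from the discarded coordinates, the other from replacing
  \<open>e j \<bullet> f j\<close> by its sign. The latter is at most
  \<open>1 - (e j \<bullet> f j)\<^sup>2\<close>, the sum of the other squares in the column; hence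
  the factor 2.\<close>

lemma matched_coordinate_error:
  fixes e f :: "nat \<Rightarrow> 'a::{real_inner, complete_space}"
  assumes e: "orthonormal_basis e" and f: "orthonormal_basis f"
    and sm: "summable (\<lambda>i. off_diagonal e f i j)"
    and R: "\<And>i. \<bar>x \<bullet> e i\<bar> \<le> R"
  shows "\<bar>x \<bullet> f j - (if 0 \<le> e j \<bullet> f j then 1 else - 1) * (x \<bullet> e j)\<bar> \<le> 2 * R * (\<Sum>i. off_diagonal e f i j)"
proof -
  let ?d = "\<lambda>i. off_diagonal e f i j" and ?u = "e j \<bullet> f j"
  let ?s = "if 0 \<le> ?u then 1 else - 1 :: real"
  have R0: "0 \<le> R" using R[of 0] by linarith
  have 1: "\<bar>x \<bullet> f j - (x \<bullet> e j) * ?u\<bar> \<le> R * (\<Sum>i. ?d i)"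
    using coordinate_expansion_error[OF e f sm R, of "{j}"] by simp
  have "1 - \<bar>?u\<bar> \<le> (\<Sum>i. ?d i)"
  proof -
    have "(\<lambda>i. (e i \<bullet> f j)\<^sup>2 - (if i = j then (e i \<bullet> f j)\<^sup>2 else 0)) sums (1 - ?u\<^sup>2)"
      by (intro sums_diff basis_parseval(1)[OF e f] sums_single)
    then have s: "(\<lambda>i. (e i \<bullet> f j)\<^sup>2 - (if i = j then (e i \<bullet> f j)\<^sup>2 else 0)) sums (1 - ?u\<^sup>2)" .
    have "(\<Sum>i. (e i \<bullet> f j)\<^sup>2 - (if i = j then (e i \<bullet> f j)\<^sup>2 else 0)) \<le> (\<Sum>i. ?d i)"
      by (rule suminf_le[OF _ sums_summable[OF s] sm])
        (use square_le_abs[OF basis_inner_le_1[OF e f]] in auto)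
    then have "1 - ?u\<^sup>2 \<le> (\<Sum>i. ?d i)" using s by (simp add: sums_iff)
    then show ?thesis using square_le_abs[OF basis_inner_le_1[OF e f], of j j] by linarith
  qed
  then have "\<bar>?u - ?s\<bar> \<le> (\<Sum>i. ?d i)"
    using basis_inner_le_1[OF e f, of j j] by (auto simp: abs_if split: if_splits)
  then have "\<bar>x \<bullet> e j\<bar> * \<bar>?u - ?s\<bar> \<le> R * (\<Sum>i. ?d i)" by (intro mult_mono R R0) auto
  then have 2: "\<bar>(x \<bullet> e j) * ?u - ?s * (x \<bullet> e j)\<bar> \<le> R * (\<Sum>i. ?d i)"
    unfolding abs_mult[symmetric] by (simp only: right_diff_distrib mult.commute[of ?s])
  have "\<bar>x \<bullet> f j - ?s * (x \<bullet> e j)\<bar> \<le> \<bar>x \<bullet> f j - (x \<bullet> e j) * ?u\<bar> + \<bar>(x \<bullet> e j) * ?u - ?s * (x \<bullet> e j)\<bar>"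
    using abs_triangle_ineq[of "x \<bullet> f j - (x \<bullet> e j) * ?u" "(x \<bullet> e j) * ?u - ?s * (x \<bullet> e j)"] by simp
  then show ?thesis using add_mono[OF 1 2] by simp
qed

section \<open>Approximating rectangles of one basis by those of a matched basis\<close>

lemma rectangle_bounds_uniform:
  assumes "rectangle_bounds e a b"
  obtains M where "0 \<le> M" "\<And>j. \<bar>a j\<bar> \<le> M" "\<And>j. \<bar>b j\<bar> \<le> M"
proof -
  obtain A where A: "\<And>j. \<bar>a j\<bar> \<le> A" using assms by (auto simp: rectangle_bounds_def bounded_iff)
  obtain B where B: "\<And>j. \<bar>b j\<bar> \<le> B" using assms by (auto simp: rectangle_bounds_def bounded_iff)
  have "0 \<le> max A B" using A[of 0] by linarith
  then show thesis using A B by (intro that[of "max A B"]) (auto simp: le_max_iff_disj)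
qed

lemma matched_rectangle_hull:
  fixes e f :: "nat \<Rightarrow> 'a::{real_inner, complete_space}"
  assumes e: "orthonormal_basis e" and f: "orthonormal_basis f"
    and T: "\<And>m. (\<Sum>i<m. \<Sum>j<m. off_diagonal e f i j) \<le> T"
    and \<alpha>\<beta>: "rectangle_bounds f \<alpha> \<beta>"
  shows "\<exists>a b. rectangle_bounds e a b \<and> rectangle f \<alpha> \<beta> \<subseteq> rectangle e a b"
proof -
  define r where "r j = (\<Sum>i. off_diagonal f e i j)" for j
  have T': "(\<Sum>i<m. \<Sum>j<m. off_diagonal f e i j) \<le> T" for m using T off_diagonal_swap[of f e m] by simp
  have sm: "summable (\<lambda>i. off_diagonal f e i j)" for j
    by (rule square_bounded_double_series(1)[of "off_diagonal f e", OF _ T']) simp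
  have smr: "summable r"
    unfolding r_def by (rule square_bounded_double_series(2)[of "off_diagonal f e", OF _ T']) simp
  have r0: "0 \<le> r j" for j unfolding r_def by (intro suminf_nonneg sm) auto
  obtain M where M: "0 \<le> M" "\<And>j. \<bar>\<alpha> j\<bar> \<le> M" "\<And>j. \<bar>\<beta> j\<bar> \<le> M" by (rule rectangle_bounds_uniform[OF \<alpha>\<beta>]) blast
  define s where "s j = (if 0 \<le> f j \<bullet> e j then 1 else - 1 :: real)" for j
  \<comment> \<open>A negative diagonal entry reflects the interval: \<open>[p j, q j]\<close> is
    \<open>[\<alpha> j, \<beta> j]\<close> multiplied by \<open>s j\<close>.\<close>
  define p where "p j = (if 0 \<le> f j \<bullet> e j then \<alpha> j else - \<beta> j)" for j
  define q where "q j = (if 0 \<le> f j \<bullet> e j then \<beta> j else - \<alpha> j)" for j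
  \<comment> \<open>The first term is the coordinate error. The geometric term makes the margin
    strict, as half-open intervals require, and keeps it summable.\<close>
  define \<rho> where "\<rho> j = 2 * M * r j + (1 / 2) ^ j" for j
  have sm\<rho>: "summable \<rho>" unfolding \<rho>_def by (intro summable_add summable_mult smr summable_geometric) simp
  have \<rho>0: "0 < \<rho> j" for j unfolding \<rho>_def using M(1) r0[of j] by (simp add: add_nonneg_pos)
  have len: "q j - p j = \<beta> j - \<alpha> j" for j by (simp add: p_def q_def)
  have lpos: "\<alpha> j < \<beta> j" for j by (rule rectangle_bounds_less[OF \<alpha>\<beta>])
  have sub: "rectangle f \<alpha> \<beta> \<subseteq> rectangle e (\<lambda>j. p j - \<rho> j) (\<lambda>j. q j + \<rho> j)"
  proof
    fix x assume x: "x \<in> rectangle f \<alpha> \<beta>"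
    then have xj: "\<alpha> j \<le> x \<bullet> f j" "x \<bullet> f j < \<beta> j" for j by (auto simp: in_rectangle)
    have xM: "\<bar>x \<bullet> f j\<bar> \<le> M" for j using xj[of j] M(2,3)[of j] by linarith
    have "p j - \<rho> j \<le> x \<bullet> e j \<and> x \<bullet> e j < q j + \<rho> j" for j
    proof -
      have "\<bar>x \<bullet> e j - s j * (x \<bullet> f j)\<bar> \<le> 2 * M * r j"
        unfolding s_def r_def by (rule matched_coordinate_error[OF f e sm xM])
      also have "\<dots> < \<rho> j" by (simp add: \<rho>_def)
      finally have *: "\<bar>x \<bullet> e j - s j * (x \<bullet> f j)\<bar> < \<rho> j" .
      have "p j \<le> s j * (x \<bullet> f j)" "s j * (x \<bullet> f j) \<le> q j"
        using xj[of j] by (auto simp: p_def q_def s_def)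
      then show ?thesis using * by linarith
    qed
    then show "x \<in> rectangle e (\<lambda>j. p j - \<rho> j) (\<lambda>j. q j + \<rho> j)" by (simp add: in_rectangle)
  qed
  moreover have "rectangle_bounds e (\<lambda>j. p j - \<rho> j) (\<lambda>j. q j + \<rho> j)"
    unfolding rectangle_bounds_def
  proof (intro conjI)
    show "rectangle e (\<lambda>j. p j - \<rho> j) (\<lambda>j. q j + \<rho> j) \<noteq> {}"
      using \<alpha>\<beta> sub by (auto simp: rectangle_bounds_def)
    obtain P where P: "\<And>j. \<bar>\<rho> j\<bar> \<le> P"
      using summable_imp_bounded[OF sm\<rho>] by (auto simp: bounded_iff)
    have "\<bar>p j - \<rho> j\<bar> \<le> M + P" "\<bar>q j + \<rho> j\<bar> \<le> M + P" for j
      using M(2,3)[of j] P[of j] by (auto simp: p_def q_def)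
    then show "bounded (range (\<lambda>j. p j - \<rho> j))" "bounded (range (\<lambda>j. q j + \<rho> j))"
      unfolding bounded_iff by auto
    show "summable (\<lambda>j. max 0 (ln (q j + \<rho> j - (p j - \<rho> j))))"
    proof (rule summable_comparison_test')
      \<comment> \<open>The sides grow by \<open>2 * \<rho> j\<close>. The bound
        \<open>ln t \<le> t - 1\<close> makes this an additive error, and the excess of the old side
        over 1 is bounded by its logarithm again, with constant \<open>2 * M + 1\<close> since sides
        are at most that long.\<close>
      show "summable (\<lambda>j. (2 * M + 1) * max 0 (ln (\<beta> j - \<alpha> j)) + 2 * \<rho> j)"
        using \<alpha>\<beta> by (intro summable_add summable_mult sm\<rho>) (simp add: rectangle_bounds_def)
      fix j
      let ?L = "\<beta> j - \<alpha> j"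
      have L: "0 < ?L" "?L \<le> 2 * M + 1" using lpos[of j] M(2,3)[of j] by auto
      have "q j + \<rho> j - (p j - \<rho> j) = ?L + 2 * \<rho> j" using len[of j] by simp
      then have "ln (q j + \<rho> j - (p j - \<rho> j)) = ln (?L + 2 * \<rho> j)" by (rule arg_cong)
      also have "\<dots> \<le> ?L + 2 * \<rho> j - 1" using L(1) \<rho>0[of j] by (intro ln_le_minus_one) auto
      finally have 1: "ln (q j + \<rho> j - (p j - \<rho> j)) \<le> ?L - 1 + 2 * \<rho> j" by simp
      have 2: "?L - 1 \<le> (2 * M + 1) * max 0 (ln ?L)"
      proof (cases "1 \<le> ?L")
        case True
        then have "?L - 1 \<le> (2 * M + 1) * \<bar>ln ?L\<bar>"
          using abs_minus_1_le_ln[OF L] M(1) by simp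
        then show ?thesis using True by simp
      next
        case False
        have "0 \<le> (2 * M + 1) * max 0 (ln ?L)" using M(1) by (intro mult_nonneg_nonneg) auto
        then show ?thesis using False by linarith
      qed
      have "0 \<le> (2 * M + 1) * max 0 (ln ?L)" using M(1) by (intro mult_nonneg_nonneg) auto
      then show "norm (max 0 (ln (q j + \<rho> j - (p j - \<rho> j)))) \<le> (2 * M + 1) * max 0 (ln ?L) + 2 * \<rho> j"
        using 1 2 \<rho>0[of j] by simp
    qed
  qed
  ultimately show ?thesis by blast
qed

lemma rectangle_bounds_finite_change:
  assumes e: "orthonormal_basis e" and ab: "rectangle_bounds e a b"
    and eq: "\<And>j. j \<ge> n \<Longrightarrow> a' j = a j \<and> b' j = b j" and less: "\<And>j. j < n \<Longrightarrow> a' j < b' j"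
  shows "rectangle_bounds e a' b'"
  unfolding rectangle_bounds_def
proof (intro conjI)
  obtain x where x: "x \<in> rectangle e a b" using ab by (auto simp: rectangle_bounds_def)
  obtain y where y: "\<And>i. y \<bullet> e i = (if i \<in> {..<n} then a' i else x \<bullet> e i)"
    using coordinate_update[OF e finite_lessThan[of n], of a' x] by blast
  have "y \<in> rectangle e a' b'" using x eq less unfolding in_rectangle y by (auto simp: not_less)
  then show "rectangle e a' b' \<noteq> {}" by blast
  have bd: "bounded (range c')" if "bounded (range c)" "\<And>j. j \<ge> n \<Longrightarrow> c' j = c j" for c c' :: "nat \<Rightarrow> real"
  proof (rule bounded_subset)
    show "bounded (range c \<union> c' ` {..<n})" using that(1) by (simp add: finite_imp_bounded)
    show "range c' \<subseteq> range c \<union> c' ` {..<n}"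
    proof (rule image_subsetI)
      fix j show "c' j \<in> range c \<union> c' ` {..<n}" using that(2)[of j] by (cases "j < n") auto
    qed
  qed
  show "bounded (range a')" "bounded (range b')"
    using bd[of a a'] bd[of b b'] ab eq by (auto simp: rectangle_bounds_def)
  have "\<forall>\<^sub>F j in sequentially. max 0 (ln (b' j - a' j)) = max 0 (ln (b j - a j))"
    unfolding eventually_sequentially using eq by (intro exI[of _ n]) simp
  then show "summable (\<lambda>j. max 0 (ln (b' j - a' j)))"
    using ab summable_cong by (fastforce simp: rectangle_bounds_def)
qed

text \<open>The Weierstrass product inequality; it converts summed relative losses of length into a
  lower bound for the volume.\<close>

lemma prod_one_minus_ge:
  fixes x :: "nat \<Rightarrow> real"
  assumes "\<And>j. 0 \<le> x j" "\<And>j. x j \<le> 1"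
  shows "1 - (\<Sum>j<m. x j) \<le> (\<Prod>j<m. 1 - x j)"
proof (induction m)
  case (Suc m)
  have "0 \<le> (\<Sum>j<m. x j)" by (intro sum_nonneg assms(1))
  then have "0 \<le> (\<Sum>j<m. x j) * x m" using assms(1)[of m] by simp
  then have "1 - (\<Sum>j<Suc m. x j) \<le> (1 - (\<Sum>j<m. x j)) * (1 - x m)"
    by (simp add: algebra_simps)
  also have "\<dots> \<le> (\<Prod>j<m. 1 - x j) * (1 - x m)"
    using assms(2)[of m] by (intro mult_right_mono Suc.IH) simp
  finally show ?case by simp
qed simp

text \<open>
  Here \<open>\<bar>y i\<bar>\<close> is compared with the coordinates \<open>\<Sum>i<n. y i * (e i \<bullet> f j)\<close>, \<open>j < n\<close>, of
  \<open>\<Sum>i<n. y i *\<^sub>R e i\<close>; the remaining coordinates are absorbed because the tail of the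
  off-diagonal sum is at most one half.
\<close>

lemma matched_block_bound:
  fixes e f :: "nat \<Rightarrow> 'a::{real_inner, complete_space}"
  assumes e: "orthonormal_basis e" and f: "orthonormal_basis f"
    and T: "\<And>m. (\<Sum>i<m. \<Sum>j<m. off_diagonal e f i j) \<le> T"
    and tail: "(\<Sum>j. \<Sum>i. off_diagonal e f i j) - (\<Sum>j<n. \<Sum>i. off_diagonal e f i j) \<le> 1 / 2"
    and M: "\<And>j. j < n \<Longrightarrow> \<bar>\<Sum>i<n. y i * (e i \<bullet> f j)\<bar> \<le> M" and "0 \<le> M" and "i < n"
  shows "\<bar>y i\<bar> \<le> 2 * M * (1 + T)"
proof -
  let ?d = "off_diagonal e f"
  define col where "col j = (\<Sum>i. ?d i j)" for j
  have d0: "0 \<le> ?d i j" for i j by simp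
  note D = square_bounded_double_series[of ?d, OF d0 T]
  have col0: "0 \<le> col j" for j unfolding col_def by (intro suminf_nonneg D(1) d0)
  have smcol: "summable col" unfolding col_def by (rule D(2))
  \<comment> \<open>A self-improving estimate: coordinates beyond \<open>n\<close> are bounded by
    \<open>Y\<close> times column sums whose tail is at most 1/2, so
    \<open>Y \<le> M * (1 + T) + Y / 2\<close>.\<close>
  define Y where "Y = Max ((\<lambda>i. \<bar>y i\<bar>) ` {..<n})"
  have Yge: "\<bar>y i\<bar> \<le> Y" if "i < n" for i unfolding Y_def using that by (intro Max_ge) auto
  have "Y \<in> (\<lambda>i. \<bar>y i\<bar>) ` {..<n}" unfolding Y_def using \<open>i < n\<close> by (intro Max_in) auto
  then obtain k where k: "k < n" "Y = \<bar>y k\<bar>" by auto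
  have Y0: "0 \<le> Y" using k(2) by simp
  define v where "v = (\<Sum>i<n. y i *\<^sub>R e i)"
  have vf: "v \<bullet> f j = (\<Sum>i<n. y i * (e i \<bullet> f j))" for j by (simp add: v_def inner_sum_left)
  have "v \<bullet> e k = y k" using k(1) by (simp add: v_def inner_sum_orthonormal[OF e])
  then have s: "(\<lambda>j. (v \<bullet> f j) * (e k \<bullet> f j)) sums y k" using parseval[OF f, of v "e k"] by simp
  define b where "b j = (if j < n then M * \<bar>e k \<bullet> f j\<bar> else Y * col j)" for j
  have le: "\<bar>(v \<bullet> f j) * (e k \<bullet> f j)\<bar> \<le> b j" for j
  proof (cases "j < n")
    case True
    then show ?thesis using M[OF True] by (simp add: b_def vf abs_mult mult_right_mono)
  next
    case False
    have "\<bar>v \<bullet> f j\<bar> \<le> (\<Sum>i<n. \<bar>y i * (e i \<bullet> f j)\<bar>)" unfolding vf by (rule sum_abs)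
    also have "\<dots> \<le> (\<Sum>i<n. Y * ?d i j)"
      using False Yge by (intro sum_mono) (auto simp: abs_mult intro!: mult_right_mono)
    also have "\<dots> = Y * (\<Sum>i<n. ?d i j)" by (simp only: sum_distrib_left)
    also have "\<dots> \<le> Y * col j" unfolding col_def using Y0 by (intro mult_left_mono sum_le_suminf D(1) d0) auto
    finally have "\<bar>v \<bullet> f j\<bar> * \<bar>e k \<bullet> f j\<bar> \<le> (Y * col j) * 1"
      using Y0 col0 basis_inner_le_1[OF e f] by (intro mult_mono) auto
    then show ?thesis using False by (simp add: b_def abs_mult)
  qed
  have bs: "b sums ((\<Sum>j<n. M * \<bar>e k \<bullet> f j\<bar>) + Y * (suminf col - (\<Sum>j<n. col j)))"
  proof -
    have "(\<lambda>j. (if j \<in> {..<n} then M * \<bar>e k \<bullet> f j\<bar> else 0) + Y * (col j - (if j \<in> {..<n} then col j else 0))) sums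
        ((\<Sum>j<n. M * \<bar>e k \<bullet> f j\<bar>) + Y * (suminf col - (\<Sum>j<n. col j)))"
      by (intro sums_add sums_mult sums_diff sums_If_finite_set summable_sums smcol finite_lessThan)
    moreover have "(\<lambda>j. (if j \<in> {..<n} then M * \<bar>e k \<bullet> f j\<bar> else 0) + Y * (col j - (if j \<in> {..<n} then col j else 0))) = b"
      by (auto simp: b_def)
    ultimately show ?thesis by simp
  qed
  have "\<bar>y k\<bar> \<le> suminf b"
  proof -
    have sma: "summable (\<lambda>j. \<bar>(v \<bullet> f j) * (e k \<bullet> f j)\<bar>)"
      by (rule summable_comparison_test'[OF sums_summable[OF bs], of 0]) (use le in auto)
    have "\<bar>y k\<bar> = \<bar>\<Sum>j. (v \<bullet> f j) * (e k \<bullet> f j)\<bar>" using s by (simp add: sums_iff)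
    also have "\<dots> \<le> (\<Sum>j. \<bar>(v \<bullet> f j) * (e k \<bullet> f j)\<bar>)" by (rule summable_rabs[OF sma])
    also have "\<dots> \<le> suminf b" by (rule suminf_le[OF le sma sums_summable[OF bs]])
    finally show ?thesis .
  qed
  moreover have "suminf b = M * (\<Sum>j<n. \<bar>e k \<bullet> f j\<bar>) + Y * (suminf col - (\<Sum>j<n. col j))"
    using bs by (simp add: sums_iff sum_distrib_left)
  moreover have "(\<Sum>j<n. \<bar>e k \<bullet> f j\<bar>) \<le> 1 + T"
  proof -
    have "(\<Sum>j<n. \<bar>e k \<bullet> f j\<bar>) = \<bar>e k \<bullet> f k\<bar> + (\<Sum>j\<in>{..<n} - {k}. \<bar>e k \<bullet> f j\<bar>)"
      using k(1) by (intro sum.remove) auto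
    also have "(\<Sum>j\<in>{..<n} - {k}. \<bar>e k \<bullet> f j\<bar>) = (\<Sum>j<n. ?d k j)"
      by (rule sum.mono_neutral_cong_left) auto
    also have "\<bar>e k \<bullet> f k\<bar> + \<dots> \<le> 1 + (\<Sum>i<n. \<Sum>j<n. ?d i j)"
      using k(1) by (intro add_mono basis_inner_le_1[OF e f] member_le_sum sum_nonneg) auto
    finally show ?thesis using T[of n] by linarith
  qed
  then have "M * (\<Sum>j<n. \<bar>e k \<bullet> f j\<bar>) \<le> M * (1 + T)" using \<open>0 \<le> M\<close> by (rule mult_left_mono)
  moreover have "Y * (suminf col - (\<Sum>j<n. col j)) \<le> Y * (1 / 2)"
    using tail Y0 unfolding col_def by (intro mult_left_mono)
  ultimately have "Y \<le> M * (1 + T) + Y * (1 / 2)" using k(2) by linarith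
  then show ?thesis using Yge[OF \<open>i < n\<close>] by linarith
qed

lemma basis_block_contraction:
  fixes e f :: "nat \<Rightarrow> 'a::{real_inner, complete_space}"
  assumes e: "orthonormal_basis e" and f: "orthonormal_basis f"
  shows "(\<Sum>j<n. (\<Sum>i<n. y i * (e i \<bullet> f j))\<^sup>2) \<le> (\<Sum>i<n. (y i)\<^sup>2)"
  using bessel[OF f finite_lessThan[of n], of "\<Sum>i<n. y i *\<^sub>R e i"]
  unfolding norm_sum_orthonormal[OF e finite_lessThan] by (simp add: inner_sum_left)

text \<open>The cells fill the preimage of the box under the block up to a prescribed volume. The
  sup bound on \<open>y\<close> is part of the conclusion because the later coordinate errors are
  proportional to it.\<close>

lemma matched_block_grid:
  fixes e f :: "nat \<Rightarrow> 'a::{real_inner, complete_space}"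
  assumes e: "orthonormal_basis e" and f: "orthonormal_basis f"
    and T: "\<And>m. (\<Sum>i<m. \<Sum>j<m. off_diagonal e f i j) \<le> T"
    and tail: "(\<Sum>j. \<Sum>i. off_diagonal e f i j) - (\<Sum>j<n. \<Sum>i. off_diagonal e f i j) \<le> 1 / 2"
    and lo: "\<And>j. j < n \<Longrightarrow> lo j < hi j" and M: "\<And>j. \<bar>lo j\<bar> \<le> M" "\<And>j. \<bar>hi j\<bar> \<le> M" "0 \<le> M"
    and c: "c < (\<Prod>j<n. hi j - lo j)" "0 \<le> c"
  obtains k and Z :: "(nat \<Rightarrow> int) set" where "finite Z" "Z \<subseteq> extensional {..<n}"
    "\<And>z y. z \<in> Z \<Longrightarrow> \<forall>i<n. \<lfloor>2 ^ k * y i\<rfloor> = z i \<Longrightarrow> (\<forall>i<n. \<bar>y i\<bar> \<le> 2 * M * (1 + T)) \<and>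
       (\<forall>j<n. lo j < (\<Sum>i<n. y i * (e i \<bullet> f j)) \<and> (\<Sum>i<n. y i * (e i \<bullet> f j)) < hi j)"
    "c < real (card Z) * (1 / 2 ^ k) ^ n"
proof -
  let ?M = "lebesgue_on_coords n"
  interpret product_sigma_finite "\<lambda>_::nat. lborel :: real measure" by standard
  let ?t = "\<lambda>y j. \<Sum>i<n. y i * (e i \<bullet> f j)"
  let ?T = "\<lambda>y. \<lambda>j\<in>{..<n}. ?t y j"
  let ?X = "Pi\<^sub>E {..<n} (\<lambda>j. {lo j<..<hi j})"
  define D where "D = ?T -` ?X \<inter> space ?M"
  have X: "?X \<in> sets ?M" by (intro sets_PiM_I_finite) auto
  have D: "D \<in> sets ?M" unfolding D_def by (rule measurable_sets[OF _ X]) measurable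
  have Dmem: "y \<in> D \<longleftrightarrow> y \<in> extensional {..<n} \<and> (\<forall>j<n. lo j < ?t y j \<and> ?t y j < hi j)" for y
    by (auto simp: D_def space_PiM PiE_iff)
  have bd: "\<bar>y i\<bar> \<le> 2 * M * (1 + T)" if y: "\<And>j. j < n \<Longrightarrow> lo j < ?t y j \<and> ?t y j < hi j" and i: "i < n" for y i
  proof (rule matched_block_bound[OF e f T tail _ M(3) i])
    show "\<bar>?t y j\<bar> \<le> M" if "j < n" for j using y[OF that] M(1,2)[of j] by linarith
  qed
  have solv: "\<exists>y. \<forall>j<n. ?t y j = z j" for z
  proof (rule square_system_solvable[OF f])
    fix y i assume "\<And>j. j < n \<Longrightarrow> ?t y j = 0" "i < n"
    \<comment> \<open>With \<open>M = 0\<close> the block bound is injectivity of the block.\<close>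
    then show "y i = 0" using matched_block_bound[OF e f T tail, of y 0 i] by simp
  qed
  have op: "\<exists>r>0. \<forall>y'\<in>extensional {..<n}. (\<forall>i<n. \<bar>y' i - y i\<bar> < r) \<longrightarrow> y' \<in> D" if y: "y \<in> D" for y
  proof -
    define g where "g = Min (insert 1 ((\<lambda>j. min (?t y j - lo j) (hi j - ?t y j)) ` {..<n}))"
    have g0: "0 < g" using y by (auto simp: g_def Dmem)
    have g: "g \<le> ?t y j - lo j" "g \<le> hi j - ?t y j" if "j < n" for j
    proof -
      have "g \<le> min (?t y j - lo j) (hi j - ?t y j)" unfolding g_def using that by (intro Min_le) auto
      then show "g \<le> ?t y j - lo j" "g \<le> hi j - ?t y j" by auto
    qed
    \<comment> \<open>Entries of the block are at most 1 in modulus, so each of the \<open>n\<close>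
      summands moves by at most \<open>r\<close> and the total stays below \<open>g\<close>.\<close>
    define r where "r = g / (real n + 1)"
    have "0 < r" using g0 by (simp add: r_def)
    moreover have "y' \<in> D" if y': "y' \<in> extensional {..<n}" "\<forall>i<n. \<bar>y' i - y i\<bar> < r" for y'
    proof -
      have "\<bar>?t y' j - ?t y j\<bar> < g" for j
      proof -
        have "\<bar>?t y' j - ?t y j\<bar> = \<bar>\<Sum>i<n. (y' i - y i) * (e i \<bullet> f j)\<bar>"
          by (simp add: sum_subtractf left_diff_distrib)
        also have "\<dots> \<le> (\<Sum>i<n. \<bar>(y' i - y i) * (e i \<bullet> f j)\<bar>)" by (rule sum_abs)
        also have "\<dots> \<le> (\<Sum>i<n. r)"
        proof (rule sum_mono)
          fix i assume "i \<in> {..<n}"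
          then have "\<bar>y' i - y i\<bar> * \<bar>e i \<bullet> f j\<bar> \<le> r * 1"
            using y'(2) \<open>0 < r\<close> basis_inner_le_1[OF e f, of i j] by (intro mult_mono) (auto intro: less_imp_le)
          then show "\<bar>(y' i - y i) * (e i \<bullet> f j)\<bar> \<le> r" by (simp add: abs_mult)
        qed
        also have "\<dots> = real n * r" by simp
        also have "\<dots> < g" using g0 by (simp add: r_def field_simps)
        finally show ?thesis .
      qed
      note near = this
      have "lo j < ?t y' j \<and> ?t y' j < hi j" if "j < n" for j
        using near[of j] g[OF that] unfolding abs_less_iff by linarith
      then show ?thesis using y'(1) by (simp add: Dmem)
    qed
    ultimately show ?thesis by blast
  qed
  have "emeasure ?M ?X = (\<Prod>j<n. ennreal (hi j - lo j))"
    using lo by (subst emeasure_PiM) (auto intro!: prod.cong simp: less_imp_le)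
  also have "\<dots> = ennreal (\<Prod>j<n. hi j - lo j)" using lo by (intro prod_ennreal) (simp add: less_imp_le)
  finally have "ennreal c < emeasure ?M ?X" using c by (simp add: ennreal_lessI)
  also have "\<dots> \<le> emeasure ?M D"
    unfolding D_def by (rule contraction_preimage_volume[OF solv basis_block_contraction[OF e f] X])
  finally have cD: "ennreal c < emeasure ?M D" .
  show thesis
  proof (rule grid_inner_approximation[OF D _ op cD])
    show "\<bar>y i\<bar> \<le> 2 * M * (1 + T)" if "y \<in> D" "i < n" for y i using that bd by (auto simp: Dmem)
    fix k and Z :: "(nat \<Rightarrow> int) set"
    assume Z: "finite Z" "Z \<subseteq> extensional {..<n}"
      "\<And>z y. z \<in> Z \<Longrightarrow> y \<in> extensional {..<n} \<Longrightarrow> (\<And>i. i < n \<Longrightarrow> \<lfloor>2 ^ k * y i\<rfloor> = z i) \<Longrightarrow> y \<in> D"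
      "ennreal c < ennreal (real (card Z) * (1 / 2 ^ k) ^ n)"
    have t: "lo j < ?t y j \<and> ?t y j < hi j" if "z \<in> Z" "\<forall>i<n. \<lfloor>2 ^ k * y i\<rfloor> = z i" "j < n" for z y j
    proof -
      \<comment> \<open>Members of \<open>D\<close> are extensional, whereas the coordinates of a
        point are given for all indices.\<close>
      have "restrict y {..<n} \<in> D" using that by (intro Z(3)[OF that(1)]) auto
      then show ?thesis using that(3) by (simp add: Dmem)
    qed
    show thesis
    proof (rule that[OF Z(1,2)])
      show "c < real (card Z) * (1 / 2 ^ k) ^ n" using Z(4) c(2) by (simp add: ennreal_less_iff)
      show "(\<forall>i<n. \<bar>y i\<bar> \<le> 2 * M * (1 + T)) \<and> (\<forall>j<n. lo j < ?t y j \<and> ?t y j < hi j)"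
        if "z \<in> Z" "\<forall>i<n. \<lfloor>2 ^ k * y i\<rfloor> = z i" for z y
        using bd[OF t[OF that]] t[OF that] by blast
    qed
  qed
qed

lemma sum_half_powers: "(\<Sum>j<n. (1 / 2) ^ j) = 2 - 2 * (1 / 2 :: real) ^ n"
  by (induction n) (simp_all add: field_simps)

text \<open>Positive volume makes the logarithms absolutely summable, and none of them exceeds the
  total in modulus.\<close>

lemma positive_volume_lengths:
  assumes ab: "rectangle_bounds e a b" and vol: "0 < rectangle_volume a b"
  obtains c where "0 < c" "\<And>j. c \<le> b j - a j"
proof -
  have sml: "summable (\<lambda>i. \<bar>ln (b i - a i)\<bar>)"
    using ab vol unfolding rectangle_volume_pos_iff
    by (intro summable_ln_pos_cases) (auto simp: rectangle_bounds_def)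
  show thesis
  proof (rule that)
    fix j
    have "\<bar>ln (b j - a j)\<bar> \<le> (\<Sum>i. \<bar>ln (b i - a i)\<bar>)"
      using sum_le_suminf[OF sml, of "{j}"] by simp
    then have "exp (- (\<Sum>i. \<bar>ln (b i - a i)\<bar>)) \<le> exp (ln (b j - a j))" unfolding exp_le_cancel_iff by linarith
    then show "exp (- (\<Sum>i. \<bar>ln (b i - a i)\<bar>)) \<le> b j - a j"
      using rectangle_bounds_less[OF ab, of j] by simp
  qed simp
qed

text \<open>The first \<open>n\<close> sides are unit placeholders, to be replaced by grid cells.
  The point at issue is nonemptiness: a square-summable selection for the shrunk
  \<open>e\<close>-intervals has to come from a point whose \<open>f\<close>-coordinates lie in the
  original ones.\<close>

lemma shrunk_tail_rectangle:
  fixes e f :: "nat \<Rightarrow> 'a::{real_inner, complete_space}"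
  assumes e: "orthonormal_basis e" and f: "orthonormal_basis f"
    and \<alpha>\<beta>: "rectangle_bounds f \<alpha> \<beta>" and M: "\<And>j. \<bar>\<alpha> j\<bar> \<le> M" "\<And>j. \<bar>\<beta> j\<bar> \<le> M"
    and sm\<rho>: "summable \<rho>" and \<rho>: "\<And>j. 0 < \<rho> j" "\<And>j. j \<ge> n \<Longrightarrow> 4 * \<rho> j \<le> \<beta> j - \<alpha> j"
    and p: "\<And>j. p j = (if P j then \<alpha> j else - \<beta> j)" and q: "\<And>j. q j = (if P j then \<beta> j else - \<alpha> j)"
  shows "rectangle_bounds e (\<lambda>j. if j < n then 0 else p j + \<rho> j) (\<lambda>j. if j < n then 1 else q j - \<rho> j)"
    (is "rectangle_bounds e ?a ?b")
proof -
  have lpos: "\<alpha> j < \<beta> j" for j by (rule rectangle_bounds_less[OF \<alpha>\<beta>])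
  have len: "q j - p j = \<beta> j - \<alpha> j" for j by (simp add: p q)
  obtain x0 where x0: "x0 \<in> rectangle f \<alpha> \<beta>" using \<alpha>\<beta> by (auto simp: rectangle_bounds_def)
  define t where "t j = (if P j then x0 \<bullet> f j else - (x0 \<bullet> f j))" for j
  have t: "p j \<le> t j" "t j \<le> q j" for j
    using x0 unfolding in_rectangle by (auto simp: p q t_def less_imp_le)
  \<comment> \<open>Clamps \<open>t j\<close> into the shrunk interval; cutting at
    \<open>q j - 2 * \<rho> j\<close> leaves room for the strict upper bound. The displacement is at
    most \<open>2 * \<rho> j\<close>, so its square is dominated by a multiple of the summable
    \<rho>.\<close>
  define c where "c j = (if j < n then 0 else max (p j + \<rho> j) (min (t j) (q j - 2 * \<rho> j)))" for j
  have cab: "?a j \<le> c j" "c j < ?b j" for j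
    using \<rho>[of j] len[of j] lpos[of j] by (auto simp: c_def not_less)
  have pq: "\<bar>p j\<bar> \<le> M" "\<bar>q j\<bar> \<le> M" for j using M[of j] by (auto simp: p q)
  have "summable (\<lambda>j. (c j)\<^sup>2)"
  proof (rule summable_comparison_test')
    have "(\<lambda>j. (t j)\<^sup>2) = (\<lambda>j. (x0 \<bullet> f j)\<^sup>2)" by (auto simp: t_def)
    then have "summable (\<lambda>j. (t j)\<^sup>2)" using sums_summable[OF parseval_norm[OF f, of x0]] by simp
    then show "summable (\<lambda>j. 2 * (t j)\<^sup>2 + 8 * M * \<rho> j)"
      by (intro summable_add summable_mult sm\<rho>)
    fix j assume j: "n \<le> j"
    have "\<bar>c j - t j\<bar> \<le> 2 * \<rho> j"
      using j \<rho>(1)[of j] \<rho>(2)[OF j] len[of j] t[of j] by (auto simp: c_def max_def min_def abs_le_iff)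
    then have "(c j - t j)\<^sup>2 \<le> (2 * \<rho> j)\<^sup>2"
      using \<rho>(1)[of j] unfolding abs_le_square_iff[symmetric] by simp
    also have "\<dots> = 4 * \<rho> j * \<rho> j" by (simp add: power2_eq_square)
    also have "\<dots> \<le> 4 * M * \<rho> j"
    proof -
      have "\<rho> j \<le> M" using \<rho>(1)[of j] \<rho>(2)[OF j] M[of j] by linarith
      then show ?thesis using \<rho>(1)[of j] by simp
    qed
    finally have 1: "(c j - t j)\<^sup>2 \<le> 4 * M * \<rho> j" .
    have "0 \<le> (c j - 2 * t j)\<^sup>2" by simp
    then have "(c j)\<^sup>2 \<le> 2 * (t j)\<^sup>2 + 2 * (c j - t j)\<^sup>2" by (simp add: power2_eq_square algebra_simps)
    then show "norm ((c j)\<^sup>2) \<le> 2 * (t j)\<^sup>2 + 8 * M * \<rho> j" using 1 by simp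
  qed
  then have ne: "rectangle e ?a ?b \<noteq> {}"
    using cab unfolding rectangle_nonempty_iff[OF e] by blast
  have "\<bar>?a j\<bar> \<le> M + 1 \<and> \<bar>?b j\<bar> \<le> M + 1" for j
  proof (cases "j < n")
    case True
    then show ?thesis using M(1)[of j] by simp
  next
    case False
    then show ?thesis using \<rho>(1)[of j] \<rho>(2)[of j] len[of j] pq[of j] by (simp add: abs_le_iff)
  qed
  then have "bounded (range ?a)" "bounded (range ?b)"
    unfolding bounded_iff real_norm_def ball_simps by blast+
  moreover have "summable (\<lambda>j. max 0 (ln (?b j - ?a j)))"
  proof (rule summable_comparison_test')
    show "summable (\<lambda>j. max 0 (ln (\<beta> j - \<alpha> j)))" using \<alpha>\<beta> by (simp add: rectangle_bounds_def)
    fix j assume j: "n \<le> j"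
    have "ln (?b j - ?a j) \<le> ln (\<beta> j - \<alpha> j)"
      using j \<rho>(1)[of j] \<rho>(2)[OF j] len[of j] lpos[of j] by simp
    then show "norm (max 0 (ln (?b j - ?a j))) \<le> max 0 (ln (\<beta> j - \<alpha> j))" by simp
  qed
  ultimately show ?thesis using ne unfolding rectangle_bounds_def by blast
qed

text \<open>Volume is lost in three places: the block box shrinks by \<open>R * \<theta> j\<close>
  on each side, the tail by \<open>\<rho> j\<close>, and cells do not fill the preimage. The first
  two losses, relative to the side lengths, are collected in \<open>x\<close> and sum to less than
  \<eta>; the third costs another factor \<open>1 - \<eta>\<close>.\<close>

lemma matched_rectangle_inner:
  fixes e f :: "nat \<Rightarrow> 'a::{real_inner, complete_space}"
  assumes e: "orthonormal_basis e" and f: "orthonormal_basis f"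
    and T: "\<And>m. (\<Sum>i<m. \<Sum>j<m. off_diagonal e f i j) \<le> T"
    and \<alpha>\<beta>: "rectangle_bounds f \<alpha> \<beta>" and vol: "0 < rectangle_volume \<alpha> \<beta>" and \<epsilon>: "0 < \<epsilon>"
  shows "\<exists>S\<in>rectangle_ring e. S \<subseteq> rectangle f \<alpha> \<beta> \<and> rectangle_volume \<alpha> \<beta> - \<epsilon> \<le> ring_measure e S"
proof -
  let ?d = "off_diagonal e f" and ?V = "rectangle_volume \<alpha> \<beta>"
  have d0: "0 \<le> ?d i j" for i j by simp
  note D = square_bounded_double_series[of ?d, OF d0 T]
  define col where "col j = (\<Sum>i. ?d i j)" for j
  have col0: "0 \<le> col j" for j unfolding col_def by (intro suminf_nonneg D(1) d0)
  have smcol: "summable col" unfolding col_def by (rule D(2))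
  have colge: "(\<Sum>i<n. ?d i j) \<le> col j" for n j unfolding col_def by (intro sum_le_suminf D(1) d0) auto
  define sq where "sq n = (\<Sum>j<n. \<Sum>i<n. ?d i j)" for n
  have sqlim: "sq \<longlonglongrightarrow> suminf col" unfolding sq_def[abs_def] col_def by (rule D(3))
  have T0: "0 \<le> T" using T[of 0] by simp
  obtain M where M: "0 \<le> M" "\<And>j. \<bar>\<alpha> j\<bar> \<le> M" "\<And>j. \<bar>\<beta> j\<bar> \<le> M" by (rule rectangle_bounds_uniform[OF \<alpha>\<beta>]) blast
  \<comment> \<open>Sup bound for all \<open>e\<close>-coordinates of the approximating set: the
    block bound for indices below \<open>n\<close>, \<open>M\<close> for the others. Adding 1
    ensures \<open>1 \<le> R\<close>.\<close>
  define R where "R = 2 * M * (1 + T) + 1"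
  have MT: "0 \<le> M * T" using M(1) T0 by simp
  have RM: "M \<le> R" and R1: "1 \<le> R" using M(1) MT by (auto simp: R_def algebra_simps)
  obtain c where c: "0 < c" "\<And>j. c \<le> \<beta> j - \<alpha> j" by (rule positive_volume_lengths[OF \<alpha>\<beta> vol]) blast
  have lpos: "0 < \<beta> j - \<alpha> j" for j using rectangle_bounds_less[OF \<alpha>\<beta>, of j] by simp
  \<comment> \<open>A factor \<open>1 - \<eta>\<close> is lost twice, and
    \<open>(1 - \<eta>)\<^sup>2 \<ge> 1 - 2 * \<eta>\<close>.\<close>
  define \<eta> where "\<eta> = min (1 / 2) (\<epsilon> / (2 * ?V))"
  have \<eta>: "0 < \<eta>" "\<eta> \<le> 1 / 2" "2 * \<eta> * ?V \<le> \<epsilon>"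
  proof -
    show "0 < \<eta>" "\<eta> \<le> 1 / 2" using \<epsilon> vol by (auto simp: \<eta>_def)
    have "\<eta> \<le> \<epsilon> / (2 * ?V)" by (simp add: \<eta>_def)
    then show "2 * \<eta> * ?V \<le> \<epsilon>" using vol by (simp add: field_simps)
  qed
  \<comment> \<open>The first condition keeps the sum of the relative losses below \<eta>; the
    second yields the tail hypothesis of the block bound.\<close>
  obtain n where n: "4 * R / c * (suminf col - sq n) + 4 / c * (1 / 2) ^ n < \<eta>" "suminf col - sq n < 1 / 2"
  proof -
    have "(\<lambda>n. 4 * R / c * (suminf col - sq n) + 4 / c * (1 / 2) ^ n) \<longlonglongrightarrow> 4 * R / c * (suminf col - suminf col) + 4 / c * 0"
      by (intro tendsto_intros sqlim LIMSEQ_power_zero) simp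
    then have "\<forall>\<^sub>F n in sequentially. 4 * R / c * (suminf col - sq n) + 4 / c * (1 / 2) ^ n < \<eta>"
      using \<eta>(1) by (intro order_tendstoD(2)) auto
    moreover have "(\<lambda>n. suminf col - sq n) \<longlonglongrightarrow> suminf col - suminf col" by (intro tendsto_intros sqlim)
    then have "\<forall>\<^sub>F n in sequentially. suminf col - sq n < 1 / 2" by (intro order_tendstoD(2)) auto
    ultimately have "\<forall>\<^sub>F n in sequentially. 4 * R / c * (suminf col - sq n) + 4 / c * (1 / 2) ^ n < \<eta> \<and> suminf col - sq n < 1 / 2"
      by (rule eventually_conj)
    then show thesis using that unfolding eventually_sequentially by blast
  qed
  \<comment> \<open>Mass of column \<open>j\<close> outside the first \<open>n\<close> rows. For
    \<open>j < n\<close>, the coordinate in direction \<open>f j\<close> differs from its block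
    approximation by at most \<open>R * \<theta> j\<close>.\<close>
  define \<theta> where "\<theta> j = col j - (\<Sum>i<n. ?d i j)" for j
  have \<theta>0: "0 \<le> \<theta> j" for j using colge by (simp add: \<theta>_def)
  define \<rho> where "\<rho> j = 2 * R * col j + (1 / 2) ^ j" for j
  have \<rho>0: "0 < \<rho> j" for j unfolding \<rho>_def using R1 col0[of j] by (intro add_nonneg_pos) auto
  have sm\<rho>: "summable \<rho>" unfolding \<rho>_def by (intro summable_add summable_mult smcol summable_geometric) simp
  \<comment> \<open>Relative loss: a side of length at least \<open>c\<close> loses
    \<open>2 * R * \<theta> j\<close> in the block and \<open>2 * \<rho> j\<close> in the
    tail.\<close>
  define x where "x j = (if j < n then 2 * R * \<theta> j / c else 2 * \<rho> j / c)" for j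
  have x0: "0 \<le> x j" for j using R1 \<theta>0[of j] \<rho>0[of j] c(1) by (simp add: x_def)
  have xsum: "(\<Sum>j<m. x j) < \<eta>" if "m \<ge> n" for m
  proof -
    have split: "(\<Sum>j<m. g j) = (\<Sum>j<n. g j) + (\<Sum>j=n..<m. g j)" for g :: "nat \<Rightarrow> real"
      using that sum.atLeastLessThan_concat[of 0 n m g] by (simp add: atLeast0LessThan)
    have "(\<Sum>j<n. x j) = 2 * R / c * (\<Sum>j<n. \<theta> j)" by (simp add: x_def sum_distrib_left)
    also have "\<dots> \<le> 4 * R / c * (\<Sum>j<n. \<theta> j)"
      using R1 c(1) by (intro mult_right_mono divide_right_mono sum_nonneg \<theta>0) auto
    finally have 1: "(\<Sum>j<n. x j) \<le> 4 * R / c * (\<Sum>j<n. \<theta> j)" .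
    have "(\<Sum>j=n..<m. x j) = (\<Sum>j=n..<m. 4 * R / c * col j + 2 / c * (1 / 2) ^ j)"
      by (intro sum.cong refl) (simp add: x_def \<rho>_def add_divide_distrib)
    also have "\<dots> = 4 * R / c * (\<Sum>j=n..<m. col j) + 2 / c * (\<Sum>j=n..<m. (1 / 2) ^ j)"
      by (simp add: sum.distrib sum_distrib_left)
    finally have 2: "(\<Sum>j=n..<m. x j) = 4 * R / c * (\<Sum>j=n..<m. col j) + 2 / c * (\<Sum>j=n..<m. (1 / 2) ^ j)" .
    have "(\<Sum>j<n. \<theta> j) + (\<Sum>j=n..<m. col j) = (\<Sum>j<m. col j) - sq n"
      unfolding split[of col] by (simp add: \<theta>_def sum_subtractf sq_def)
    also have "\<dots> \<le> suminf col - sq n" using sum_le_suminf[OF smcol, of "{..<m}"] col0 by simp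
    finally have "4 * R / c * ((\<Sum>j<n. \<theta> j) + (\<Sum>j=n..<m. col j)) \<le> 4 * R / c * (suminf col - sq n)"
      using R1 c(1) by (intro mult_left_mono) auto
    moreover have "(\<Sum>j=n..<m. (1 / 2 :: real) ^ j) \<le> 2 * (1 / 2) ^ n"
    proof -
      have "0 \<le> (1 / 2 :: real) ^ m" by simp
      then show ?thesis using split[of "\<lambda>j. (1 / 2) ^ j"] unfolding sum_half_powers by linarith
    qed
    then have "2 / c * (\<Sum>j=n..<m. (1 / 2) ^ j) \<le> 2 / c * (2 * (1 / 2) ^ n)"
      using c(1) by (intro mult_left_mono) auto
    ultimately show ?thesis using 1 2 n(1) unfolding split[of x] distrib_left by simp
  qed
  have x1: "x j \<le> 1 / 2" for j
  proof -
    have "x j \<le> (\<Sum>j<max n (Suc j). x j)" by (intro member_le_sum x0) auto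
    then show ?thesis using xsum[of "max n (Suc j)"] \<eta>(2) by simp
  qed
  have cx: "c * x j \<le> (\<beta> j - \<alpha> j) * x j" for j using c(2) x0 by (intro mult_right_mono)
  have cx1: "c * x j = 2 * R * \<theta> j" if "j < n" for j using that c(1) by (simp add: x_def)
  have cx2: "c * x j = 2 * \<rho> j" if "n \<le> j" for j using that c(1) by (simp add: x_def)
  define lo where "lo j = \<alpha> j + (if j < n then R * \<theta> j else 0)" for j
  define hi where "hi j = \<beta> j - (if j < n then R * \<theta> j else 0)" for j
  have lx: "0 < (\<beta> j - \<alpha> j) * (1 - x j)" for j using lpos[of j] x1[of j] by simp
  have lohi: "(\<beta> j - \<alpha> j) * (1 - x j) \<le> hi j - lo j" for j
    using cx[of j] cx1[of j] x0[of j] lpos[of j] by (cases "j < n") (simp_all add: lo_def hi_def right_diff_distrib)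
  have lohi': "lo j < hi j" for j using lohi[of j] lx[of j] by linarith
  have R\<theta>: "0 \<le> R * \<theta> j" for j using R1 \<theta>0[of j] by simp
  have loM: "\<bar>lo j\<bar> \<le> M" "\<bar>hi j\<bar> \<le> M" for j
    using lohi'[of j] R\<theta>[of j] M(2,3)[of j] by (auto simp: lo_def hi_def abs_le_iff split: if_splits)
  define VX where "VX = (\<Prod>j<n. hi j - lo j)"
  have VX: "0 < VX" unfolding VX_def using lohi' by (intro prod_pos) auto
  have c0: "(1 - \<eta>) * VX < (\<Prod>j<n. hi j - lo j)" "0 \<le> (1 - \<eta>) * VX"
    using VX \<eta>(1,2) unfolding VX_def[symmetric] by (simp_all add: algebra_simps)
  have tail: "(\<Sum>j. \<Sum>i. ?d i j) - (\<Sum>j<n. \<Sum>i. ?d i j) \<le> 1 / 2"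
  proof -
    have "sq n \<le> (\<Sum>j<n. col j)" unfolding sq_def by (intro sum_mono colge)
    then show ?thesis using n(2) unfolding col_def by linarith
  qed
  obtain k and Z :: "(nat \<Rightarrow> int) set" where Z: "finite Z" "Z \<subseteq> extensional {..<n}"
    and ZX: "\<And>z y. z \<in> Z \<Longrightarrow> \<forall>i<n. \<lfloor>2 ^ k * y i\<rfloor> = z i \<Longrightarrow> (\<forall>i<n. \<bar>y i\<bar> \<le> 2 * M * (1 + T)) \<and>
       (\<forall>j<n. lo j < (\<Sum>i<n. y i * (e i \<bullet> f j)) \<and> (\<Sum>i<n. y i * (e i \<bullet> f j)) < hi j)"
    and Zc: "(1 - \<eta>) * VX < real (card Z) * (1 / 2 ^ k) ^ n"
    by (rule matched_block_grid[OF e f T tail lohi' loM M(1) c0]) blast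
  define s where "s j = (if 0 \<le> e j \<bullet> f j then 1 else - 1 :: real)" for j
  define p where "p j = (if 0 \<le> e j \<bullet> f j then \<alpha> j else - \<beta> j)" for j
  define q where "q j = (if 0 \<le> e j \<bullet> f j then \<beta> j else - \<alpha> j)" for j
  have pq: "q j - p j = \<beta> j - \<alpha> j" "\<bar>p j\<bar> \<le> M" "\<bar>q j\<bar> \<le> M" for j using M(2,3)[of j] by (auto simp: p_def q_def)
  have \<rho>L: "4 * \<rho> j \<le> \<beta> j - \<alpha> j" if "n \<le> j" for j
  proof -
    have "c * x j \<le> (\<beta> j - \<alpha> j) * (1 / 2)"
      using cx[of j] mult_left_mono[OF x1[of j], of "\<beta> j - \<alpha> j"] lpos[of j] by linarith
    then show ?thesis using cx2[OF that] by simp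
  qed
  define a0 where "a0 = (\<lambda>j. if j < n then 0 else p j + \<rho> j)"
  define b0 where "b0 = (\<lambda>j. if j < n then 1 else q j - \<rho> j)"
  have bd0: "rectangle_bounds e a0 b0"
    unfolding a0_def b0_def by (rule shrunk_tail_rectangle[OF e f \<alpha>\<beta> M(2,3) sm\<rho> \<rho>0 \<rho>L p_def q_def])
  define W where "W = rectangle_volume a0 b0"
  \<comment> \<open>\<open>W\<close> is the volume of the tail, since the placeholder sides have
    length 1, and \<open>VX\<close> is that of the shrunk block box. The comparison is made for
    finite products, where the Weierstrass inequality applies.\<close>
  have WV: "?V * (1 - \<eta>) \<le> W * VX"
  proof (rule LIMSEQ_le)
    show "(\<lambda>m. (\<Prod>j<m. \<beta> j - \<alpha> j) * (1 - \<eta>)) \<longlonglongrightarrow> ?V * (1 - \<eta>)"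
      by (intro tendsto_mult tendsto_const rectangle_volume_tendsto[OF \<alpha>\<beta>])
    show "(\<lambda>m. (\<Prod>j<m. b0 j - a0 j) * VX) \<longlonglongrightarrow> W * VX"
      unfolding W_def by (intro tendsto_mult tendsto_const rectangle_volume_tendsto[OF bd0])
    have "(\<Prod>j<m. \<beta> j - \<alpha> j) * (1 - \<eta>) \<le> (\<Prod>j<m. b0 j - a0 j) * VX" if m: "m \<ge> n" for m
    proof -
      have split: "(\<Prod>j<m. g j) = (\<Prod>j<n. g j) * (\<Prod>j=n..<m. g j)" for g :: "nat \<Rightarrow> real"
        using m prod.atLeastLessThan_concat[of 0 n m g] by (simp add: atLeast0LessThan)
      have "1 - \<eta> \<le> 1 - (\<Sum>j<m. x j)" using xsum[OF m] by simp
      also have "\<dots> \<le> (\<Prod>j<m. 1 - x j)"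
      proof (rule prod_one_minus_ge[OF x0])
        show "x j \<le> 1" for j using x1[of j] by simp
      qed
      finally have "(\<Prod>j<m. \<beta> j - \<alpha> j) * (1 - \<eta>) \<le> (\<Prod>j<m. \<beta> j - \<alpha> j) * (\<Prod>j<m. 1 - x j)"
        using lpos by (intro mult_left_mono prod_nonneg) (auto intro: less_imp_le)
      also have "\<dots> = (\<Prod>j<n. (\<beta> j - \<alpha> j) * (1 - x j)) * (\<Prod>j=n..<m. (\<beta> j - \<alpha> j) * (1 - x j))"
        by (subst split[symmetric]) (simp add: prod.distrib)
      also have "\<dots> \<le> VX * (\<Prod>j=n..<m. b0 j - a0 j)"
      proof (rule mult_mono)
        show "(\<Prod>j<n. (\<beta> j - \<alpha> j) * (1 - x j)) \<le> VX"
          unfolding VX_def using lx lohi by (intro prod_mono) (auto intro: less_imp_le)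
        show "(\<Prod>j=n..<m. (\<beta> j - \<alpha> j) * (1 - x j)) \<le> (\<Prod>j=n..<m. b0 j - a0 j)"
        proof (rule prod_mono)
          fix j assume "j \<in> {n..<m}"
          then have j: "n \<le> j" by simp
          have "b0 j - a0 j = \<beta> j - \<alpha> j - 2 * \<rho> j" using j pq(1)[of j] by (simp add: a0_def b0_def)
          then have "(\<beta> j - \<alpha> j) * (1 - x j) \<le> b0 j - a0 j"
            using cx[of j] cx2[OF j] by (simp add: right_diff_distrib)
          then show "0 \<le> (\<beta> j - \<alpha> j) * (1 - x j) \<and> (\<beta> j - \<alpha> j) * (1 - x j) \<le> b0 j - a0 j"
            using lx[of j] by simp
        qed
        show "0 \<le> VX" using VX by simp
        show "0 \<le> (\<Prod>j=n..<m. (\<beta> j - \<alpha> j) * (1 - x j))" using lx by (intro prod_nonneg) (auto intro: less_imp_le)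
      qed
      also have "\<dots> = (\<Prod>j<m. b0 j - a0 j) * VX"
        unfolding split[of "\<lambda>j. b0 j - a0 j"] by (simp add: a0_def b0_def)
      finally show ?thesis .
    qed
    then show "\<exists>N. \<forall>m\<ge>N. (\<Prod>j<m. \<beta> j - \<alpha> j) * (1 - \<eta>) \<le> (\<Prod>j<m. b0 j - a0 j) * VX" by blast
  qed
  \<comment> \<open>The placeholders give way to the grid cell \<open>z\<close>, so every piece has
    volume \<open>W\<close> times that of a cell.\<close>
  define az where "az z j = (if j < n then real_of_int (z j) / 2 ^ k else a0 j)" for z :: "nat \<Rightarrow> int" and j
  define bz where "bz z j = (if j < n then (real_of_int (z j) + 1) / 2 ^ k else b0 j)" for z :: "nat \<Rightarrow> int" and j
  have bdz: "rectangle_bounds e (az z) (bz z)" for z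
    by (rule rectangle_bounds_finite_change[OF e bd0, of n]) (auto simp: az_def bz_def divide_strict_right_mono)
  have volz: "rectangle_volume (az z) (bz z) = W * (1 / 2 ^ k) ^ n" for z
  proof -
    have "rectangle_volume (az z) (bz z) = W * (\<Prod>j<n. (bz z j - az z j) / (b0 j - a0 j))"
      unfolding W_def by (rule rectangle_volume_finite_change[OF bd0 bdz]) (auto simp: az_def bz_def)
    also have "(\<Prod>j<n. (bz z j - az z j) / (b0 j - a0 j)) = (\<Prod>j<n. 1 / 2 ^ k)"
      by (intro prod.cong refl) (simp add: az_def bz_def a0_def b0_def add_divide_distrib)
    finally show ?thesis by simp
  qed
  have floor: "\<lfloor>2 ^ k * (y \<bullet> e i)\<rfloor> = z i" if "y \<in> rectangle e (az z) (bz z)" "i < n" for y z i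
    using that unfolding in_rectangle az_def bz_def dyadic_cell_iff[symmetric] by (auto dest!: spec[of _ i])
  let ?S = "\<Union>z\<in>Z. rectangle e (az z) (bz z)"
  have S: "?S \<in> rectangle_ring e" using Z(1) bdz by (intro rectangle_ring_UN rectangle_in_ring)
  have disj: "disjoint_family_on (\<lambda>z. rectangle e (az z) (bz z)) Z"
    unfolding disjoint_family_on_def
  proof (intro ballI impI equals0I)
    fix z z' y assume z: "z \<in> Z" "z' \<in> Z" "z \<noteq> z'"
      and y: "y \<in> rectangle e (az z) (bz z) \<inter> rectangle e (az z') (bz z')"
    have "z i = z' i" if "i \<in> {..<n}" for i using y floor[of y z i] floor[of y z' i] that by simp
    then have "z = z'" using z(1,2) Z(2) by (intro extensionalityI[of z "{..<n}" z']) auto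
    then show False using z(3) by simp
  qed
  have "ring_measure e ?S = (\<Sum>z\<in>Z. ring_measure e (rectangle e (az z) (bz z)))"
    using bdz by (intro ring_measure_UN_disjoint[OF e Z(1) _ disj] rectangle_in_ring)
  also have "\<dots> = real (card Z) * (1 / 2 ^ k) ^ n * W"
    by (simp add: ring_measure_rectangle[OF e bdz] volz)
  finally have mS: "ring_measure e ?S = real (card Z) * (1 / 2 ^ k) ^ n * W" .
  have W0: "0 \<le> W" by (simp add: W_def)
  have "?V - \<epsilon> \<le> ?V * (1 - 2 * \<eta>)" using \<eta>(3) by (simp add: algebra_simps)
  also have "\<dots> \<le> (1 - \<eta>) * (?V * (1 - \<eta>))"
  proof -
    have "0 \<le> ?V * \<eta>\<^sup>2" by simp
    then show ?thesis by (simp add: power2_eq_square algebra_simps)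
  qed
  also have "\<dots> \<le> (1 - \<eta>) * (W * VX)" using \<eta>(2) by (intro mult_left_mono WV) simp
  also have "\<dots> = ((1 - \<eta>) * VX) * W" by simp
  also have "\<dots> \<le> ring_measure e ?S" unfolding mS by (rule mult_right_mono[OF less_imp_le[OF Zc] W0])
  finally have "?V - \<epsilon> \<le> ring_measure e ?S" .
  moreover have "?S \<subseteq> rectangle f \<alpha> \<beta>"
  proof (rule UN_least, rule subsetI)
    fix z y assume z: "z \<in> Z" and y: "y \<in> rectangle e (az z) (bz z)"
    have fl: "\<forall>i<n. \<lfloor>2 ^ k * (y \<bullet> e i)\<rfloor> = z i" using floor[OF y] by blast
    have yt: "p j + \<rho> j \<le> y \<bullet> e j" "y \<bullet> e j < q j - \<rho> j" if "n \<le> j" for j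
      using y that unfolding in_rectangle az_def bz_def a0_def b0_def by (auto dest!: spec[of _ j])
    have yR: "\<bar>y \<bullet> e i\<bar> \<le> R" for i
    proof (cases "i < n")
      case True
      then show ?thesis using ZX[OF z fl] by (fastforce simp: R_def)
    next
      case False
      then show ?thesis using yt[of i] pq(2,3)[of i] \<rho>0[of i] RM by (simp add: abs_le_iff)
    qed
    have "\<alpha> j \<le> y \<bullet> f j \<and> y \<bullet> f j < \<beta> j" for j
    proof (cases "j < n")
      case True
      define h where "h = (\<Sum>i<n. (y \<bullet> e i) * (e i \<bullet> f j))"
      have "\<bar>y \<bullet> f j - h\<bar> \<le> R * \<theta> j"
        unfolding h_def
        by (rule coordinate_expansion_error[OF e f D(1) yR finite_lessThan]) (use True in \<open>auto simp: \<theta>_def col_def\<close>)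
      moreover have "lo j < h" "h < hi j" using ZX[OF z fl] True unfolding h_def by blast+
      moreover have "lo j = \<alpha> j + R * \<theta> j" "hi j = \<beta> j - R * \<theta> j" using True by (simp_all add: lo_def hi_def)
      ultimately show ?thesis by (intro conjI; linarith)
    next
      case False
      have "\<bar>y \<bullet> f j - s j * (y \<bullet> e j)\<bar> \<le> 2 * R * col j"
        unfolding s_def col_def by (rule matched_coordinate_error[OF e f D(1) yR])
      also have "\<dots> < \<rho> j" by (simp add: \<rho>_def)
      finally show ?thesis using yt[of j] False by (auto simp: s_def p_def q_def abs_less_iff split: if_splits)
    qed
    then show "y \<in> rectangle f \<alpha> \<beta>" by (simp add: in_rectangle)
  qed
  ultimately show ?thesis using S by blast
qed

text \<open>A lower estimate passes through disjoint unions and inner limits but not through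
  differences, hence the use of the inner induction rule.\<close>

lemma matched_inner:
  fixes e f :: "nat \<Rightarrow> 'a::{real_inner, complete_space}"
  assumes e: "orthonormal_basis e" and f: "orthonormal_basis f"
    and T: "\<And>m. (\<Sum>i<m. \<Sum>j<m. off_diagonal e f i j) \<le> T"
    and Q: "Q \<in> rectangle_ring f"
  shows "\<forall>\<epsilon>>0. \<exists>S\<in>rectangle_ring e. S \<subseteq> Q \<and> ring_measure f Q - \<epsilon> \<le> ring_measure e S"
  using f Q
proof (induction rule: rectangle_ring_inner_induct)
  case empty
  show ?case by (intro allI impI bexI[of _ "{}"]) (simp_all add: ring_measure_empty[OF e] ring_measure_empty[OF f])
next
  case (rectangle \<alpha> \<beta>)
  then show ?case using matched_rectangle_inner[OF e f T] by (simp add: ring_measure_rectangle[OF f])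
next
  case (Un A B)
  show ?case
  proof (intro allI impI)
    fix \<epsilon> :: real assume "0 < \<epsilon>"
    then have "0 < \<epsilon> / 2" by simp
    then obtain S S' where S: "S \<in> rectangle_ring e" "S \<subseteq> A" "ring_measure f A - \<epsilon> / 2 \<le> ring_measure e S"
      and S': "S' \<in> rectangle_ring e" "S' \<subseteq> B" "ring_measure f B - \<epsilon> / 2 \<le> ring_measure e S'"
      using Un.IH by meson
    have "S \<inter> S' = {}" using S(2) S'(2) Un.hyps(3) by blast
    then have "ring_measure f (A \<union> B) - \<epsilon> \<le> ring_measure e (S \<union> S')"
      using S(3) S'(3) ring_measure_Un[OF e S(1) S'(1)] ring_measure_Un[OF f Un.hyps(1-3)] by simp
    moreover have "S \<union> S' \<subseteq> A \<union> B" using S(2) S'(2) by blast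
    ultimately show "\<exists>S\<in>rectangle_ring e. S \<subseteq> A \<union> B \<and> ring_measure f (A \<union> B) - \<epsilon> \<le> ring_measure e S"
      using rectangle_ring_Un[OF S(1) S'(1)] by blast
  qed
next
  case (limit A)
  show ?case
  proof (intro allI impI)
    fix \<epsilon> :: real assume "0 < \<epsilon>"
    then have \<epsilon>: "0 < \<epsilon> / 2" by simp
    from limit(2)[OF \<epsilon>] obtain A' where A': "A' \<subseteq> A" "ring_measure f A - \<epsilon> / 2 \<le> ring_measure f A'"
      "\<forall>\<epsilon>>0. \<exists>S\<in>rectangle_ring e. S \<subseteq> A' \<and> ring_measure f A' - \<epsilon> \<le> ring_measure e S" by blast
    from A'(3) \<epsilon> obtain S where S: "S \<in> rectangle_ring e" "S \<subseteq> A'" "ring_measure f A' - \<epsilon> / 2 \<le> ring_measure e S"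
      by blast
    have "ring_measure f A - \<epsilon> \<le> ring_measure e S" using A'(2) S(3) by linarith
    then show "\<exists>S\<in>rectangle_ring e. S \<subseteq> A \<and> ring_measure f A - \<epsilon> \<le> ring_measure e S"
      using S(1,2) A'(1) by blast
  qed
qed

text \<open>
  Inner inequalities in both directions imply the outer one: cover \<open>Q\<close> by \<open>A\<close>, take \<open>Q'\<close> inside
  \<open>A\<close> with nearly the measure of \<open>A\<close>, and remove from \<open>A\<close> an inner approximation of \<open>Q' - Q\<close>.
\<close>

lemma matched_outer:
  fixes e f :: "nat \<Rightarrow> 'a::{real_inner, complete_space}"
  assumes e: "orthonormal_basis e" and f: "orthonormal_basis f"
    and T: "\<And>m. (\<Sum>i<m. \<Sum>j<m. off_diagonal e f i j) \<le> T"
    and Q: "Q \<in> rectangle_ring f" and \<epsilon>: "0 < \<epsilon>"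
  shows "\<exists>A\<in>rectangle_ring e. Q \<subseteq> A \<and> ring_measure e A \<le> ring_measure f Q + \<epsilon>"
proof -
  have T': "(\<Sum>i<m. \<Sum>j<m. off_diagonal f e i j) \<le> T" for m using T off_diagonal_swap[of f e m] by simp
  obtain \<C> where C: "finite \<C>" "\<C> \<subseteq> {(a, b). rectangle_bounds f a b}" "Q \<subseteq> (\<Union>(a, b)\<in>\<C>. rectangle f a b)"
    by (rule rectangle_ring_covered[OF Q])
  have "\<forall>t\<in>\<C>. \<exists>A\<in>rectangle_ring e. (case t of (a, b) \<Rightarrow> rectangle f a b) \<subseteq> A"
  proof
    fix t assume "t \<in> \<C>"
    then obtain a b where t: "t = (a, b)" "rectangle_bounds f a b" using C(2) by blast
    from matched_rectangle_hull[OF e f T t(2)] obtain a' b'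
      where "rectangle_bounds e a' b'" "rectangle f a b \<subseteq> rectangle e a' b'" by blast
    then show "\<exists>A\<in>rectangle_ring e. (case t of (a, b) \<Rightarrow> rectangle f a b) \<subseteq> A"
      unfolding t(1) case_prod_conv by (intro bexI[of _ "rectangle e a' b'"] rectangle_in_ring)
  qed
  then obtain H where H: "\<And>t. t \<in> \<C> \<Longrightarrow> H t \<in> rectangle_ring e" "\<And>t. t \<in> \<C> \<Longrightarrow> (case t of (a, b) \<Rightarrow> rectangle f a b) \<subseteq> H t"
    by metis
  define A where "A = (\<Union>t\<in>\<C>. H t)"
  have A: "A \<in> rectangle_ring e" unfolding A_def using C(1) H(1) by (rule rectangle_ring_UN)
  have QA: "Q \<subseteq> A" using C(3) H(2) unfolding A_def by blast
  have \<epsilon>2: "0 < \<epsilon> / 2" using \<epsilon> by simp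
  obtain Q' where Q': "Q' \<in> rectangle_ring f" "Q' \<subseteq> A" "ring_measure e A - \<epsilon> / 2 \<le> ring_measure f Q'"
    using matched_inner[OF f e T' A] \<epsilon>2 by blast
  have Q'Q: "Q' - Q \<in> rectangle_ring f" by (rule rectangle_ring_Diff[OF Q'(1) Q])
  obtain S where S: "S \<in> rectangle_ring e" "S \<subseteq> Q' - Q" "ring_measure f (Q' - Q) - \<epsilon> / 2 \<le> ring_measure e S"
    using matched_inner[OF e f T Q'Q] \<epsilon>2 by blast
  have "ring_measure f Q' \<le> ring_measure f (Q' - Q) + ring_measure f Q"
  proof -
    have "ring_measure f Q' \<le> ring_measure f ((Q' - Q) \<union> Q)"
      by (rule ring_measure_mono[OF f rectangle_ring_Un[OF Q'Q Q] Q'(1)]) blast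
    also have "\<dots> = ring_measure f (Q' - Q) + ring_measure f Q"
      by (rule ring_measure_Un[OF f Q'Q Q]) blast
    finally show ?thesis .
  qed
  moreover have "S \<subseteq> A" using S(2) Q'(2) by blast
  then have "ring_measure e (A - S) = ring_measure e A - ring_measure e S" by (rule ring_measure_Diff[OF e A S(1)])
  ultimately have "ring_measure e (A - S) \<le> ring_measure f Q + \<epsilon>" using Q'(3) S(3) by linarith
  moreover have "Q \<subseteq> A - S" using QA S(2) by blast
  ultimately show ?thesis using rectangle_ring_Diff[OF A S(1)] by blast
qed

section \<open>Passage to the completions\<close>

lemma completed_measure_le:
  assumes e: "orthonormal_basis e" and A: "A2 \<in> rectangle_ring e" "A \<subseteq> A2"
  shows "completed_measure e A \<le> ring_measure e A2"
  unfolding completed_measure_def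
proof (rule cInf_lower)
  show "bdd_below {ring_measure e A2 |A2. A2 \<in> rectangle_ring e \<and> A \<subseteq> A2}"
    using ring_measure_nonneg[OF e] by (intro bdd_belowI[of _ 0]) auto
qed (use A in blast)

lemma matched_completed_le:
  fixes e f :: "nat \<Rightarrow> 'a::{real_inner, complete_space}"
  assumes e: "orthonormal_basis e" and f: "orthonormal_basis f"
    and T: "\<And>m. (\<Sum>i<m. \<Sum>j<m. off_diagonal e f i j) \<le> T"
    and B: "B \<in> completed_ring f"
  shows "B \<in> completed_ring e" "completed_measure e B \<le> completed_measure f B"
proof -
  show "B \<in> completed_ring e"
    unfolding completed_ring_def mem_Collect_eq
  proof (intro allI impI)
    fix \<epsilon> :: real assume "0 < \<epsilon>"
    then have \<epsilon>: "0 < \<epsilon> / 3" by simp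
    then obtain Q1 Q2 where Q: "Q1 \<in> rectangle_ring f" "Q2 \<in> rectangle_ring f" "Q1 \<subseteq> B" "B \<subseteq> Q2"
      "ring_measure f (Q2 - Q1) < \<epsilon> / 3"
      using B unfolding completed_ring_def by blast
    obtain A1 where A1: "A1 \<in> rectangle_ring e" "A1 \<subseteq> Q1" "ring_measure f Q1 - \<epsilon> / 3 \<le> ring_measure e A1"
      using matched_inner[OF e f T Q(1)] \<epsilon> by blast
    obtain A2 where A2: "A2 \<in> rectangle_ring e" "Q2 \<subseteq> A2" "ring_measure e A2 \<le> ring_measure f Q2 + \<epsilon> / 3"
      using matched_outer[OF e f T Q(2) \<epsilon>] by blast
    have "A1 \<subseteq> A2" "Q1 \<subseteq> Q2" using A1 A2 Q by blast+
    then have "ring_measure e (A2 - A1) < \<epsilon>"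
      using ring_measure_Diff[OF e A2(1) A1(1)] ring_measure_Diff[OF f Q(2,1)] Q(5) A1(3) A2(3) by simp
    then show "\<exists>A1\<in>rectangle_ring e. \<exists>A2\<in>rectangle_ring e. A1 \<subseteq> B \<and> B \<subseteq> A2 \<and> ring_measure e (A2 - A1) < \<epsilon>"
      using A1(1,2) A2(1,2) Q(3,4) by (meson order_trans)
  qed
  have "completed_measure e B \<le> ring_measure f Q" if Q: "Q \<in> rectangle_ring f" "B \<subseteq> Q" for Q
  proof (rule field_le_epsilon)
    fix \<epsilon> :: real assume "0 < \<epsilon>"
    then obtain A where "A \<in> rectangle_ring e" "Q \<subseteq> A" "ring_measure e A \<le> ring_measure f Q + \<epsilon>"
      using matched_outer[OF e f T Q(1)] by blast
    then show "completed_measure e B \<le> ring_measure f Q + \<epsilon>"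
      using completed_measure_le[OF e, of A B] Q(2) by (meson order_trans)
  qed
  moreover have "{ring_measure f A2 |A2. A2 \<in> rectangle_ring f \<and> B \<subseteq> A2} \<noteq> {}"
    using B by (auto simp: completed_ring_def dest!: spec[of _ 1])
  ultimately show "completed_measure e B \<le> completed_measure f B"
    unfolding completed_measure_def[of f] by (intro cInf_greatest) auto
qed

lemma finite_distortion_completed_eq:
  fixes e f :: "nat \<Rightarrow> 'a::{real_inner, complete_space}"
  assumes e: "orthonormal_basis e" and f: "orthonormal_basis f" and fd: "finite_distortion e f"
  shows "completed_ring e = completed_ring f"
    and "A \<in> completed_ring e \<Longrightarrow> completed_measure e A = completed_measure f A"
proof -
  obtain \<sigma> T where \<sigma>: "bij \<sigma>" and T: "\<And>m. (\<Sum>i<m. \<Sum>j<m. off_diagonal (e \<circ> \<sigma>) f i j) \<le> T"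
    by (rule finite_distortion_matching[OF e f fd]) blast
  let ?e = "e \<circ> \<sigma>"
  have e': "orthonormal_basis ?e" by (rule orthonormal_basis_reindex[OF \<sigma> e])
  have T': "(\<Sum>i<m. \<Sum>j<m. off_diagonal f ?e i j) \<le> T" for m using T[of m] off_diagonal_swap[of f ?e m] by simp
  \<comment> \<open>The rectangle ring and its measure do not depend on the enumeration, so the
    matching may permute \<open>e\<close> freely.\<close>
  have ring: "completed_ring ?e = completed_ring e"
    unfolding completed_ring_def rectangle_ring_reindex[OF \<sigma>] ring_measure_reindex[OF \<sigma>] ..
  have meas: "completed_measure ?e = completed_measure e"
    unfolding completed_measure_def rectangle_ring_reindex[OF \<sigma>] ring_measure_reindex[OF \<sigma>] ..
  show eq: "completed_ring e = completed_ring f"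
    using matched_completed_le(1)[OF e' f T] matched_completed_le(1)[OF f e' T'] unfolding ring by blast
  show "completed_measure e A = completed_measure f A" if "A \<in> completed_ring e"
    using matched_completed_le(2)[OF e' f T, of A] matched_completed_le(2)[OF f e' T', of A] that
    unfolding ring meas eq by simp
qed

theorem theorem6p1:
  fixes e f :: "nat \<Rightarrow> 'a::{real_inner, complete_space, second_countable_topology}"
  assumes infinite_dim: "\<nexists>B::'a set. finite B \<and> span B = UNIV"
    and e: "orthonormal_basis e"
    and f: "orthonormal_basis f"
  shows "(\<forall>A\<in>completed_ring e \<inter> completed_ring f. completed_measure e A = completed_measure f A) \<and>
    ((\<Prod>j. \<Sum>i. ennreal \<bar>e i \<bullet> f j\<bar>) < \<infinity> \<longrightarrow>
       completed_ring e = completed_ring f \<and>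
       (\<forall>A\<in>completed_ring e. completed_measure e A = completed_measure f A)) \<and>
    (\<not> (\<Prod>j. \<Sum>i. ennreal \<bar>e i \<bullet> f j\<bar>) < \<infinity> \<longrightarrow>
       (\<forall>A\<in>completed_ring e \<inter> completed_ring f.
          completed_measure f A = 0 \<and> completed_measure e A = 0))"
proof -
  have eq: "completed_ring e = completed_ring f \<and> (\<forall>A\<in>completed_ring e. completed_measure e A = completed_measure f A)"
    if "finite_distortion e f"
    using finite_distortion_completed_eq[OF e f that] by blast
  \<comment> \<open>The condition is stated for the ordered pair; its symmetry allows the same
    argument with the bases interchanged to handle the \<open>f\<close>-measure.\<close>
  have zero: "completed_measure f A = 0 \<and> completed_measure e A = 0"
    if "\<not> finite_distortion e f" "A \<in> completed_ring e" "A \<in> completed_ring f" for A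
    using completed_positive_distortion[OF e f that(2,3)] completed_positive_distortion[OF f e that(3,2)]
      finite_distortion_sym[OF e f] that(1) by blast
  have "completed_measure e A = completed_measure f A" if "A \<in> completed_ring e" "A \<in> completed_ring f" for A
  proof (cases "finite_distortion e f")
    case True
    then show ?thesis using eq that(1) by blast
  next
    case False
    then show ?thesis using zero[OF _ that] by simp
  qed
  then show ?thesis
    unfolding prodinf_finite_iff_distortion[OF e f] using eq zero by blast
qed

end
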